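(* Let $\zeta$ denote the Riemann zeta function. For every real $t \geq 3$, $$|\zeta(1+it)| \leq \frac{1}{2}\log t + 1.57.$$ Furthermore, for every real $t \geq 10^8$, $$|\zeta(1+it)| \leq \frac{1}{3}\log t + 2\log\log t - 1.16.$$
   Context: $\log$ denotes the natural logarithm. *)

theory Defs
  imports "HOL-Complex_Analysis.Complex_Analysis" "HOL-Real_Asymp.Real_Asymp"
begin

text \<open>The Riemann zeta function is the analytic continuation to the plane minus the point 1 of the
  Dirichlet series. The value 0 at the pole is a convention that only serves to
  make the function unique.\<close>

definition is_riemann_zeta :: "(complex \<Rightarrow> complex) \<Rightarrow> bool" where
  "is_riemann_zeta f \<longleftrightarrow>
     f holomorphic_on (- {1}) \<and>
     (\<forall>s. Re s > 1 \<longrightarrow> (\<lambda>n. 1 / of_nat (Suc n) powr s) sums f s) \<and>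
     f 1 = 0"

definition zeta :: "complex \<Rightarrow> complex" where
  "zeta = (THE f. is_riemann_zeta f)"

text \<open>The remainder of this theory shows that \<^term>\<open>zeta\<close> is well defined. For existence, one
  expands \<open>(n + 2)\<close> to the power \<open>1 - s\<close> around \<open>n + 1\<close>, sums over \<open>n\<close>, and so
  expresses \<open>(s - 1) zeta(s)\<close> through the values at \<open>s + 1, s + 2, \<dots>\<close> and a
  holomorphic remainder.\<close>

lemma is_riemann_zeta_unique:
  assumes f: "is_riemann_zeta f" and g: "is_riemann_zeta g"
  shows "f = g"
proof
  fix z :: complex
  show "f z = g z"
  proof (cases "z = 1")
    case True
    then show ?thesis using f g by (simp add: is_riemann_zeta_def)
  next
    case False
    have op: "open {s. Re s > 1}"
      by (simp add: open_halfspace_Re_gt)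
    have conn: "connected (- {1::complex})"
      by (rule connected_punctured_universe) simp
    have ne: "{s. Re s > 1} \<noteq> {}"
      by (auto intro!: exI[of _ "2::complex"])
    show ?thesis
    proof (rule analytic_continuation_open[OF op _ ne conn, of f g])
      show "f holomorphic_on - {1}" "g holomorphic_on - {1}"
        using f g by (auto simp: is_riemann_zeta_def)
      show "f z = g z" if "z \<in> {s. Re s > 1}" for z
        using f g that unfolding is_riemann_zeta_def by (meson mem_Collect_eq sums_unique2)
    qed (use False in auto)
  qed
qed

definition falling :: "complex \<Rightarrow> nat \<Rightarrow> complex" where
  "falling a i = (\<Prod>j<i. a - of_nat j)"

lemma falling_Suc: "falling a (Suc i) = falling a i * (a - of_nat i)"
  by (simp add: falling_def)

lemma falling_0 [simp]: "falling a 0 = 1"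
  by (simp add: falling_def)

lemma holomorphic_falling [holomorphic_intros]:
  "f holomorphic_on S \<Longrightarrow> (\<lambda>s. falling (f s) i) holomorphic_on S"
  unfolding falling_def by (intro holomorphic_intros)

lemma binomial_remainder:
  fixes R :: real and K :: nat
  assumes R: "R \<ge> 0"
  obtains C where "C \<ge> 0"
    "\<And>a x. norm a \<le> R \<Longrightarrow> x \<in> {0..1::real} \<Longrightarrow>
       norm ((1 + of_real x) powr a - (\<Sum>i\<le>K. falling a i / fact i * of_real x ^ i)) \<le> C * x ^ Suc K"
proof -
  define B where "B = (\<Prod>j<Suc K. R + real j) * 2 powr R"
  have B0: "B \<ge> 0" unfolding B_def using R by (intro mult_nonneg_nonneg prod_nonneg) auto
  have "norm ((1 + of_real x) powr a - (\<Sum>i\<le>K. falling a i / fact i * of_real x ^ i)) \<le> B * x ^ Suc K"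
    if a: "norm a \<le> R" and x: "x \<in> {0..1::real}" for a x
  proof -
    define S where "S = closed_segment (0::complex) 1"
    define f where "f = (\<lambda>i w. falling a i * (1 + w) powr (a - of_nat i))"
    have S: "w \<in> S \<longleftrightarrow> (\<exists>u\<in>{0..1}. w = of_real u)" for w
      unfolding S_def by (auto simp: closed_segment_def scaleR_conv_of_real)
    have der: "(f i has_field_derivative f (Suc i) w) (at w within S)" if "w \<in> S" for i w
    proof -
      have "1 + w \<notin> \<real>\<^sub>\<le>\<^sub>0"
        using that by (auto simp: S complex_nonpos_Reals_iff)
      then show ?thesis
        unfolding f_def falling_Suc
        by (auto intro!: derivative_eq_intros simp: algebra_simps)
    qed
    have bd: "norm (f (Suc K) w) \<le> B" if "w \<in> S" for w
    proof -
      obtain u where u: "u \<in> {0..1}" "w = of_real u" using \<open>w \<in> S\<close> S by auto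
      have 1: "norm (falling a (Suc K)) \<le> (\<Prod>j<Suc K. R + real j)"
        unfolding falling_def prod_norm[symmetric]
      proof (rule prod_mono, safe)
        fix j
        show "norm (a - of_nat j) \<le> R + real j"
          using norm_triangle_ineq4[of a "of_nat j"] a by simp
      qed auto
      have "norm ((1 + w) powr (a - of_nat (Suc K))) = (1 + u) powr (Re a - real (Suc K))"
        using u by (subst norm_powr_real_powr) simp_all
      also have "\<dots> \<le> (1 + u) powr R"
        using u a complex_Re_le_cmod[of a] by (intro powr_mono) auto
      also have "\<dots> \<le> 2 powr R"
        using u R by (intro powr_mono2) auto
      finally have 2: "norm ((1 + w) powr (a - of_nat (Suc K))) \<le> 2 powr R" .
      show ?thesis
        unfolding f_def B_def norm_mult
        using R by (intro mult_mono 1 2 prod_nonneg) auto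
    qed
    have "norm (f 0 (of_real x) - (\<Sum>i\<le>K. f i 0 * (of_real x - 0) ^ i / fact i))
        \<le> B * norm (of_real x - 0 :: complex) ^ Suc K / fact K"
      by (rule complex_Taylor[of S K f B 0 "of_real x"]) (use der bd x in \<open>auto simp: S S_def[symmetric]\<close>, auto simp: S_def)
    also have "\<dots> \<le> B * x ^ Suc K"
    proof -
      have "B * x ^ Suc K / fact K \<le> B * x ^ Suc K / 1"
        using B0 x by (intro divide_left_mono) auto
      then show ?thesis using x by simp
    qed
    finally show ?thesis
      by (simp add: f_def)
  qed
  with B0 show ?thesis using that by blast
qed

definition zeta_rem :: "nat \<Rightarrow> nat \<Rightarrow> complex \<Rightarrow> complex" where
  "zeta_rem K n s = of_nat (n + 2) powr (1 - s)
     - (\<Sum>i\<le>K. falling (1 - s) i / fact i * of_nat (Suc n) powr (1 - s - of_nat i))"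

lemma zeta_rem_bound:
  assumes R: "R \<ge> 0"
  obtains C where "C \<ge> 0"
    "\<And>s n. norm (1 - s) \<le> R \<Longrightarrow> norm (zeta_rem K n s) \<le> C * real (Suc n) powr (- Re s - real K)"
proof -
  obtain C where C: "C \<ge> 0" "\<And>a x. norm a \<le> R \<Longrightarrow> x \<in> {0..1::real} \<Longrightarrow>
       norm ((1 + of_real x) powr a - (\<Sum>i\<le>K. falling a i / fact i * of_real x ^ i)) \<le> C * x ^ Suc K"
    using binomial_remainder[OF R, of K] by blast
  have "norm (zeta_rem K n s) \<le> C * real (Suc n) powr (- Re s - real K)" if s: "norm (1 - s) \<le> R" for s n
  proof -
    define N where "N = real (Suc n)"
    define x where "x = 1 / N"
    have N: "N \<ge> 1" by (simp add: N_def)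
    have x: "x \<in> {0..1}" using N by (simp add: x_def)
    have eq1: "of_nat (n + 2) powr (1 - s) = of_real N powr (1 - s) * (1 + of_real x) powr (1 - s)"
    proof -
      have "complex_of_nat (n + 2) = of_real N * of_real (1 + x)"
        unfolding x_def N_def by (simp add: field_simps del: of_nat_Suc flip: of_real_mult of_real_add)
          (simp add: algebra_simps)
      also have "\<dots> powr (1 - s) = of_real N powr (1 - s) * of_real (1 + x) powr (1 - s)"
        using N x by (intro powr_times_real) auto
      finally show ?thesis by simp
    qed
    have eq2: "of_nat (Suc n) powr (1 - s - of_nat i) = of_real N powr (1 - s) * of_real x ^ i" for i
    proof -
      have "of_nat (Suc n) = complex_of_real N" by (simp add: N_def)
      then show ?thesis
        using N by (simp add: powr_diff x_def power_divide powr_nat')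
    qed
    have "zeta_rem K n s = of_real N powr (1 - s) *
        ((1 + of_real x) powr (1 - s) - (\<Sum>i\<le>K. falling (1 - s) i / fact i * of_real x ^ i))"
      unfolding zeta_rem_def eq1 eq2 by (simp add: sum_distrib_left right_diff_distrib mult_ac)
    also have "norm \<dots> \<le> N powr (1 - Re s) * (C * x ^ Suc K)"
    proof -
      have "norm (of_real N powr (1 - s)) = N powr (1 - Re s)"
        using N by (subst norm_powr_real_powr) auto
      then show ?thesis
        unfolding norm_mult by (simp only:) (intro mult_left_mono C(2) s x, simp)
    qed
    also have "N powr (1 - Re s) * (C * x ^ Suc K) = C * (N powr (1 - Re s) * N powr (- real (Suc K)))"
      using N by (simp add: x_def powr_minus powr_realpow power_divide divide_inverse power_inverse del: power_Suc of_nat_Suc)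
    also have "N powr (1 - Re s) * N powr (- real (Suc K)) = N powr (- Re s - real K)"
      by (simp flip: powr_add)
    finally show ?thesis by (simp add: N_def)
  qed
  with C(1) show ?thesis using that by blast
qed

lemma zeta_rem_sums:
  obtains G where "G holomorphic_on {s. Re s > 1 - real K}"
    "\<And>s. Re s > 1 - real K \<Longrightarrow> (\<lambda>n. zeta_rem K n s) sums G s"
proof -
  let ?S = "{s. Re s > 1 - real K}"
  have op: "open ?S" by (simp add: open_halfspace_Re_gt)
  obtain g where g: "\<forall>x\<in>?S. ((\<lambda>n. zeta_rem K n x) sums g x) \<and> g field_differentiable (at x)"
  proof (rule series_differentiable_comparison_complex[OF op, of "zeta_rem K"])
    show "zeta_rem K n field_differentiable (at x)" if "x \<in> ?S" for n x
    proof -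
      have "zeta_rem K n holomorphic_on UNIV"
        unfolding zeta_rem_def by (intro holomorphic_intros) (auto simp: complex_nonpos_Reals_iff)
      then show ?thesis by (simp add: holomorphic_on_def)
    qed
    show "\<exists>d h. 0 < d \<and> summable h \<and> range h \<subseteq> \<real>\<^sub>\<ge>\<^sub>0 \<and>
            (\<forall>\<^sub>F n in sequentially. \<forall>y\<in>ball x d \<inter> ?S. cmod (zeta_rem K n y) \<le> cmod (h n))"
      if x: "x \<in> ?S" for x
    proof -
      define d where "d = (Re x - (1 - real K)) / 2"
      have d: "d > 0" using x by (simp add: d_def)
      define e where "e = - (Re x - d) - real K"
      have e: "e < -1" using x by (simp add: e_def d_def field_simps)
      obtain C where C: "C \<ge> 0" "\<And>s n. norm (1 - s) \<le> norm (1 - x) + d \<Longrightarrow>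
          norm (zeta_rem K n s) \<le> C * real (Suc n) powr (- Re s - real K)"
        using zeta_rem_bound[of "norm (1 - x) + d" K] d by (metis add_nonneg_nonneg norm_ge_zero order_less_imp_le)
      define h where "h = (\<lambda>n. complex_of_real (C * real (Suc n) powr e))"
      have "summable (\<lambda>n. real (Suc n) powr e)"
        using e summable_Suc_iff[of "\<lambda>n. real n powr e"] by (simp add: summable_real_powr_iff del: of_nat_Suc)
      then have "summable h"
        unfolding h_def by (intro summable_of_real summable_mult)
      moreover have "range h \<subseteq> \<real>\<^sub>\<ge>\<^sub>0"
        using C(1) unfolding h_def by (auto simp del: of_nat_Suc of_real_mult)
      moreover have "cmod (zeta_rem K n y) \<le> cmod (h n)" if y: "y \<in> ball x d" for n y
      proof -
        have dy: "norm (x - y) < d" using y by (simp add: dist_norm)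
        have "norm (1 - y) \<le> norm (1 - x) + norm (x - y)"
          using norm_triangle_ineq[of "1 - x" "x - y"] by simp
        then have "norm (zeta_rem K n y) \<le> C * real (Suc n) powr (- Re y - real K)"
          using dy by (intro C(2)) simp
        also have "\<dots> \<le> C * real (Suc n) powr e"
          using dy abs_Re_le_cmod[of "x - y"] C(1)
          by (intro mult_left_mono powr_mono) (auto simp: e_def)
        also have "\<dots> = cmod (h n)"
          using C(1) unfolding h_def norm_of_real by simp
        finally show ?thesis .
      qed
      ultimately show ?thesis
        using d by (intro exI[of _ d] exI[of _ h] conjI always_eventually) auto
    qed
  qed
  have "g holomorphic_on ?S"
    using g by (auto simp: holomorphic_on_def intro: field_differentiable_at_within)
  with g show ?thesis using that by auto
qed

definition zeta_series :: "complex \<Rightarrow> complex" where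
  "zeta_series s = (\<Sum>n. of_nat (Suc n) powr (- s))"

lemma zeta_series_sums:
  assumes "Re s > 1"
  shows "(\<lambda>n. of_nat (Suc n) powr (- s)) sums zeta_series s"
proof -
  have "summable (\<lambda>n. real n powr (- Re s))"
    using assms by (simp add: summable_real_powr_iff)
  also have "(\<lambda>n. real n powr (- Re s)) = (\<lambda>n. norm (of_nat n powr (- s) :: complex))"
    by (rule ext, subst norm_powr_real_powr) auto
  finally have "summable (\<lambda>n. of_nat n powr (- s) :: complex)"
    by (rule summable_norm_cancel)
  then have "summable (\<lambda>n. of_nat (Suc n) powr (- s) :: complex)"
    by (subst summable_Suc_iff)
  then show ?thesis unfolding zeta_series_def by (rule summable_sums)
qed

lemma zeta_series_recursion:
  assumes s: "Re s > 1" and G: "(\<lambda>n. zeta_rem (Suc m) n s) sums g"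
  shows "(s - 1) * zeta_series s = g + 1 -
     (\<Sum>j=1..m. falling (1 - s) j / fact (Suc j) * ((s + of_nat j - 1) * zeta_series (s + of_nat j)))"
proof -
  let ?T = "\<lambda>j. falling (1 - s) j / fact (Suc j) * ((s + of_nat j - 1) * zeta_series (s + of_nat j))"
  have lim: "(\<lambda>n. of_nat (Suc n) powr (1 - s) :: complex) \<longlonglongrightarrow> 0"
  proof (rule tendsto_norm_zero_cancel)
    have "(\<lambda>n. real (Suc n) powr (1 - Re s)) \<longlonglongrightarrow> 0"
      using s by real_asymp
    also have "(\<lambda>n. real (Suc n) powr (1 - Re s)) = (\<lambda>n. norm (of_nat (Suc n) powr (1 - s) :: complex))"
      by (rule ext, subst norm_powr_real_powr) auto
    finally show "(\<lambda>n. norm (of_nat (Suc n) powr (1 - s) :: complex)) \<longlonglongrightarrow> 0" .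
  qed
  have tele: "(\<lambda>n. of_nat (Suc (Suc n)) powr (1 - s) - of_nat (Suc n) powr (1 - s) :: complex) sums (0 - of_nat (Suc 0) powr (1 - s))"
    by (rule telescope_sums[OF lim])
  have *: "(\<lambda>n. \<Sum>j\<le>m. falling (1 - s) (Suc j) / fact (Suc j) * of_nat (Suc n) powr (- (s + of_nat j)))
          sums (\<Sum>j\<le>m. falling (1 - s) (Suc j) / fact (Suc j) * zeta_series (s + of_nat j))"
    using s by (intro sums_sum sums_mult zeta_series_sums) auto
  have "(\<lambda>n. zeta_rem (Suc m) n s) sums ((0 - of_nat (Suc 0) powr (1 - s)) -
          (\<Sum>j\<le>m. falling (1 - s) (Suc j) / fact (Suc j) * zeta_series (s + of_nat j)))"
    using sums_diff[OF tele *]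
  proof (rule sums_cong[THEN iffD1, rotated])
    fix n
    have eq: "of_nat (Suc n) powr (1 - s - of_nat (Suc j)) = (of_nat (Suc n) powr (- (s + of_nat j)) :: complex)" for j
      by (rule arg_cong[where f = "\<lambda>w. of_nat (Suc n) powr w"]) simp
    then show "of_nat (Suc (Suc n)) powr (1 - s) - of_nat (Suc n) powr (1 - s) -
        (\<Sum>j\<le>m. falling (1 - s) (Suc j) / fact (Suc j) * of_nat (Suc n) powr (- (s + of_nat j))) = zeta_rem (Suc m) n s"
      unfolding zeta_rem_def by (subst sum.atMost_Suc_shift) (simp only: eq, simp del: of_nat_Suc fact_Suc)
  qed
  then have "g = - 1 - (\<Sum>j\<le>m. falling (1 - s) (Suc j) / fact (Suc j) * zeta_series (s + of_nat j))"
    using G sums_unique2 by fastforce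
  also have "(\<Sum>j\<le>m. falling (1 - s) (Suc j) / fact (Suc j) * zeta_series (s + of_nat j)) = (\<Sum>j\<le>m. - ?T j)"
    by (intro sum.cong refl) (simp add: falling_Suc field_simps del: fact_Suc)
  also have "(\<Sum>j\<le>m. - ?T j) = - ?T 0 + (\<Sum>j=1..m. - ?T j)"
    by (simp only: atMost_atLeast0) (subst sum.atLeast_Suc_atMost, simp, simp only: One_nat_def)
  finally show ?thesis by (simp add: sum_negf del: fact_Suc)
qed

lemma zeta_continuation_step:
  "\<exists>h. h holomorphic_on {s. Re s > - real m} \<and> (\<forall>s. Re s > 1 \<longrightarrow> h s = (s - 1) * zeta_series s)"
proof (induction m)
  case 0
  obtain G where G: "G holomorphic_on {s. Re s > 1 - real (Suc 0)}"
    "\<And>s. Re s > 1 - real (Suc 0) \<Longrightarrow> (\<lambda>n. zeta_rem (Suc 0) n s) sums G s"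
    using zeta_rem_sums[of "Suc 0"] by blast
  show ?case
  proof (intro exI[of _ "\<lambda>s. G s + 1"] conjI allI impI)
    show "(\<lambda>s. G s + 1) holomorphic_on {s. - real 0 < Re s}"
      using G(1) by (intro holomorphic_intros) simp
    show "G s + 1 = (s - 1) * zeta_series s" if "1 < Re s" for s
      using zeta_series_recursion[OF that G(2)] that by simp
  qed
next
  case (Suc m)
  then obtain h where h: "h holomorphic_on {s. Re s > - real m}"
    "\<And>s. Re s > 1 \<Longrightarrow> h s = (s - 1) * zeta_series s" by blast
  obtain G where G: "G holomorphic_on {s. Re s > 1 - real (Suc (Suc m))}"
    "\<And>s. Re s > 1 - real (Suc (Suc m)) \<Longrightarrow> (\<lambda>n. zeta_rem (Suc (Suc m)) n s) sums G s"
    using zeta_rem_sums[of "Suc (Suc m)"] by blast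
  let ?h = "\<lambda>s. G s + 1 - (\<Sum>j=1..Suc m. falling (1 - s) j / fact (Suc j) * h (s + of_nat j))"
  show ?case
  proof (intro exI[of _ ?h] conjI allI impI)
    have "(\<lambda>s. h (s + of_nat j)) holomorphic_on {s. - real (Suc m) < Re s}" if "j \<in> {1..Suc m}" for j
    proof -
      have "(h \<circ> (\<lambda>s. s + of_nat j)) holomorphic_on {s. - real (Suc m) < Re s}"
        using that by (intro holomorphic_on_compose_gen[OF _ h(1)] holomorphic_intros) auto
      then show ?thesis by (simp add: o_def)
    qed
    moreover have "G holomorphic_on {s. - real (Suc m) < Re s}"
      using G(1) by simp
    ultimately show "?h holomorphic_on {s. - real (Suc m) < Re s}"
      by (intro holomorphic_intros) (auto simp del: fact_Suc)
    show "?h s = (s - 1) * zeta_series s" if s: "1 < Re s" for s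
    proof -
      have "(\<lambda>n. zeta_rem (Suc (Suc m)) n s) sums G s" using s by (intro G(2)) auto
      from zeta_series_recursion[OF s this] show ?thesis
        using s by (simp add: h(2) del: fact_Suc sum.cl_ivl_Suc)
    qed
  qed
qed

lemma ex_is_riemann_zeta: "\<exists>f. is_riemann_zeta f"
proof -
  obtain H where H: "\<And>m. H m holomorphic_on {s. Re s > - real m}"
    "\<And>m s. Re s > 1 \<Longrightarrow> H m s = (s - 1) * zeta_series s"
    using zeta_continuation_step by metis
  have agree: "H m s = H n s" if "m \<le> n" "Re s > - real m" for m n s
  proof (rule analytic_continuation_open[of "{s. Re s > 1}" "{s. Re s > - real m}" "H m" "H n"])
    show "connected {s. Re s > - real m}"
      by (intro convex_connected convex_halfspace_Re_gt)
    show "{s. Re s > 1} \<noteq> {}"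
      by (auto intro!: exI[of _ "2::complex"])
    show "H n holomorphic_on {s. Re s > - real m}"
      by (rule holomorphic_on_subset[OF H(1)]) (use that in auto)
  qed (use H that in \<open>auto simp: open_halfspace_Re_gt\<close>)
  define F where "F = (\<lambda>s. H (nat \<lceil>\<bar>Re s\<bar>\<rceil> + 1) s)"
  have F: "F s = H m s" if "Re s > - real m" for m s
  proof -
    have "Re s > - real (nat \<lceil>\<bar>Re s\<bar>\<rceil> + 1)" by linarith
    then show ?thesis
      unfolding F_def using that agree by (metis nle_le)
  qed
  have "F holomorphic_on (\<Union>m. {s. Re s > - real m})"
  proof (rule holomorphic_on_UN_open)
    show "F holomorphic_on {s. Re s > - real m}" for m
      using H(1)[of m] by (rule holomorphic_transform) (use F in auto)
  qed (simp add: open_halfspace_Re_gt)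
  moreover have "s \<in> (\<Union>m. {s. Re s > - real m})" for s
    using reals_Archimedean2[of "- Re s"] by (auto simp: minus_less_iff)
  ultimately have holF: "F holomorphic_on S" for S
    by (meson holomorphic_on_subset subsetI)
  define f where "f = (\<lambda>s. if s = 1 then 0 else F s / (s - 1))"
  have "(\<lambda>s. F s / (s - 1)) holomorphic_on - {1}"
    by (intro holomorphic_intros holF) auto
  then have "f holomorphic_on - {1}"
    by (rule holomorphic_transform) (auto simp: f_def)
  moreover have "(\<lambda>n. 1 / of_nat (Suc n) powr s) sums f s" if "Re s > 1" for s
  proof -
    have "s \<noteq> 1" using that by auto
    moreover have "F s = (s - 1) * zeta_series s"
      using F[of 0 s] H(2)[of s 0] that by simp
    ultimately have "f s = zeta_series s" by (simp add: f_def)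
    then show ?thesis
      using zeta_series_sums[OF that] by (simp add: powr_minus divide_inverse)
  qed
  ultimately have "is_riemann_zeta f" by (auto simp: is_riemann_zeta_def f_def)
  then show ?thesis by blast
qed

theorem is_riemann_zeta_zeta: "is_riemann_zeta zeta"
  unfolding zeta_def
  by (rule theI'[of is_riemann_zeta]) (use ex_is_riemann_zeta is_riemann_zeta_unique in blast)

end

theory Submission
  imports Defs
begin

text \<open>
  Put \<open>z n = n powr (\<i> * t)\<close>. Up to an explicit term at infinity, the value \<open>zeta (1 + \<i> * t)\<close> is the limit of
  the conjugates of the sums of \<open>z n / n\<close>. The terms with \<open>n < c * sqrt t\<close> are estimated trivially and give
  \<open>ln t / 2 + ln c\<close> and Euler's constant. For the others one sums by parts: \<open>z n\<close> is essentially
  \<open>z (n + 1) - z n\<close> times a cotangent of half the phase increment, and the cotangent has bounded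
  variation except near the points \<open>t / (2 * pi * k)\<close> where the phase is stationary. Each of these
  points contributes a constant multiple of \<open>1 / sqrt t\<close>, and there are \<open>O(sqrt t)\<close> of them, so that
  the tail is bounded by an absolute constant. This gives the first bound, and for \<open>t\<close> just above
  \<open>10 ^ 8\<close> also the second one.

  For larger \<open>t\<close> the trivial estimate is used only up to \<open>n < 3 * t powr (1 / 3)\<close>. The terms between this
  point and a multiple of \<open>sqrt t\<close> are divided into geometric blocks. On each block van der Corput's
  inequality reduces the sum to the correlations of \<open>z\<close> with its shifts, and these are
  estimated by the summation by parts from before. The blocks add up to a constant, so one
  obtains \<open>ln t / 3 + 4.4\<close>.
\<close>

section \<open>Exponential sums near one stationary point\<close>

text \<open>Summation by parts is applied to the averages \<open>(z n + z (n + 1)) / 2\<close>,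
  because for them the kernel is exactly a cotangent. That kernel vanishes halfway between two
  stationary points, so the range can be cut there without boundary losses and each section treated
  alone. The cut-off \<open>d\<close> of the pole balances the variation of the kernel, of order
  \<open>1 / d\<close>, against the bump, of order \<open>d\<close>; this is the origin of
  \<open>sqrt (3 / t)\<close> and of \<open>sqrt (3 * l) / 2\<close>.

  The number \<open>K\<close> of stationary points kept is the second parameter: each further point
  costs a constant over \<open>sqrt t\<close>, but it shortens the range estimated before them. When
  that range costs a logarithm, \<open>K\<close> is about \<open>0.16 * sqrt t\<close>; once
  differencing has made it cheap, \<open>0.06 * sqrt t\<close> is used.

  The two estimates have to overlap. The bound \<open>ln t / 2 + 1.49\<close> is good enough for the
  second claim up to \<open>4.8 * 10 ^ 8\<close>, with very little to spare there, and the
  differenced bound starts at \<open>782 ^ 3 = 478211768\<close>. The numerical constants of the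
  block estimate are rounded with this start in view.\<close>

text \<open>Abel summation in which a potential \<open>V\<close> replaces the total variation: its
  drop pays for each step of \<open>w\<close>, and \<open>U - V a\<close> pays for the left boundary
  value. The right boundary term stays inside the norm, so that near infinity it can be compared
  with its limit instead of being bounded.\<close>

lemma norm_sum_mult_diff_le:
  fixes w V :: "nat \<Rightarrow> real" and z :: "nat \<Rightarrow> complex"
  assumes "a \<le> m" and z: "\<And>n. norm (z n) \<le> 1"
    and step: "\<And>n. a \<le> n \<Longrightarrow> n < m \<Longrightarrow> \<bar>w (Suc n) - w n\<bar> \<le> V n - V (Suc n)"
    and init: "\<bar>w a\<bar> \<le> U - V a"
  shows "norm ((\<Sum>n=a..m. of_real (w n) * (z (Suc n) - z n)) - of_real (w m) * z (Suc m)) \<le> U - V m"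
  using \<open>a \<le> m\<close> step
proof (induction m rule: dec_induct)
  case base
  have "\<bar>w a\<bar> * norm (z a) \<le> \<bar>w a\<bar> * 1" by (intro mult_left_mono z) auto
  then show ?case using init by (simp add: algebra_simps norm_mult)
next
  case (step m)
  let ?S = "\<lambda>m. (\<Sum>n=a..m. of_real (w n) * (z (Suc n) - z n)) - of_real (w m) * z (Suc m)"
  have "?S (Suc m) = ?S m + of_real (w m - w (Suc m)) * z (Suc m)"
    using step.hyps by (simp add: algebra_simps)
  then have "norm (?S (Suc m)) \<le> norm (?S m) + \<bar>w m - w (Suc m)\<bar> * norm (z (Suc m))"
    using norm_triangle_ineq[of "?S m" "of_real (w m - w (Suc m)) * z (Suc m)"]
    by (simp add: norm_mult del: of_real_diff)
  also have "\<dots> \<le> (U - V m) + \<bar>w m - w (Suc m)\<bar> * 1"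
    using step by (intro add_mono mult_left_mono z) auto
  also have "\<dots> \<le> U - V (Suc m)"
    using step.prems[of m] step.hyps by (simp add: abs_minus_commute)
  finally show ?case .
qed

text \<open>Here the right boundary term is paid for as well: \<open>U - U'\<close> accounts for the
  variation of \<open>w\<close> together with its jumps from and to 0 at the two ends.\<close>

lemma norm_sum_mult_diff_le':
  fixes w V :: "nat \<Rightarrow> real" and z :: "nat \<Rightarrow> complex"
  assumes z: "\<And>n. norm (z n) \<le> 1"
    and step: "\<And>n. a \<le> n \<Longrightarrow> Suc n < b \<Longrightarrow> \<bar>w (Suc n) - w n\<bar> \<le> V n - V (Suc n)"
    and init: "\<And>n. a \<le> n \<Longrightarrow> n < b \<Longrightarrow> \<bar>w n\<bar> \<le> U - V n"
    and last: "\<And>n. a \<le> n \<Longrightarrow> n < b \<Longrightarrow> \<bar>w n\<bar> \<le> V n - U'"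
    and U: "U' \<le> U"
  shows "norm (\<Sum>n=a..<b. of_real (w n) * (z (Suc n) - z n)) \<le> U - U'"
proof (cases "a < b")
  case True
  then obtain m where m: "b = Suc m" "a \<le> m" by (cases b) auto
  let ?S = "\<Sum>n=a..m. of_real (w n) * (z (Suc n) - z n)"
  have "norm (?S - of_real (w m) * z (Suc m)) \<le> U - V m"
    using m step init z by (intro norm_sum_mult_diff_le) auto
  moreover have "norm (of_real (w m) * z (Suc m)) \<le> \<bar>w m\<bar> * 1"
    unfolding norm_mult by (simp add: mult_left_le z)
  ultimately have "norm ?S \<le> (U - V m) + (V m - U')"
    using last[of m] m norm_triangle_ineq[of "?S - of_real (w m) * z (Suc m)" "of_real (w m) * z (Suc m)"]
    by simp
  then show ?thesis using m by (simp add: atLeastLessThanSuc_atLeastAtMost)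
qed (use U in auto)

lemma norm_sum_mult_diff_antimono_le:
  fixes g :: "nat \<Rightarrow> real" and z :: "nat \<Rightarrow> complex"
  assumes z: "\<And>n. norm (z n) \<le> 1"
    and g: "\<And>n. a \<le> n \<Longrightarrow> Suc n < b \<Longrightarrow> g (Suc n) \<le> g n" "\<And>n. a \<le> n \<Longrightarrow> n < b \<Longrightarrow> 0 \<le> g n \<and> g n \<le> B" "0 \<le> B"
  shows "norm (\<Sum>n=a..<b. of_real (g n) * (z (Suc n) - z n)) \<le> 2 * B"
proof -
  have "norm (\<Sum>n=a..<b. of_real (g n) * (z (Suc n) - z n)) \<le> 2 * B - 0"
    by (rule norm_sum_mult_diff_le'[where V = g]) (use z g in force)+
  then show ?thesis by simp
qed

text \<open>Abel's inequality. It restores the weight \<open>lg\<close> on the block sums, which are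
  estimated without weight.\<close>

lemma norm_sum_antimono_mult_le:
  fixes g :: "nat \<Rightarrow> real" and c :: "nat \<Rightarrow> complex"
  assumes g: "\<And>n. a \<le> n \<Longrightarrow> Suc n < b \<Longrightarrow> g (Suc n) \<le> g n" "\<And>n. a \<le> n \<Longrightarrow> n < b \<Longrightarrow> 0 \<le> g n"
    and B: "\<And>m. m \<le> b \<Longrightarrow> norm (\<Sum>n=a..<m. c n) \<le> B" and "a < b"
  shows "norm (\<Sum>n=a..<b. of_real (g n) * c n) \<le> g a * B"
proof -
  have B0: "B \<ge> 0" using B[of a] \<open>a < b\<close> by simp
  have *: "norm ((\<Sum>n=a..m. of_real (g n) * c n) - of_real (g m) * (\<Sum>n=a..m. c n)) \<le> (g a - g m) * B"
    if "a \<le> m" "m < b" for m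
    using that
  proof (induction m rule: dec_induct)
    case (step m)
    let ?D = "\<lambda>m. (\<Sum>n=a..m. of_real (g n) * c n) - of_real (g m) * (\<Sum>n=a..m. c n)"
    have "?D (Suc m) = ?D m + of_real (g m - g (Suc m)) * (\<Sum>n=a..m. c n)"
      using step.hyps by (simp add: algebra_simps)
    also have "norm \<dots> \<le> norm (?D m) + \<bar>g m - g (Suc m)\<bar> * norm (\<Sum>n=a..m. c n)"
      by (rule order_trans[OF norm_triangle_ineq]) (simp only: norm_mult norm_of_real order_refl)
    also have "\<dots> \<le> (g a - g m) * B + (g m - g (Suc m)) * B"
      using step g(1)[of m] B[of "Suc m"] by (intro add_mono mult_mono) (auto simp: atLeastLessThanSuc_atLeastAtMost)
    finally show ?case by (simp add: algebra_simps)
  qed simp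
  obtain m where m: "b = Suc m" "a \<le> m" using \<open>a < b\<close> by (cases b) auto
  let ?S = "\<Sum>n=a..m. of_real (g n) * c n" and ?C = "\<Sum>n=a..m. c n"
  have "norm ?S \<le> norm (?S - of_real (g m) * ?C) + norm (of_real (g m) * ?C)"
    using norm_triangle_ineq[of "?S - of_real (g m) * ?C" "of_real (g m) * ?C"] by simp
  also have "\<dots> \<le> (g a - g m) * B + g m * B"
    using *[of m] m g(2)[of m] B[of b] B0
    by (intro add_mono) (auto simp: norm_mult atLeastLessThanSuc_atLeastAtMost intro!: mult_left_mono)
  finally show ?thesis using m by (simp add: algebra_simps atLeastLessThanSuc_atLeastAtMost)
qed

section \<open>The damped cotangent kernel: variation and error\<close>

lemma cot_antimono:
  assumes "0 < v" "v \<le> u" "u \<le> pi / 2"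
  shows "cot u \<le> cot (v::real)"
proof -
  have "sin v > 0" "sin u > 0" using assms pi_gt_zero by (auto intro!: sin_gt_zero)
  moreover have "cos u \<le> cos v" "sin v \<le> sin u" "cos u \<ge> 0"
    using assms by (auto intro!: cos_monotone_0_pi_le sin_monotone_2pi_le cos_ge_zero)
  ultimately show ?thesis unfolding cot_def by (intro frac_le) auto
qed

lemma cot_nonneg: "0 < u \<Longrightarrow> u \<le> pi / 2 \<Longrightarrow> cot u \<ge> (0::real)"
  by (auto simp: cot_def intro!: divide_nonneg_pos cos_ge_zero sin_gt_zero)

text \<open>The derivative has the sign of \<open>sin x * cos x - x\<close>. Because the weight is
  an affine function of the phase, monotonicity of \<open>u * cot u\<close> is needed in addition to
  that of \<open>cot u\<close>.\<close>

lemma mult_cot_antimono: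
  assumes "0 < v" "v \<le> u" "u \<le> pi / 2"
  shows "u * cot u \<le> v * cot (v::real)"
proof (rule DERIV_nonpos_imp_nonincreasing[where f = "\<lambda>x. x * cot x"])
  fix x assume x: "v \<le> x" "x \<le> u"
  have s: "sin x > 0" using x assms pi_gt_zero by (auto intro!: sin_gt_zero)
  have "((\<lambda>x. x * cot x) has_real_derivative cot x + x * (- inverse ((sin x)\<^sup>2))) (at x)"
    using s by (auto intro!: derivative_eq_intros DERIV_cot)
  moreover have "cot x + x * (- inverse ((sin x)\<^sup>2)) \<le> 0"
  proof -
    have "cos x * sin x \<le> 1 * sin x" using s by (intro mult_right_mono) auto
    also have "\<dots> \<le> x" using x assms by (auto intro!: sin_x_le_x)
    finally show ?thesis using s by (simp add: cot_def field_simps power2_eq_square)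
  qed
  ultimately show "\<exists>y. ((\<lambda>x. x * cot x) has_real_derivative y) (at x) \<and> y \<le> 0" by blast
qed (use assms in auto)

lemma cot_le_inverse: "0 < u \<Longrightarrow> u < pi / 2 \<Longrightarrow> cot u \<le> 1 / (u::real)"
proof -
  assume u: "0 < u" "u < pi / 2"
  have s: "sin u > 0" "cos u > 0" using u by (auto intro!: sin_gt_zero cos_gt_zero)
  have "tan u > u"
  proof -
    have "\<exists>z>0. z < u \<and> tan u - tan 0 = (u - 0) * inverse ((cos z)\<^sup>2)"
      using u by (intro MVT2 DERIV_tan) (auto simp: less_imp_neq[THEN not_sym] cos_gt_zero_pi)
    then obtain x where x: "0 < x" "x < u" "tan u = u * inverse ((cos x)\<^sup>2)" by auto
    have "cos x > 0" "cos x < 1" using x u by (auto intro!: cos_gt_zero) (smt (verit) cos_monotone_0_pi cos_zero pi_half_less_two pi_gt3)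
    then have "inverse ((cos x)\<^sup>2) > 1" by (simp add: one_less_inverse_iff power_less_one_iff)
    then show ?thesis using x u by simp
  qed
  then show ?thesis using s u by (simp add: cot_def tan_def field_simps)
qed

text \<open>If \<open>z (n + 1) = z n * cis (2 * u n)\<close>, then \<open>(z n + z (n + 1)) / 2\<close> is
  \<open>- (\<i> / 2) * cot (u n) * (z (n + 1) - z n)\<close>. Cutting the pole of \<open>cot\<close> off linearly keeps the variation
  of the kernel finite; the error that this causes is a bump of height 1, which is smaller than the
  error of a sharp cut-off.\<close>

definition damped_cot :: "real \<Rightarrow> real \<Rightarrow> real" where
  "damped_cot d u = (if \<bar>u\<bar> < d then cot d * u / d else cot u)"

text \<open>The factor \<open>p + c * u\<close> is the weight, nonnegative by
  \<open>c * pi <= p\<close>. The weighted kernel is 0 at \<open>- pi / 2\<close>, falls to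
  \<open>- (p - c * d) * cot d\<close> at \<open>- d\<close>, rises to
  \<open>(p + c * d) * cot d\<close> at \<open>d\<close> and falls back to 0 at
  \<open>pi / 2\<close>. Its variation is therefore \<open>4 * p * cot d\<close>, the distance of
  the two outer constants in the conclusion.\<close>

lemma damped_cot_variation:
  fixes p c d :: real
  assumes d: "0 < d" "d < pi / 2" and c: "0 \<le> c" "c * pi \<le> p"
  obtains V where
    "\<And>u v. - pi / 2 \<le> v \<Longrightarrow> v \<le> u \<Longrightarrow> u \<le> pi / 2 \<Longrightarrow>
       \<bar>(p + c * v) * damped_cot d v - (p + c * u) * damped_cot d u\<bar> \<le> V u - V v"
    "\<And>u. - pi / 2 \<le> u \<Longrightarrow> u \<le> pi / 2 \<Longrightarrow>
       \<bar>(p + c * u) * damped_cot d u\<bar> \<le> 2 * cot d * (p + c * d) - V u"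
    "\<And>u. - pi / 2 \<le> u \<Longrightarrow> u \<le> pi / 2 \<Longrightarrow>
       \<bar>(p + c * u) * damped_cot d u\<bar> \<le> V u + 2 * cot d * (p - c * d)"
proof -
  define P where "P = cot d"
  \<comment> \<open>The weighted kernel \<open>w\<close> is the difference of two increasing functions \<open>s\<close> and \<open>r\<close>,
    and \<open>V = s + r\<close>.\<close>
  define cl where "cl = (\<lambda>u. max (-d) (min d u))"
  define s where "s = (\<lambda>u. (p + c * cl u) * cl u * (P / d))"
  define w where "w = (\<lambda>u. (p + c * u) * damped_cot d u)"
  define r where "r = (\<lambda>u. s u - w u)"
  have P: "P \<ge> 0" unfolding P_def using d by (intro cot_nonneg) auto
  have p: "p \<ge> 0" using c by (smt (verit) mult_nonneg_nonneg pi_ge_zero)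
  have cd: "p - c * x \<ge> 0" if "x \<le> pi / 2" for x
  proof -
    have "c * x \<le> c * pi" using that c pi_gt_zero by (intro mult_left_mono) linarith+
    then show ?thesis using c by simp
  qed
  have s_mid: "s u = w u" if "\<bar>u\<bar> < d" for u
    using that d by (simp add: s_def w_def damped_cot_def cl_def P_def)
  have s_hi: "s u = (p + c * d) * P" if "u \<ge> d" for u
    using that d by (simp add: s_def cl_def)
  have s_lo: "s u = - ((p - c * d) * P)" if "u \<le> - d" for u
    using that d by (simp add: s_def cl_def)
  have s_mono: "s v \<le> s u" if "v \<le> u" for u v
  proof -
    have "cl v \<le> cl u" "- d \<le> cl v" "cl u \<le> d" "- d \<le> cl u" "cl v \<le> d"
      using that d by (auto simp: cl_def)
    \<comment> \<open>The increment of \<open>(p + c * x) * x\<close> factors as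
      \<open>(cl u - cl v) * (p + c * (cl u + cl v))\<close>, and \<open>cl u + cl v\<close> stays
      above \<open>- pi\<close>, so that \<open>c * pi <= p\<close> makes the second factor
      nonnegative.\<close>
    moreover from this have "c * (- (cl u + cl v)) \<le> c * pi"
      using d c by (intro mult_left_mono) auto
    ultimately have "0 \<le> (cl u - cl v) * (p + c * (cl u + cl v))"
      using c by (intro mult_nonneg_nonneg) (auto simp: algebra_simps)
    then have "(p + c * cl v) * cl v \<le> (p + c * cl u) * cl u"
      by (simp add: algebra_simps)
    then show ?thesis
      unfolding s_def using P d by (intro mult_right_mono) auto
  qed
  have w_hi: "w u \<le> w v" if "d \<le> v" "v \<le> u" "u \<le> pi / 2" for u v
  proof -
    have "c * (u * cot u) \<le> c * (v * cot v)"
      using that d c by (intro mult_left_mono mult_cot_antimono) auto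
    moreover have "p * cot u \<le> p * cot v"
      using that d p by (intro mult_left_mono cot_antimono) auto
    ultimately show ?thesis using that d by (simp add: w_def damped_cot_def algebra_simps)
  qed
  have w_lo: "w u \<le> w v" if "u \<le> - d" "v \<le> u" "- pi / 2 \<le> v" for u v
  proof -
    have "(p - c * (-v)) * cot (-v) \<le> (p - c * (-u)) * cot (-u)"
      using that d c cd[of "-u"] by (intro mult_mono cot_antimono cot_nonneg) (auto intro!: mult_left_mono)
    then show ?thesis using that d by (simp add: w_def damped_cot_def)
  qed
  have wd: "w d = (p + c * d) * P" "w (-d) = - ((p - c * d) * P)"
    using d by (simp_all add: w_def damped_cot_def P_def)
  have r_mid: "r u = 0" if "\<bar>u\<bar> \<le> d" for u
    using that s_mid[of u] s_hi[of u] s_lo[of u] wd by (cases "\<bar>u\<bar> < d") (auto simp: r_def abs_if split: if_splits)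
  have r_hi: "0 \<le> r u" if "d \<le> u" "u \<le> pi / 2" for u
    using w_hi[of d u] that s_hi[of u] by (simp add: r_def wd)
  have r_lo: "r u \<le> 0" if "u \<le> - d" "- pi / 2 \<le> u" for u
    using w_lo[of "-d" u] that s_lo[of u] by (simp add: r_def wd)
  have r_mono: "r v \<le> r u" if "- pi / 2 \<le> v" "v \<le> u" "u \<le> pi / 2" for u v
  proof -
    consider "u \<le> -d" | "v \<le> -d" "-d \<le> u" "u \<le> d" | "v \<le> -d" "d \<le> u" | "-d \<le> v" "u \<le> d"
      | "-d \<le> v" "v \<le> d" "d \<le> u" | "d \<le> v" by linarith
    then show ?thesis
    proof cases
      case 1 then show ?thesis using w_lo[of u v] that s_lo[of u] s_lo[of v] by (simp add: r_def)
    next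
      case 2 then show ?thesis using r_lo[of v] r_mid[of u] that by (simp add: abs_le_iff)
    next
      case 3 then show ?thesis using r_lo[of v] r_hi[of u] that by simp
    next
      case 4 then show ?thesis using r_mid[of v] r_mid[of u] that by (simp add: abs_le_iff)
    next
      case 5 then show ?thesis using r_mid[of v] r_hi[of u] that by (simp add: abs_le_iff)
    next
      case 6 then show ?thesis using w_hi[of v u] that s_hi[of u] s_hi[of v] by (simp add: r_def)
    qed
  qed
  have s_bd: "s u \<le> (p + c * d) * P" "- ((p - c * d) * P) \<le> s u" for u
    using s_mono[of u d] s_mono[of d u] s_hi[of u] s_hi[of d] s_lo[of u] s_mono[of "-d" u] s_lo[of "-d"]
    by linarith+
  have r_bd: "r u \<le> (p + c * d) * P" "- ((p - c * d) * P) \<le> r u" if "- pi / 2 \<le> u" "u \<le> pi / 2" for u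
  proof -
    have w0: "w (pi / 2) = 0" "w (- pi / 2) = 0"
      using d by (simp_all add: w_def damped_cot_def cot_def)
    have "r (pi / 2) = (p + c * d) * P" "r (- pi / 2) = - ((p - c * d) * P)"
      using w0 s_hi[of "pi / 2"] s_lo[of "- pi / 2"] d by (simp_all add: r_def)
    then show "r u \<le> (p + c * d) * P" "- ((p - c * d) * P) \<le> r u"
      using r_mono[of u "pi / 2"] r_mono[of "- pi / 2" u] that by auto
  qed
  have wsr: "w u = s u - r u" for u by (simp add: r_def)
  show ?thesis
  proof (rule that[of "\<lambda>u. s u + r u"])
    fix u v :: real assume uv: "- pi / 2 \<le> v" "v \<le> u" "u \<le> pi / 2"
    show "\<bar>(p + c * v) * damped_cot d v - (p + c * u) * damped_cot d u\<bar> \<le> s u + r u - (s v + r v)"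
      using s_mono[of v u] r_mono[of v u] uv wsr[of u] wsr[of v] unfolding w_def by linarith
  next
    fix u :: real assume u: "- pi / 2 \<le> u" "u \<le> pi / 2"
    show "\<bar>(p + c * u) * damped_cot d u\<bar> \<le> 2 * cot d * (p + c * d) - (s u + r u)"
      using s_bd[of u] r_bd[of u] u wsr[of u] unfolding w_def P_def by (simp add: algebra_simps)
    show "\<bar>(p + c * u) * damped_cot d u\<bar> \<le> s u + r u + 2 * cot d * (p - c * d)"
      using s_bd[of u] r_bd[of u] u wsr[of u] unfolding w_def P_def by (simp add: algebra_simps)
  qed
qed

lemma sin_concave_0: "0 \<le> u \<Longrightarrow> u \<le> d \<Longrightarrow> 0 < d \<Longrightarrow> d \<le> pi / 2 \<Longrightarrow> sin u \<ge> u / d * sin (d::real)"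
proof -
  assume *: "0 \<le> u" "u \<le> d" "0 < d" "d \<le> pi / 2"
  show ?thesis
  proof (cases "u = 0")
    case False
    then have u: "u > 0" using * by simp
    have s: "sin u > 0" "sin d > 0" using u * pi_gt_zero by (auto intro!: sin_gt_zero)
    have "sin d / d \<le> sin u / u"
    proof (rule DERIV_nonpos_imp_nonincreasing[where f = "\<lambda>x. sin x / x"])
      fix x assume x: "u \<le> x" "x \<le> d"
      have x0: "x > 0" using x u by simp
      have "((\<lambda>x. sin x / x) has_real_derivative (cos x * x - sin x) / (x * x)) (at x)"
        using x0 by (auto intro!: derivative_eq_intros)
      moreover have "cos x * x - sin x \<le> 0"
      proof (cases "x = pi / 2")
        case False
        then have "x < pi / 2" using x * by simp
        moreover from this have "cot x \<le> 1 / x" using x0 by (intro cot_le_inverse)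
        moreover have "sin x > 0" using x0 x * pi_gt_zero by (intro sin_gt_zero) auto
        ultimately show ?thesis using x0 by (simp add: cot_def field_simps)
      next
        case True
        show ?thesis unfolding True by simp
      qed
      ultimately show "\<exists>y. ((\<lambda>x. sin x / x) has_real_derivative y) (at x) \<and> y \<le> 0"
        using x0 by (intro exI conjI) (auto intro!: divide_nonpos_nonneg)
    qed (use * in auto)
    then show ?thesis using u * by (simp add: field_simps)
  qed auto
qed

text \<open>Outside the cut-off \<open>cot u * sin u = cos u\<close> leaves no error. Inside, the
  chord bound for the sine is used twice: at \<open>u / 2\<close> it gives
  \<open>cos u <= 1 - (u / d)^2 * (1 - cos d)\<close>, and at \<open>u\<close> it gives
  \<open>cot d * u / d * sin u >= (u / d)^2 * cos d\<close>. In the difference the terms with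
  \<open>cos d\<close> cancel.\<close>

lemma damped_cot_error:
  assumes d: "0 < d" "d < pi / 2" and u: "- pi / 2 \<le> u" "u \<le> pi / 2"
  shows "0 \<le> cos u - damped_cot d u * sin u" "cos u - damped_cot d u * sin u \<le> max 0 (1 - (u / d)\<^sup>2)"
proof -
  have main: "0 \<le> cos u - cot d * u / d * sin u \<and> cos u - cot d * u / d * sin u \<le> 1 - (u / d)\<^sup>2"
    if u: "0 \<le> u" "u < d" for u
  proof -
    have c: "cos d > 0" "sin d > 0" "cos u > 0" using d u by (auto intro!: cos_gt_zero_pi sin_gt_zero)
    have s: "sin u \<ge> u / d * sin d" using u d by (intro sin_concave_0) auto
    have "sin (u / 2) \<ge> (u / 2) / (d / 2) * sin (d / 2)"
      using u d by (intro sin_concave_0) auto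
    then have "sin (u / 2) \<ge> (u / d) * sin (d / 2)" using d by simp
    moreover have "sin (d / 2) \<ge> 0" using d by (intro sin_ge_zero) auto
    ultimately have "(u / d * sin (d / 2))\<^sup>2 \<le> (sin (u / 2))\<^sup>2"
      using u d by (intro power_mono) auto
    moreover have "cos u = 1 - 2 * (sin (u / 2))\<^sup>2" "cos d = 1 - 2 * (sin (d / 2))\<^sup>2"
      using cos_double_sin[of "u / 2"] cos_double_sin[of "d / 2"] by simp_all
    moreover have "(u / d * sin (d / 2))\<^sup>2 = (u / d)\<^sup>2 * (sin (d / 2))\<^sup>2"
      by (rule power_mult_distrib)
    ultimately have 1: "cos u \<le> 1 - (u / d)\<^sup>2 * (1 - cos d)"
      by simp
    have "cot d * (u / d) * (u / d * sin d) \<le> cot d * (u / d) * sin u"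
      using s d u cot_nonneg[of d] by (intro mult_left_mono) auto
    then have "(u / d)\<^sup>2 * cos d \<le> cot d * u / d * sin u"
      using c by (simp add: cot_def power2_eq_square mult_ac)
    with 1 have A: "cos u - cot d * u / d * sin u \<le> 1 - (u / d)\<^sup>2" by (simp add: algebra_simps)
    have "cot d * u / d * sin u \<le> cos u"
    proof (cases "u = 0")
      case False
      then have "u > 0" "sin u > 0" using u d by (auto intro!: sin_gt_zero)
      have "cot d * (u / d) \<le> cot u * 1"
        using u d \<open>u > 0\<close> by (intro mult_mono cot_antimono cot_nonneg) auto
      then have "cot d * (u / d) * sin u \<le> cot u * sin u"
        using \<open>sin u > 0\<close> by (intro mult_right_mono) auto
      then show ?thesis using \<open>sin u > 0\<close> by (simp add: cot_def)
    qed simp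
    with A show ?thesis by simp
  qed
  have "0 \<le> cos u - damped_cot d u * sin u \<and> cos u - damped_cot d u * sin u \<le> max 0 (1 - (u / d)\<^sup>2)"
  proof (cases "\<bar>u\<bar> < d")
    case True
    then show ?thesis
      using main[of u] main[of "-u"] by (cases "u \<ge> 0") (auto simp: damped_cot_def max_def)
  next
    case False
    then have "sin \<bar>u\<bar> > 0" using d u pi_gt_zero by (intro sin_gt_zero) auto
    then have "sin u \<noteq> 0" by (auto simp: abs_if split: if_splits)
    then show ?thesis using False by (simp add: damped_cot_def cot_def)
  qed
  then show "0 \<le> cos u - damped_cot d u * sin u" "cos u - damped_cot d u * sin u \<le> max 0 (1 - (u / d)\<^sup>2)"
    by auto
qed


section \<open>Sums over the bump, and the estimate for one section\<close>

text \<open>Comparison of a sum with an integral. \<open>G n\<close> is at most \<open>E\<close>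
  times the step from \<open>u n\<close> down to \<open>u (Suc n)\<close>, and over this step the
  bump is smallest at \<open>u n\<close>. The last index has no step after it and is charged
  \<open>B\<close>.\<close>

lemma sum_bump_le:
  fixes G u :: "nat \<Rightarrow> real"
  assumes d: "0 < d" and E: "0 \<le> E" and B: "0 \<le> B"
    and anti: "\<And>n. a \<le> n \<Longrightarrow> Suc n < b \<Longrightarrow> u (Suc n) \<le> u n"
    and nonneg: "\<And>n. a \<le> n \<Longrightarrow> n < b \<Longrightarrow> 0 \<le> u n"
    and gap: "\<And>n. a \<le> n \<Longrightarrow> Suc n < b \<Longrightarrow> u n < d \<Longrightarrow> G n \<le> E * (u n - u (Suc n))"
    and G: "\<And>n. a \<le> n \<Longrightarrow> n < b \<Longrightarrow> u n < d \<Longrightarrow> G n \<le> B"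
  shows "(\<Sum>n=a..<b. G n * max 0 (1 - (u n / d)\<^sup>2)) \<le> B + E * (2 * d / 3)"
proof (cases "a < b")
  case True
  \<comment> \<open>The integral of \<open>max 0 (1 - (x / d)^2)\<close> from 0 to \<open>x\<close>;
    it is constantly \<open>2 * d / 3\<close> from \<open>d\<close> on.\<close>
  define Phi where "Phi = (\<lambda>x. let y = min x d in y - y ^ 3 / (3 * d\<^sup>2))"
  have Phi0: "0 \<le> Phi x" "Phi x \<le> 2 * d / 3" if "0 \<le> x" for x
  proof -
    define y where "y = min x d / d"
    have y: "0 \<le> y" "y \<le> 1" "min x d = d * y" using that d by (auto simp: y_def)
    have P: "Phi x = d * (y - y ^ 3 / 3)"
      using d unfolding Phi_def Let_def y by (simp add: power_mult_distrib field_simps power2_eq_square power3_eq_cube)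
    have "y ^ 3 \<le> y" using y power_decreasing[of 1 3 y] by simp
    then have "0 \<le> y - y ^ 3 / 3" using y by linarith
    then show "0 \<le> Phi x" using P d by simp
    have "0 \<le> (1 - y)\<^sup>2 * (2 + y)" using y by simp
    then have "y - y ^ 3 / 3 \<le> 2 / 3" by (simp add: algebra_simps power2_eq_square power3_eq_cube)
    then have "d * (y - y ^ 3 / 3) \<le> d * (2 / 3)" using d by (intro mult_left_mono) auto
    then show "Phi x \<le> 2 * d / 3" using P by simp
  qed
  have Phi_diff: "(x - y) * (1 - (x / d)\<^sup>2) \<le> Phi x - Phi y" if "0 \<le> y" "y \<le> x" "x < d" for x y
  proof -
    define e where "e = 1 / (3 * d\<^sup>2)"
    have P: "Phi x = x - e * x ^ 3" "Phi y = y - e * y ^ 3" "(x / d)\<^sup>2 = 3 * e * x\<^sup>2"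
      using that by (simp_all add: Phi_def e_def power_divide)
    have "Phi x - Phi y - (x - y) * (1 - (x / d)\<^sup>2) = e * ((x - y)\<^sup>2 * (2 * x + y))"
      unfolding P by algebra
    also have "\<dots> \<ge> 0" using that by (simp add: e_def)
    finally show ?thesis by simp
  qed
  have mono: "Phi y \<le> Phi x" if "0 \<le> y" "y \<le> x" for x y
  proof -
    have *: "Phi y \<le> Phi x" if "0 \<le> y" "y \<le> x" "x < d" for x y
    proof -
      have "0 \<le> (x - y) * (1 - (x / d)\<^sup>2)"
        using that d by (intro mult_nonneg_nonneg) (auto simp: power_le_one)
      then show ?thesis using Phi_diff[OF that] by simp
    qed
    show ?thesis
    proof (cases "x < d")
      case False
      then have "Phi x = d - d ^ 3 / (3 * d\<^sup>2)" by (simp add: Phi_def)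
      also have "d ^ 3 / (3 * d\<^sup>2) = d / 3" using d by (simp add: power2_eq_square power3_eq_cube)
      finally have "Phi x = 2 * d / 3" by simp
      then show ?thesis using Phi0[of y] that by simp
    qed (use * that in auto)
  qed
  obtain m where m: "b = Suc m" "a \<le> m" using True by (cases b) auto
  have "(\<Sum>n=a..<m. G n * max 0 (1 - (u n / d)\<^sup>2)) \<le> (\<Sum>n=a..<m. E * (Phi (u n) - Phi (u (Suc n))))"
  proof (rule sum_mono)
    fix n assume n: "n \<in> {a..<m}"
    have u: "0 \<le> u (Suc n)" "u (Suc n) \<le> u n" using n m anti[of n] nonneg[of "Suc n"] by auto
    show "G n * max 0 (1 - (u n / d)\<^sup>2) \<le> E * (Phi (u n) - Phi (u (Suc n)))"
    proof (cases "u n < d")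
      case True
      have "(u n / d)\<^sup>2 \<le> 1" using u True d by (intro power_le_one) auto
      then have "G n * max 0 (1 - (u n / d)\<^sup>2) = G n * (1 - (u n / d)\<^sup>2)" "0 \<le> 1 - (u n / d)\<^sup>2" by auto
      moreover from this(2) have "G n * (1 - (u n / d)\<^sup>2) \<le> E * (u n - u (Suc n)) * (1 - (u n / d)\<^sup>2)"
        using gap[of n] n m True by (intro mult_right_mono) auto
      moreover have "E * ((u n - u (Suc n)) * (1 - (u n / d)\<^sup>2)) \<le> E * (Phi (u n) - Phi (u (Suc n)))"
        using u True by (intro mult_left_mono Phi_diff E) auto
      ultimately show ?thesis by (simp add: mult.assoc)
    next
      case False
      then have "1 \<le> (u n / d)\<^sup>2" using d by (intro one_le_power) auto
      then have "max 0 (1 - (u n / d)\<^sup>2) = 0" by simp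
      then show ?thesis using mono[of "u (Suc n)" "u n"] u E by simp
    qed
  qed
  also have "\<dots> = E * (Phi (u a) - Phi (u m))"
    using sum_Suc_diff'[of a m "\<lambda>n. - Phi (u n)"] m by (simp flip: sum_distrib_left)
  also have "\<dots> \<le> E * (2 * d / 3)"
    using Phi0[of "u a"] Phi0[of "u m"] nonneg[of a] nonneg[of m] m by (intro mult_left_mono E) auto
  finally have "(\<Sum>n=a..<m. G n * max 0 (1 - (u n / d)\<^sup>2)) \<le> E * (2 * d / 3)" .
  moreover have "G m * max 0 (1 - (u m / d)\<^sup>2) \<le> B"
  proof (cases "u m < d")
    case True
    have "G m * max 0 (1 - (u m / d)\<^sup>2) \<le> B * max 0 (1 - (u m / d)\<^sup>2)"
      using G[of m] True m by (intro mult_right_mono) auto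
    also have "\<dots> \<le> B * 1" using B by (intro mult_left_mono) auto
    finally show ?thesis by simp
  next
    case False
    then have "1 \<le> (u m / d)\<^sup>2" using d by (intro one_le_power) auto
    then show ?thesis using B by simp
  qed
  ultimately show ?thesis using m by (simp add: atLeastLessThanSuc)
qed (use assms in auto)


text \<open>The mirror image under reversal of the index range and \<open>u\<close> to
  \<open>- u\<close>. The end of a step that lies farther from 0 is now the right one, which is why
  the gap condition bounds \<open>G (Suc n)\<close>.\<close>

lemma sum_bump_le':
  fixes G u :: "nat \<Rightarrow> real"
  assumes d: "0 < d" and E: "0 \<le> E" and B: "0 \<le> B"
    and anti: "\<And>n. a \<le> n \<Longrightarrow> Suc n < b \<Longrightarrow> u (Suc n) \<le> u n"
    and nonpos: "\<And>n. a \<le> n \<Longrightarrow> n < b \<Longrightarrow> u n \<le> 0"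
    and gap: "\<And>n. a \<le> n \<Longrightarrow> Suc n < b \<Longrightarrow> - d < u (Suc n) \<Longrightarrow> G (Suc n) \<le> E * (u n - u (Suc n))"
    and G: "\<And>n. a \<le> n \<Longrightarrow> n < b \<Longrightarrow> - d < u n \<Longrightarrow> G n \<le> B"
  shows "(\<Sum>n=a..<b. G n * max 0 (1 - (u n / d)\<^sup>2)) \<le> B + E * (2 * d / 3)"
proof -
  have "(\<Sum>n=a..<b. G n * max 0 (1 - (u n / d)\<^sup>2))
      = (\<Sum>n=a..<b. G (a + b - Suc n) * max 0 (1 - (- u (a + b - Suc n) / d)\<^sup>2))"
    by (subst sum.atLeastLessThan_rev) simp
  also have "\<dots> \<le> B + E * (2 * d / 3)"
  proof (rule sum_bump_le[OF d E B, where G = "\<lambda>n. G (a + b - Suc n)" and u = "\<lambda>n. - u (a + b - Suc n)"])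
    fix n assume n: "a \<le> n" "Suc n < b"
    then have m: "a + b - Suc n = Suc (a + b - Suc (Suc n))" "a \<le> a + b - Suc (Suc n)" "Suc (a + b - Suc (Suc n)) < b" by auto
    show "- u (a + b - Suc (Suc n)) \<le> - u (a + b - Suc n)"
      using anti[OF m(2,3)] by (simp add: m(1))
    show "G (a + b - Suc n) \<le> E * (- u (a + b - Suc n) - - u (a + b - Suc (Suc n)))"
      if "- u (a + b - Suc n) < d"
      using gap[OF m(2,3)] that unfolding m(1) by simp
  qed (use G nonpos in \<open>force+\<close>)
  finally show ?thesis .
qed

lemma cis_double_plus_minus_1:
  "cis (2 * u) + 1 = of_real (2 * cos u) * cis u"
  "cis (2 * u) - 1 = 2 * \<i> * of_real (sin u) * cis u"
  by (simp_all add: complex_eq_iff cos_double sin_double power2_eq_square)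
     (use sin_cos_squared_add[of u] in \<open>simp_all add: power2_eq_square\<close>)

text \<open>On the three summands of the bound: the first is the variation of the damped cotangent, the second
  accounts for the terms next to the stationary point that the comparison with an integral leaves
  over, and the third is the integral of the bump \<open>1 - (u / d)\<^sup>2\<close>.\<close>

lemma cis_sum_section_le:
  fixes p c d E E' :: real and u :: "nat \<Rightarrow> real" and z :: "nat \<Rightarrow> complex"
  assumes d: "0 < d" "d < pi / 2" and c: "0 \<le> c" "c * pi \<le> p" and E: "0 \<le> E" "0 \<le> E'"
    and z: "\<And>n. norm (z n) = 1"
    and zu: "\<And>n. a \<le> n \<Longrightarrow> n < b \<Longrightarrow> z (Suc n) = z n * cis (2 * u n)"
    and u: "\<And>n. a \<le> n \<Longrightarrow> n < b \<Longrightarrow> - pi / 2 \<le> u n \<and> u n \<le> pi / 2"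
    and anti: "\<And>n. a \<le> n \<Longrightarrow> Suc n < b \<Longrightarrow> u (Suc n) \<le> u n"
    and gap: "\<And>n. a \<le> n \<Longrightarrow> Suc n < b \<Longrightarrow> 0 \<le> u (Suc n) \<Longrightarrow> u n < d \<Longrightarrow>
      p + c * u n \<le> E * (u n - u (Suc n))"
    and gap': "\<And>n. a \<le> n \<Longrightarrow> Suc n < b \<Longrightarrow> - d < u (Suc n) \<Longrightarrow> u n \<le> 0 \<Longrightarrow>
      p + c * u (Suc n) \<le> E' * (u n - u (Suc n))"
  shows "norm (\<Sum>n=a..<b. of_real (p + c * u n) * ((z n + z (Suc n)) / 2))
    \<le> 2 * p / d + (2 * p + c * d) + (2 * d / 3) * (E + E')"
proof (cases "a \<le> b")
  case False
  have "p \<ge> 0" using c by (smt (verit) mult_nonneg_nonneg pi_ge_zero)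
  then have "0 \<le> 2 * p / d + (2 * p + c * d) + (2 * d / 3) * (E + E')"
    using d c E by (intro add_nonneg_nonneg mult_nonneg_nonneg divide_nonneg_nonneg) auto
  then show ?thesis using False by simp
next
  case True
  define G where "G = (\<lambda>n. p + c * u n)"
  define w where "w = (\<lambda>n. G n * damped_cot d (u n))"
  define h where "h = (\<lambda>n. G n * (cos (u n) - damped_cot d (u n) * sin (u n)))"
  have p: "p \<ge> 0" using c by (smt (verit) mult_nonneg_nonneg pi_ge_zero)
  have G0: "G n \<ge> 0" if "a \<le> n" "n < b" for n
  proof -
    have "c * (- u n) \<le> c * pi" using u[of n] that c pi_gt_zero by (intro mult_left_mono) auto
    then show ?thesis using c by (simp add: G_def)
  qed
  \<comment> \<open>With \<open>e = cis (u n) * z n\<close> the average is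
    \<open>cos (u n) * e\<close> and the difference is \<open>2 * \<i> * sin (u n) * e\<close>. So
    \<open>w\<close> carries the part that can be summed by parts, and \<open>h\<close> is the error
    of the damping.\<close>
  have decomp: "of_real (G n) * ((z n + z (Suc n)) / 2)
      = of_real (h n) * (cis (u n) * z n) + (- \<i> / 2) * (of_real (w n) * (z (Suc n) - z n))"
    if "a \<le> n" "n < b" for n
  proof -
    have "z n + z (Suc n) = (cis (2 * u n) + 1) * z n" "z (Suc n) - z n = (cis (2 * u n) - 1) * z n"
      unfolding zu[OF that] by (simp_all add: algebra_simps)
    then have 2: "z n + z (Suc n) = of_real (2 * cos (u n)) * (cis (u n) * z n)"
      "z (Suc n) - z n = 2 * \<i> * of_real (sin (u n)) * (cis (u n) * z n)"
      unfolding cis_double_plus_minus_1 by (simp_all add: mult.assoc)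
    show ?thesis
      unfolding 2 h_def w_def by (simp add: algebra_simps)
  qed
  obtain V where V:
    "\<And>u v. - pi / 2 \<le> v \<Longrightarrow> v \<le> u \<Longrightarrow> u \<le> pi / 2 \<Longrightarrow>
       \<bar>(p + c * v) * damped_cot d v - (p + c * u) * damped_cot d u\<bar> \<le> V u - V v"
    "\<And>u. - pi / 2 \<le> u \<Longrightarrow> u \<le> pi / 2 \<Longrightarrow>
       \<bar>(p + c * u) * damped_cot d u\<bar> \<le> 2 * cot d * (p + c * d) - V u"
    "\<And>u. - pi / 2 \<le> u \<Longrightarrow> u \<le> pi / 2 \<Longrightarrow>
       \<bar>(p + c * u) * damped_cot d u\<bar> \<le> V u + 2 * cot d * (p - c * d)"
    using damped_cot_variation[OF d c] by blast
  have cot: "0 \<le> cot d" "cot d \<le> 1 / d"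
    using d by (auto intro!: cot_nonneg cot_le_inverse)
  have "norm (\<Sum>n=a..<b. of_real (w n) * (z (Suc n) - z n))
      \<le> 2 * cot d * (p + c * d) - (- (2 * cot d * (p - c * d)))"
  proof (rule norm_sum_mult_diff_le'[where V = "\<lambda>n. V (u n)"])
    show "\<bar>w (Suc n) - w n\<bar> \<le> V (u n) - V (u (Suc n))" if "a \<le> n" "Suc n < b" for n
      unfolding w_def G_def using that u[of n] u[of "Suc n"] anti[of n] by (intro V(1)) auto
    show "\<bar>w n\<bar> \<le> 2 * cot d * (p + c * d) - V (u n)" if "a \<le> n" "n < b" for n
      unfolding w_def G_def using that u[of n] by (intro V(2)) auto
    show "\<bar>w n\<bar> \<le> V (u n) - - (2 * cot d * (p - c * d))" if "a \<le> n" "n < b" for n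
      unfolding w_def G_def using that u[of n] V(3)[of "u n"] by simp
    show "- (2 * cot d * (p - c * d)) \<le> 2 * cot d * (p + c * d)"
      using cot p mult_nonneg_nonneg[of "cot d" p] by (simp add: algebra_simps)
  qed (simp add: z)
  also have "\<dots> = 4 * (p * cot d)" by (simp add: algebra_simps)
  also have "\<dots> \<le> 4 * (p * (1 / d))" using cot p by (intro mult_left_mono) auto
  finally have W: "norm (\<Sum>n=a..<b. of_real (w n) * (z (Suc n) - z n)) \<le> 4 * p / d" by simp
  have anti': "u n \<le> u m" if "a \<le> m" "m \<le> n" "n < b" for m n
    using that(2,1,3)
  proof (induction n rule: dec_induct)
    case (step n)
    then show ?case using anti[of n] by (meson Suc_lessD le_trans order_trans)
  qed simp
  \<comment> \<open>The sign change of \<open>u\<close>, that is, the stationary point; it equals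
    \<open>b\<close> if \<open>u\<close> stays nonnegative. The two one-sided bump estimates apply
    left and right of it.\<close>
  define m where "m = (LEAST n. a \<le> n \<and> (b \<le> n \<or> u n < 0))"
  have m: "a \<le> m" "b \<le> m \<or> u m < 0" "m \<le> b"
    using LeastI[of "\<lambda>n. a \<le> n \<and> (b \<le> n \<or> u n < 0)" b]
      Least_le[of "\<lambda>n. a \<le> n \<and> (b \<le> n \<or> u n < 0)" b] True unfolding m_def by auto
  have lt: "0 \<le> u n" if "a \<le> n" "n < m" for n
    using not_less_Least[of n "\<lambda>n. a \<le> n \<and> (b \<le> n \<or> u n < 0)"] that unfolding m_def by auto
  have ge: "u n \<le> 0" if "m \<le> n" "n < b" for n
    using anti'[of m n] that m by auto
  have "(\<Sum>n=a..<b. h n) \<le> (\<Sum>n=a..<b. G n * max 0 (1 - (u n / d)\<^sup>2))"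
    unfolding h_def using d u G0 by (intro sum_mono mult_left_mono damped_cot_error) auto
  also have "\<dots> = (\<Sum>n=a..<m. G n * max 0 (1 - (u n / d)\<^sup>2)) + (\<Sum>n=m..<b. G n * max 0 (1 - (u n / d)\<^sup>2))"
    using m by (simp add: sum.atLeastLessThan_concat)
  also have "\<dots> \<le> ((p + c * d) + E * (2 * d / 3)) + (p + E' * (2 * d / 3))"
  proof (rule add_mono[OF sum_bump_le sum_bump_le'])
    show "G n \<le> p + c * d" if "u n < d" for n
      using that c by (auto simp: G_def intro!: mult_left_mono)
    show "G n \<le> p" if "m \<le> n" "n < b" for n
      using ge[OF that] c by (simp add: G_def mult_nonneg_nonpos)
    show "G n \<le> E * (u n - u (Suc n))" if "a \<le> n" "Suc n < m" "u n < d" for n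
      using gap[of n] that lt[of "Suc n"] m unfolding G_def by auto
    show "G (Suc n) \<le> E' * (u n - u (Suc n))" if "m \<le> n" "Suc n < b" "- d < u (Suc n)" for n
      using gap'[of n] that ge[of n] m unfolding G_def by auto
  qed (use d E p c m lt ge anti in auto)
  finally have H: "(\<Sum>n=a..<b. h n) \<le> (2 * p + c * d) + (2 * d / 3) * (E + E')"
    by (simp add: algebra_simps add_divide_distrib)
  have h0: "0 \<le> h n" if "a \<le> n" "n < b" for n
    unfolding h_def using that d u G0 by (intro mult_nonneg_nonneg damped_cot_error) auto
  have "(\<Sum>n=a..<b. of_real (G n) * ((z n + z (Suc n)) / 2))
      = (\<Sum>n=a..<b. of_real (h n) * (cis (u n) * z n)) + (- \<i> / 2) * (\<Sum>n=a..<b. of_real (w n) * (z (Suc n) - z n))"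
    unfolding sum_distrib_left sum.distrib[symmetric] by (intro sum.cong refl decomp) auto
  also have "norm \<dots> \<le> norm (\<Sum>n=a..<b. of_real (h n) * (cis (u n) * z n)) +
      norm ((- \<i> / 2) * (\<Sum>n=a..<b. of_real (w n) * (z (Suc n) - z n)))"
    by (rule norm_triangle_ineq)
  also have "norm (\<Sum>n=a..<b. of_real (h n) * (cis (u n) * z n)) \<le> (\<Sum>n=a..<b. h n)"
    using h0 z by (intro sum_norm_le) (auto simp: norm_mult)
  also have "norm ((- \<i> / 2) * (\<Sum>n=a..<b. of_real (w n) * (z (Suc n) - z n))) \<le> 2 * p / d"
    using W by (simp add: norm_mult norm_divide)
  finally show ?thesis using H unfolding G_def by simp
qed

section \<open>The tail of the zeta series on the line of real part one\<close>

text \<open>The Dirichlet series has no limit at this point; the added term cancels the oscillation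
  of its partial sums. For \<open>Re s > 1\<close> the sum \<open>G\<close> of the first-order
  remainders satisfies \<open>(s - 1) * zeta s = G s + 1\<close>. Both sides are continuous at
  \<open>1 + \<i> * t\<close>, so the identity extends there along \<open>sk\<close>, and the
  partial sums of the remainders telescope to the stated expression.\<close>

lemma zeta_eq_limit:
  fixes t :: real
  assumes t: "t \<noteq> 0"
  shows "(\<lambda>N. (\<Sum>n=1..<Suc N. cis (- t * ln (real n)) / of_nat n) + cis (- t * ln (real (Suc N))) / (\<i> * of_real t))
    \<longlonglongrightarrow> zeta (1 + \<i> * of_real t)"
proof -
  define s0 where "s0 = 1 + \<i> * complex_of_real t"
  obtain G where G: "G holomorphic_on {s. Re s > 1 - real 1}"
    "\<And>s. Re s > 1 - real 1 \<Longrightarrow> (\<lambda>n. zeta_rem 1 n s) sums G s"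
    using zeta_rem_sums[of 1] by blast
  have zeta: "zeta holomorphic_on - {1}" "\<And>s. Re s > 1 \<Longrightarrow> (\<lambda>n. 1 / of_nat (Suc n) powr s) sums zeta s"
    using is_riemann_zeta_zeta by (auto simp: is_riemann_zeta_def)
  have eq: "(s - 1) * zeta s = G s + 1" if s: "Re s > 1" for s
  proof -
    have "zeta s = zeta_series s"
      using sums_unique2[OF zeta(2)[OF s]] zeta_series_sums[OF s]
      by (simp add: powr_minus divide_inverse)
    moreover have "(\<lambda>n. zeta_rem (Suc 0) n s) sums G s" using G(2)[of s] s by simp
    ultimately show ?thesis using zeta_series_recursion[of s 0 "G s"] s by simp
  qed
  define sk where "sk = (\<lambda>k. s0 + of_real (1 / real (Suc k)))"
  have sk: "sk \<longlonglongrightarrow> s0"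
  proof -
    have "(\<lambda>k. s0 + of_real (1 / real (Suc k))) \<longlonglongrightarrow> s0 + of_real 0"
      by (intro tendsto_intros) real_asymp
    then show ?thesis by (simp add: sk_def)
  qed
  have "isCont zeta s0"
    using zeta(1) t by (intro holomorphic_on_imp_continuous_on[THEN continuous_on_interior, of _ "- {1}"])
      (auto simp: s0_def interior_open[OF open_Compl])
  moreover have "isCont G s0"
    using G(1) by (intro holomorphic_on_imp_continuous_on[THEN continuous_on_interior, of _ "{s. Re s > 0}"])
      (auto simp: s0_def interior_open open_halfspace_Re_gt)
  ultimately have z: "(\<lambda>k. zeta (sk k)) \<longlonglongrightarrow> zeta s0" and g: "(\<lambda>k. G (sk k)) \<longlonglongrightarrow> G s0"
    using sk by (simp_all add: isCont_tendsto_compose)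
  have "(\<lambda>k. (sk k - 1) * zeta (sk k)) \<longlonglongrightarrow> (s0 - 1) * zeta s0"
    by (intro tendsto_intros sk z)
  moreover have "(\<lambda>k. G (sk k) + 1) \<longlonglongrightarrow> G s0 + 1" by (intro tendsto_intros g)
  moreover have "(\<lambda>k. (sk k - 1) * zeta (sk k)) = (\<lambda>k. G (sk k) + 1)"
    by (intro ext eq) (simp add: sk_def s0_def del: of_nat_Suc)
  ultimately have "(s0 - 1) * zeta s0 = G s0 + 1" using LIMSEQ_unique by metis
  then have Gz: "G s0 = \<i> * t * zeta s0 - 1" by (simp add: s0_def)
  have pw: "of_nat (Suc n) powr (- \<i> * t) = cis (- t * ln (real (Suc n)))" for n
  proof -
    have "Ln (of_nat (Suc n)) = of_real (ln (real (Suc n)))" by (rule Ln_of_nat) simp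
    then show ?thesis unfolding powr_def cis_conv_exp by (simp add: mult_ac del: of_nat_Suc)
  qed
  have rem: "zeta_rem 1 n s0 = cis (- t * ln (real (Suc (Suc n)))) - cis (- t * ln (real (Suc n)))
      + \<i> * t * (cis (- t * ln (real (Suc n))) / of_nat (Suc n))" for n
  proof -
    have 1: "1 - s0 = - \<i> * t" by (simp add: s0_def)
    have 2: "of_nat (Suc n) powr (- \<i> * t - 1) = cis (- t * ln (real (Suc n))) / of_nat (Suc n)"
      unfolding powr_diff pw by (simp del: of_nat_Suc)
    have 3: "(\<Sum>i\<le>1. falling a i / fact i * x powr (a - of_nat i)) = x powr a + a * x powr (a - 1)" for a x
      by (simp add: falling_Suc)
    have 4: "n + 2 = Suc (Suc n)" by simp
    show ?thesis
      unfolding zeta_rem_def 3 1 2 4 pw by (simp add: algebra_simps del: of_nat_Suc)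
  qed
  have "(\<Sum>n<N. zeta_rem 1 n s0) = \<i> * t * ((\<Sum>n=1..<Suc N. cis (- t * ln (real n)) / of_nat n)
      + cis (- t * ln (real (Suc N))) / (\<i> * of_real t)) - 1" for N
  proof -
    define e where "e = (\<lambda>n. cis (- t * ln (real n)))"
    have "(\<Sum>n<N. zeta_rem 1 n s0) = (\<Sum>n<N. e (Suc (Suc n)) - e (Suc n)) + \<i> * t * (\<Sum>n<N. e (Suc n) / of_nat (Suc n))"
      unfolding rem e_def sum.distrib sum_distrib_left ..
    also have "(\<Sum>n<N. e (Suc (Suc n)) - e (Suc n)) = e (Suc N) - 1"
      using sum_lessThan_telescope[of "\<lambda>n. e (Suc n)" N] by (simp add: e_def)
    also have "(\<Sum>n<N. e (Suc n) / of_nat (Suc n)) = (\<Sum>n=1..<Suc N. e n / of_nat n)"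
      unfolding One_nat_def sum.shift_bounds_Suc_ivl by (simp only: atLeast0LessThan)
    finally show ?thesis using t by (simp add: e_def algebra_simps del: of_nat_Suc sum.op_ivl_Suc)
  qed
  moreover have "(\<lambda>N. \<Sum>n<N. zeta_rem 1 n s0) \<longlonglongrightarrow> \<i> * t * zeta s0 - 1"
    using G(2)[of s0] unfolding sums_def Gz by (simp add: s0_def)
  ultimately have "(\<lambda>N. \<i> * t * ((\<Sum>n=1..<Suc N. cis (- t * ln (real n)) / of_nat n)
      + cis (- t * ln (real (Suc N))) / (\<i> * of_real t)) - 1) \<longlonglongrightarrow> \<i> * t * zeta s0 - 1" by simp
  from tendsto_mult[OF tendsto_const[of "1 / (\<i> * t)"] tendsto_add[OF this tendsto_const[of 1]]]
  show ?thesis using t by (simp add: s0_def)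
qed


section \<open>Phases and weights\<close>

definition osc :: "real \<Rightarrow> nat \<Rightarrow> complex" where
  "osc t n = cis (t * ln (real n))"

text \<open>Replacing the weight \<open>1 / n\<close> by \<open>lg n\<close> costs at most Euler's constant in total and makes the
  weight proportional to the phase increment \<open>t * lg n\<close> of \<^const>\<open>osc\<close>.\<close>

definition lg :: "nat \<Rightarrow> real" where
  "lg n = ln (1 + 1 / real n)"

lemma norm_osc [simp]: "norm (osc t n) = 1"
  by (simp add: osc_def)

lemma lg_eq: "n > 0 \<Longrightarrow> lg n = ln (real (Suc n)) - ln (real n)"
proof -
  assume n: "n > 0"
  then have "1 + 1 / real n = real (Suc n) / real n" by (simp add: field_simps)
  then show ?thesis using n unfolding lg_def by (simp add: ln_div del: of_nat_Suc)
qed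

lemma osc_Suc: "n > 0 \<Longrightarrow> osc t (Suc n) = osc t n * cis (t * lg n)"
  by (simp add: osc_def cis_mult lg_eq algebra_simps del: of_nat_Suc)

lemma lg_nonneg: "0 \<le> lg n"
  by (simp add: lg_def)

text \<open>\<open>lg n\<close> is the integral of \<open>1 / x\<close> from \<open>n\<close> to
  \<open>n + 1\<close>; the last two estimates are the midpoint and the trapezoidal rule for this
  convex function.\<close>

lemma lg_bounds:
  assumes "n > 0"
  shows "lg n \<le> 1 / real n" "1 / (real n + 1 / 2) \<le> lg n"
    "lg n \<le> (1 / real n + 1 / (real n + 1)) / 2"
proof -
  show "lg n \<le> 1 / real n" unfolding lg_def by (rule ln_add_one_self_le_self) simp
  show "1 / (real n + 1 / 2) \<le> lg n"
  proof -
    have "2 * 1 / (2 * real n + 1) \<le> lg n"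
      using ln_inverse_approx_ge[of "real n" "real n + 1"] assms by (simp add: lg_eq add.commute)
    moreover have "2 * 1 / (2 * real n + 1) = 1 / (real n + 1 / 2)" by (simp add: field_simps)
    ultimately show ?thesis by simp
  qed
  show "lg n \<le> (1 / real n + 1 / (real n + 1)) / 2"
    using ln_inverse_approx_le[of "real n" 1] assms by (simp add: lg_eq inverse_eq_divide add.commute)
qed

lemma lg_pos: "n > 0 \<Longrightarrow> 0 < lg n"
  unfolding lg_def by (intro ln_gt_zero) simp

lemma lg_antimono: "0 < m \<Longrightarrow> m \<le> n \<Longrightarrow> lg n \<le> lg m"
  unfolding lg_def by (intro ln_mono add_left_mono frac_le) (auto intro: add_pos_nonneg)

text \<open>The phase increments of \<open>osc\<close> decrease at least this fast. This plays the
  role of a lower bound for the second derivative of the phase and gives the gap conditions near a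
  stationary point.\<close>

lemma lg_diff_ge:
  assumes "n > 0"
  shows "1 / (real n + 1)\<^sup>2 \<le> lg n - lg (Suc n)"
proof -
  define x where "x = real n * (real n + 2)"
  have x: "x > 0" using assms by (simp add: x_def)
  have "lg n - lg (Suc n) = 2 * ln (real n + 1) - (ln (real n) + ln (real n + 2))"
    using assms by (simp add: lg_eq add_ac)
  also have "\<dots> = ln ((real n + 1)\<^sup>2) - ln x"
    using assms by (simp add: x_def ln_mult ln_realpow)
  also have "(real n + 1)\<^sup>2 = x + 1" by (simp add: x_def power2_eq_square algebra_simps)
  also have "ln (x + 1) - ln x = - ln (x / (x + 1))"
    using x by (simp add: ln_div)
  also have "\<dots> \<ge> 1 - x / (x + 1)"
    using ln_le_minus_one[of "x / (x + 1)"] x by simp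
  also have "1 - x / (x + 1) = 1 / (x + 1)" using x by (simp add: field_simps)
  also have "x + 1 = (real n + 1)\<^sup>2" by (simp add: x_def power2_eq_square algebra_simps)
  finally show ?thesis by linarith
qed

lemma sum_lg: "0 < m \<Longrightarrow> (\<Sum>n=1..<m. lg n) = ln (real m)"
proof (induction m)
  case (Suc m)
  then show ?case by (cases "m = 0") (auto simp: lg_eq simp del: of_nat_Suc)
qed simp

lemma norm_zeta_le:
  fixes t :: real
  assumes t: "t > 0"
    and B: "\<And>N. N \<ge> N0 \<Longrightarrow> norm ((\<Sum>n=1..<Suc N. of_real (lg n) * osc t n) - osc t (Suc N) / (\<i> * of_real t)) \<le> B"
  shows "norm (zeta (1 + \<i> * of_real t)) \<le> euler_mascheroni + B"
proof (rule Lim_norm_ubound[OF _ zeta_eq_limit])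
  show "\<forall>\<^sub>F N in sequentially. norm ((\<Sum>n=1..<Suc N. cis (- t * ln (real n)) / of_nat n)
      + cis (- t * ln (real (Suc N))) / (\<i> * of_real t)) \<le> euler_mascheroni + B"
  proof (rule eventually_sequentiallyI[of N0])
    fix N assume N: "N0 \<le> N"
    let ?S = "(\<Sum>n=1..<Suc N. cis (- t * ln (real n)) / of_nat n) + cis (- t * ln (real (Suc N))) / (\<i> * of_real t)"
    let ?D = "(\<Sum>n=1..<Suc N. of_real (lg n) * osc t n) - osc t (Suc N) / (\<i> * of_real t)"
    let ?R = "\<Sum>n=1..<Suc N. of_real (1 / real n - lg n) * osc t n"
    \<comment> \<open>Conjugation changes the sign of \<open>t\<close> in the phases and also that
      of \<open>1 / (\<i> * t)\<close>, hence the minus sign in \<open>?D\<close>.\<close>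
    have "cnj ?S = ?D + ?R"
      by (simp add: osc_def cis_cnj algebra_simps sum.distrib sum_subtractf del: of_nat_Suc sum.op_ivl_Suc)
    then have "norm ?S = norm (?D + ?R)" by (metis complex_mod_cnj)
    also have "\<dots> \<le> B + norm ?R"
      using norm_triangle_ineq[of ?D ?R] B[OF N] by linarith
    also have "norm ?R \<le> (\<Sum>n=1..<Suc N. 1 / real n - lg n)"
      by (intro sum_norm_le) (auto simp: norm_mult lg_bounds simp del: of_real_diff)
    also have "\<dots> = (\<Sum>n<N. inverse (real (n + 1)) + ln (real (n + 1)) - ln (real (n + 2)))"
      by (induction N) (auto simp: lg_eq inverse_eq_divide simp del: of_nat_Suc)
    also have "\<dots> \<le> euler_mascheroni"
    proof -
      have "0 \<le> inverse (real (n + 1)) + ln (real (n + 1)) - ln (real (n + 2))" for n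
        using lg_bounds(1)[of "Suc n"] by (simp add: lg_eq inverse_eq_divide)
      then show ?thesis
        using euler_mascheroni_sum_real by (intro sum_le_suminf[THEN order_trans]) (auto simp: sums_iff)
    qed
    finally show "norm ?S \<le> euler_mascheroni + B" by simp
  qed
qed (use t in auto)

lemma norm_zeta_le_split:
  fixes t :: real
  assumes t: "t > 0" and m: "m > 0"
    and mN: "\<And>N. N0 \<le> N \<Longrightarrow> m \<le> N"
    and head: "norm (\<Sum>n=1..<m. of_real (lg n) * osc t n) \<le> A"
    and tail: "\<And>N. N0 \<le> N \<Longrightarrow> norm ((\<Sum>n=m..N. of_real (lg n) * osc t n) - osc t (Suc N) / (\<i> * of_real t)) \<le> B"
  shows "norm (zeta (1 + \<i> * of_real t)) \<le> euler_mascheroni + (A + B)"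
proof (rule norm_zeta_le[OF t])
  fix N assume N: "N0 \<le> N"
  let ?f = "\<lambda>n. of_real (lg n) * osc t n" and ?T = "osc t (Suc N) / (\<i> * of_real t)"
  have "(\<Sum>n=1..<Suc N. ?f n) = (\<Sum>n=1..<m. ?f n) + (\<Sum>n=m..N. ?f n)"
  proof -
    have "1 \<le> m" "m \<le> Suc N" using m mN[OF N] by auto
    from sum.atLeastLessThan_concat[OF this, of ?f] show ?thesis
      unfolding atLeastLessThanSuc_atLeastAtMost by (rule sym)
  qed
  then have "norm ((\<Sum>n=1..<Suc N. ?f n) - ?T) \<le> norm (\<Sum>n=1..<m. ?f n) + norm ((\<Sum>n=m..N. ?f n) - ?T)"
    using norm_triangle_ineq[of "\<Sum>n=1..<m. ?f n" "(\<Sum>n=m..N. ?f n) - ?T"] by (simp only: add_diff_eq)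
  also have "\<dots> \<le> A + B" by (intro add_mono head tail N)
  finally show "norm ((\<Sum>n=1..<Suc N. ?f n) - ?T) \<le> A + B" .
qed

lemma norm_sum_lg_osc_le: "0 < m \<Longrightarrow> norm (\<Sum>n=1..<m. of_real (lg n) * osc t n) \<le> ln (real m)"
  unfolding sum_lg[symmetric] by (intro sum_norm_le) (auto simp: norm_mult lg_nonneg)

section \<open>The sections of the weighted sum\<close>

lemma osc_sum_initial_section:
  assumes t: "0 < t" and a: "0 < a" "t * lg a \<le> pi" and "a \<le> N"
  shows "norm ((\<Sum>n=a..N. of_real (lg n) * ((osc t n + osc t (Suc n)) / 2)) - osc t (Suc N) / (\<i> * of_real t)) \<le> 1 / t"
proof -
  define u where "u = (\<lambda>n. t * lg n / 2)"
  define w where "w = (\<lambda>n. lg n * cot (u n))"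
  have u: "0 < u n" "u n \<le> pi / 2" if "a \<le> n" for n
  proof -
    have "t * lg n \<le> pi"
      by (rule order_trans[OF mult_left_mono a(2)], rule lg_antimono) (use that a t in auto)
    then show "0 < u n" "u n \<le> pi / 2" using lg_pos[of n] that a t by (auto simp: u_def)
  qed
  have w: "w n = (2 / t) * (u n * cot (u n))" for n using t by (simp add: w_def u_def)
  have u_anti: "u (Suc n) \<le> u n" if "a \<le> n" for n
    using lg_antimono[of n "Suc n"] that a t by (simp add: u_def)
  have w_mono: "w n \<le> w (Suc n)" if "a \<le> n" for n
    unfolding w using u[of n] u[of "Suc n"] u_anti[of n] that t by (intro mult_left_mono mult_cot_antimono) auto
  have w0: "0 \<le> w n" if "a \<le> n" for n
    unfolding w using u[OF that] t by (intro mult_nonneg_nonneg cot_nonneg) auto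
  have w1: "w n \<le> 2 / t" if "a \<le> n" for n
  proof (cases "u n = pi / 2")
    case False
    then have "cot (u n) \<le> 1 / u n" using u[OF that] by (intro cot_le_inverse) auto
    then have "u n * cot (u n) \<le> 1" using u[OF that] by (simp add: field_simps)
    then have "(2 / t) * (u n * cot (u n)) \<le> (2 / t) * 1" using t by (intro mult_left_mono) auto
    then show ?thesis by (simp add: w)
  next
    case True
    then show ?thesis unfolding w using t by (simp only: True) (simp add: cot_def)
  qed
  have y: "of_real (lg n) * ((osc t n + osc t (Suc n)) / 2) = (- \<i> / 2) * (of_real (w n) * (osc t (Suc n) - osc t n))"
    if "a \<le> n" for n
  proof -
    have s: "sin (u n) \<noteq> 0" using u[OF that] sin_gt_zero[of "u n"] pi_gt_zero by simp
    have "osc t (Suc n) = cis (2 * u n) * osc t n" using osc_Suc[of n t] that a by (simp add: u_def)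
    then have "osc t n + osc t (Suc n) = (cis (2 * u n) + 1) * osc t n" "osc t (Suc n) - osc t n = (cis (2 * u n) - 1) * osc t n"
      by (simp_all add: algebra_simps)
    then have 2: "osc t n + osc t (Suc n) = of_real (2 * cos (u n)) * (cis (u n) * osc t n)"
      "osc t (Suc n) - osc t n = 2 * \<i> * of_real (sin (u n)) * (cis (u n) * osc t n)"
      unfolding cis_double_plus_minus_1 by (simp_all add: mult.assoc)
    have "cot (u n) * sin (u n) = cos (u n)" using s by (simp add: cot_def)
    then have "complex_of_real (cos (u n)) = of_real (cot (u n)) * of_real (sin (u n))" by (metis of_real_mult)
    then show ?thesis
      unfolding 2 w_def by (simp add: algebra_simps)
  qed
  let ?S = "\<Sum>n=a..N. of_real (w n) * (osc t (Suc n) - osc t n)"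
  have S: "norm (?S - of_real (w N) * osc t (Suc N)) \<le> 0 - (- w N)"
    using w_mono w0 a \<open>a \<le> N\<close> by (intro norm_sum_mult_diff_le) auto
  have "(\<Sum>n=a..N. of_real (lg n) * ((osc t n + osc t (Suc n)) / 2)) - osc t (Suc N) / (\<i> * of_real t)
      = (- \<i> / 2) * ((?S - of_real (w N) * osc t (Suc N)) + of_real (w N - 2 / t) * osc t (Suc N))"
  proof -
    have 1: "(\<Sum>n=a..N. of_real (lg n) * ((osc t n + osc t (Suc n)) / 2)) = (- \<i> / 2) * ?S"
      unfolding sum_distrib_left by (intro sum.cong refl y) auto
    have 2: "X / (\<i> * of_real t) = (- \<i> / 2) * (of_real (2 / t) * X)" for X
      using t by (simp add: field_simps)
    have 3: "c * S - c * (T * X) = c * ((S - W * X) + (W - T) * X)" for c S T W X :: complex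
      by (simp add: algebra_simps)
    show ?thesis unfolding 1 2 of_real_diff by (rule 3)
  qed
  also have "norm \<dots> \<le> (1 / 2) * ((0 - (- w N)) + (2 / t - w N))"
    using S w1[OF \<open>a \<le> N\<close>] unfolding norm_mult
    by (intro mult_mono order_trans[OF norm_triangle_ineq] add_mono) (auto simp: norm_mult simp del: of_real_diff)
  finally show ?thesis by simp
qed

text \<open>The section around the stationary point \<open>t * lg n = 2 * pi * k\<close>. The
  cut-off is \<open>pi * k * d\<close> in the half-phase \<open>u\<close>, so the main cost
  \<open>4 / (t * d) + 4 * d / 3\<close> is the same for all \<open>k\<close>; it is minimal at
  \<open>d = sqrt (3 / t)\<close>. The condition \<open>k * d < 1 / 2\<close> keeps the cut-off
  below \<open>pi / 2\<close>.\<close>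

lemma osc_sum_section:
  fixes t d :: real and k :: nat
  defines "d \<equiv> sqrt (3 / t)"
  assumes t: "12 < t" and k: "0 < k" "real k * d < 1 / 2" and a: "0 < a"
    and sec: "\<And>n. a \<le> n \<Longrightarrow> n < b \<Longrightarrow> (2 * real k - 1) * pi \<le> t * lg n \<and> t * lg n \<le> (2 * real k + 1) * pi"
  shows "norm (\<Sum>n=a..<b. of_real (lg n) * ((osc t n + osc t (Suc n)) / 2))
    \<le> (4 / (t * d) + (2 * d / 3) * (1 + 1 / (1 - d))) + 2 * pi * real k * (2 + 7 * d / 3) / t"
proof -
  have d: "0 < d" "d < 1 / 2"
  proof -
    show "0 < d" using t by (simp add: d_def)
    have "sqrt (3 / t) < sqrt ((1 / 2)\<^sup>2)" using t by (intro real_sqrt_less_mono) (simp add: field_simps power2_eq_square)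
    then show "d < 1 / 2" by (simp add: d_def)
  qed
  define u where "u = (\<lambda>n. t * lg n / 2 - pi * real k)"
  define p where "p = 2 * pi * real k / t"
  \<comment> \<open>The weight \<open>lg n\<close> divided by the step of \<open>u\<close> is about
    \<open>2 / (t * lg n)\<close>. On the nonnegative side \<open>t * lg n\<close> is at least
    \<open>2 * pi * k\<close>, on the other side it may drop by the factor \<open>1 - d\<close>,
    which gives \<open>E'\<close>.\<close>
  define E where "E = 1 / (pi * real k) + 4 / t"
  define E' where "E' = 1 / (pi * real k * (1 - d))"
  have lg_u: "lg n = p + (2 / t) * u n" for n using t by (simp add: p_def u_def field_simps)
  have "norm (\<Sum>n=a..<b. of_real (p + (2 / t) * u n) * ((osc t n + osc t (Suc n)) / 2))
     \<le> 2 * p / (pi * real k * d) + (2 * p + (2 / t) * (pi * real k * d)) + (2 * (pi * real k * d) / 3) * (E + E')"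
  proof (rule cis_sum_section_le)
    show "0 < pi * real k * d" "0 \<le> E" "0 \<le> E'" "0 \<le> 2 / t"
      using d k t by (simp_all add: E_def E'_def)
    have "pi * (real k * d) < pi * (1 / 2)" using k by (intro mult_strict_left_mono) auto
    then show "pi * real k * d < pi / 2" by simp
    have "(2 * pi) * 1 \<le> (2 * pi) * real k" using k by (intro mult_left_mono) auto
    then show "2 / t * pi \<le> p" using t by (simp add: p_def divide_right_mono)
    fix n
    show "norm (osc t n) = 1" by simp
    show "osc t (Suc n) = osc t n * cis (2 * u n)" if "a \<le> n" "n < b"
    proof -
      have "cis (2 * u n) = cis (t * lg n) * cis (- (2 * pi * real k))" by (simp add: cis_mult u_def algebra_simps)
      also have "cis (- (2 * pi * real k)) = 1" using cis_multiple_2pi[of "- real k"] by simp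
      finally show ?thesis using osc_Suc[of n t] that a by simp
    qed
    show "- pi / 2 \<le> u n \<and> u n \<le> pi / 2" if "a \<le> n" "n < b"
      using sec[OF that] by (simp add: u_def algebra_simps)
    show "u (Suc n) \<le> u n" if "a \<le> n" "Suc n < b"
      using lg_antimono[of n "Suc n"] that a t by (simp add: u_def)
  next
    fix n assume n: "a \<le> n" "Suc n < b" "0 \<le> u (Suc n)" "u n < pi * real k * d"
    have n0: "n > 0" using n a by simp
    have "lg (Suc n) \<le> lg n" using lg_antimono[of n "Suc n"] n0 by simp
    then have "0 \<le> u n" using n t by (simp add: u_def) (smt (verit) mult_left_mono)
    then have "2 / (t * lg n) \<le> 1 / (pi * real k)"
      using lg_pos[OF n0] t k by (simp add: u_def field_simps)
    then have "2 / (t * lg n) + 4 / t \<le> E" by (simp add: E_def)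
    \<comment> \<open>\<open>lg_diff_ge\<close> has \<open>(n + 1)^2\<close> where
      \<open>n * (n + 1)\<close> would be natural; the trapezoidal bound limits this loss to
      \<open>2 * lg n\<close>, which turns into the summand \<open>4 / t\<close> of
      \<open>E\<close>.\<close>
    have "(lg n * (real n + 1))\<^sup>2 \<le> 1 + 2 * lg n"
    proof -
      have "lg n * (real n + 1) \<le> (1 / real n + 1 / (real n + 1)) / 2 * (real n + 1)"
        using lg_bounds(3)[OF n0] by (intro mult_right_mono) auto
      also have "\<dots> = 1 + 1 / (2 * real n)"
        using n0 by (simp add: divide_simps)
      finally have "(lg n * (real n + 1))\<^sup>2 \<le> (1 + 1 / (2 * real n))\<^sup>2"
        using lg_nonneg[of n] by (intro power_mono) auto
      also have "\<dots> \<le> 1 + 2 * (1 / (real n + 1 / 2))"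
      proof -
        have "1 \<le> real n" using n0 by simp
        then have "6 * real n + 1 \<le> 8 * real n * real n" by (smt (verit) mult_left_mono mult_cancel_left1)
        then show ?thesis using n0 by (simp add: field_simps power2_eq_square)
      qed
      also have "\<dots> \<le> 1 + 2 * lg n" using lg_bounds(2)[OF n0] by simp
      finally show ?thesis .
    qed
    then have "lg n * (real n + 1)\<^sup>2 \<le> 1 / lg n + 2"
      using lg_pos[OF n0] by (simp add: power_mult_distrib) (simp add: field_simps power2_eq_square)
    then have "lg n \<le> (1 / lg n + 2) * (1 / (real n + 1)\<^sup>2)"
      by (simp add: pos_le_divide_eq)
    also have "\<dots> \<le> (1 / lg n + 2) * (lg n - lg (Suc n))"
      using lg_nonneg[of n] by (intro mult_left_mono lg_diff_ge n0) auto
    also have "\<dots> = (2 / (t * lg n) + 4 / t) * (u n - u (Suc n))"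
      using t by (simp add: u_def field_simps)
    also have "\<dots> \<le> E * (u n - u (Suc n))"
      using \<open>2 / (t * lg n) + 4 / t \<le> E\<close> \<open>lg (Suc n) \<le> lg n\<close> t by (intro mult_right_mono) (auto simp: u_def)
    finally show "p + 2 / t * u n \<le> E * (u n - u (Suc n))" by (simp add: lg_u)
  next
    fix n assume n: "a \<le> n" "Suc n < b" "- (pi * real k * d) < u (Suc n)" "u n \<le> 0"
    have n0: "n > 0" using n a by simp
    have "2 * pi * real k * (1 - d) \<le> t * lg (Suc n)" using n by (simp add: u_def algebra_simps)
    also have "\<dots> \<le> t * (1 / real (Suc n))" using t by (intro mult_left_mono lg_bounds) auto
    finally have "2 * (real n + 1) / t \<le> E'"
      unfolding E'_def using t d k by (simp add: field_simps)
    have "lg (Suc n) \<le> 1 / (real n + 1)" using lg_bounds(1)[of "Suc n"] by (simp add: add.commute)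
    also have "\<dots> = (real n + 1) * (1 / (real n + 1)\<^sup>2)" by (simp add: power2_eq_square)
    also have "\<dots> \<le> (real n + 1) * (lg n - lg (Suc n))" by (intro mult_left_mono lg_diff_ge n0) auto
    also have "\<dots> = (2 * (real n + 1) / t) * (u n - u (Suc n))" using t by (simp add: u_def field_simps)
    also have "\<dots> \<le> E' * (u n - u (Suc n))"
      using \<open>2 * (real n + 1) / t \<le> E'\<close> lg_antimono[of n "Suc n"] n0 t by (intro mult_right_mono) (auto simp: u_def)
    finally show "p + 2 / t * u (Suc n) \<le> E' * (u n - u (Suc n))" by (simp add: lg_u)
  qed
  also have "\<dots> = (4 / (t * d) + (2 * d / 3) * (1 + 1 / (1 - d))) + 2 * pi * real k * (2 + 7 * d / 3) / t"
  proof -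
    have "2 * p / (pi * real k * d) = 4 / (t * d)" using k d t by (simp add: p_def field_simps)
    moreover have "(2 * (pi * real k * d) / 3) * (E + E') = (2 * d / 3) * (1 + 1 / (1 - d)) + 8 * pi * real k * d / (3 * t)"
      using k d t by (simp add: E_def E'_def field_simps)
    moreover have "2 * p + (2 / t) * (pi * real k * d) + 8 * pi * real k * d / (3 * t) = 2 * pi * real k * (2 + 7 * d / 3) / t"
      using t by (simp add: p_def field_simps)
    ultimately show ?thesis by linarith
  qed
  finally show ?thesis unfolding lg_u[symmetric] .
qed


text \<open>The sum starts halfway between the stationary points number \<open>K\<close> and \<open>K + 1\<close>, counted from
  infinity.\<close>

lemma osc_sum_tail:
  fixes t d :: real and K :: nat
  defines "d \<equiv> sqrt (3 / t)" and "\<beta> \<equiv> (2 * real K + 1) * pi / t"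
  assumes t: "t > 0" and K: "K = 0 \<or> (12 < t \<and> real K * d < 1 / 2)"
  obtains m N0 where "m > 0" "lg m \<le> \<beta>" "real m \<le> 1 / \<beta> + \<beta> / 4 + 1 / 2"
    "\<And>N. N0 \<le> N \<Longrightarrow> m \<le> N"
    "\<And>N. N0 \<le> N \<Longrightarrow> norm ((\<Sum>n=m..N. of_real (lg n) * osc t n) - osc t (Suc N) / (\<i> * of_real t))
      \<le> lg m + 1 / t + real K * (4 / (t * d) + (2 * d / 3) * (1 + 1 / (1 - d))) + pi * real (K * (K + 1)) * (2 + 7 * d / 3) / t"
proof -
  \<comment> \<open>The first index past the halfway phase \<open>(2 * k + 1) * pi\<close>. Thus
    \<open>{m (Suc k)..<m k}\<close> is the section of stationary point \<open>Suc k\<close>, and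
    the section from \<open>m 0\<close> on belongs to the point at infinity.\<close>
  define m where "m = (\<lambda>k. LEAST n. 0 < n \<and> t * lg n \<le> (2 * real k + 1) * pi)"
  have ex: "\<exists>n. 0 < n \<and> t * lg n \<le> (2 * real k + 1) * pi" for k
  proof -
    obtain n where n: "real n > t / pi" using reals_Archimedean2 by blast
    then have n0: "n > 0" using t by (smt (verit) divide_pos_pos of_nat_0_less_iff pi_gt_zero)
    have "t * lg n \<le> t * (1 / real n)" using t n0 by (intro mult_left_mono lg_bounds) auto
    also have "\<dots> \<le> 1 * pi" using n n0 by (simp add: field_simps)
    also have "\<dots> \<le> (2 * real k + 1) * pi" by (intro mult_right_mono) auto
    finally show ?thesis using n0 by blast
  qed
  have m: "0 < m k" "t * lg (m k) \<le> (2 * real k + 1) * pi" for k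
    using LeastI_ex[OF ex[of k]] unfolding m_def by auto
  have less: "(2 * real k + 1) * pi < t * lg n" if "0 < n" "n < m k" for n k
    using not_less_Least[of n "\<lambda>n. 0 < n \<and> t * lg n \<le> (2 * real k + 1) * pi"] that unfolding m_def by auto
  have m_anti: "m (Suc k) \<le> m k" for k
  proof -
    have "t * lg (m k) \<le> (2 * real (Suc k) + 1) * pi"
      by (rule order_trans[OF m(2)]) (intro mult_right_mono, auto)
    then show ?thesis unfolding m_def[of] using m(1)[of k] by (intro Least_le) (auto simp: m_def)
  qed
  have le: "t * lg n \<le> (2 * real k + 1) * pi" if "m k \<le> n" for n k
    by (rule order_trans[OF mult_left_mono m(2)[of k]], rule lg_antimono) (use that t m in auto)
  define c1 where "c1 = 4 / (t * d) + (2 * d / 3) * (1 + 1 / (1 - d))"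
  define c2 where "c2 = pi * (2 + 7 * d / 3) / t"
  have mean: "norm ((\<Sum>n=m k..N. of_real (lg n) * ((osc t n + osc t (Suc n)) / 2)) - osc t (Suc N) / (\<i> * of_real t))
      \<le> 1 / t + real k * c1 + real (k * (k + 1)) * c2" if "k \<le> K" "m 0 \<le> N" for k N
    using that(1)
  proof (induction k)
    case 0
    show ?case using osc_sum_initial_section[OF t m(1), of 0 N] m(2)[of 0] that by simp
  next
    case (Suc k)
    have mN: "m k \<le> N" using lift_Suc_antimono_le[of m 0 k, OF m_anti] that by simp
    have kd: "real (Suc k) * d < 1 / 2"
    proof -
      have "real (Suc k) * d \<le> real K * d" using Suc t by (intro mult_right_mono) (auto simp: d_def)
      then show ?thesis using K Suc by auto
    qed
    let ?f = "\<lambda>n. of_real (lg n) * ((osc t n + osc t (Suc n)) / 2)"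
    have split: "(\<Sum>n=m (Suc k)..N. ?f n) = (\<Sum>n=m (Suc k)..<m k. ?f n) + (\<Sum>n=m k..N. ?f n)"
      using m_anti[of k] mN by (simp add: sum.atLeastLessThan_concat flip: atLeastLessThanSuc_atLeastAtMost)
    have "norm (\<Sum>n=m (Suc k)..<m k. ?f n)
        \<le> (4 / (t * d) + (2 * d / 3) * (1 + 1 / (1 - d))) + 2 * pi * real (Suc k) * (2 + 7 * d / 3) / t"
      unfolding d_def
    proof (rule osc_sum_section)
      show "real (Suc k) * sqrt (3 / t) < 1 / 2" using kd by (simp add: d_def)
      fix n assume n: "m (Suc k) \<le> n" "n < m k"
      have "0 < n" using n m(1)[of "Suc k"] by linarith
      then show "(2 * real (Suc k) - 1) * pi \<le> t * lg n \<and> t * lg n \<le> (2 * real (Suc k) + 1) * pi"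
        using less[of n k] le[of "Suc k" n] n by (simp add: algebra_simps)
    qed (use K Suc m in auto)
    then have "norm (\<Sum>n=m (Suc k)..<m k. ?f n) \<le> c1 + real (2 * Suc k) * c2"
      by (simp add: c1_def c2_def mult_ac)
    moreover have "norm ((\<Sum>n=m k..N. ?f n) - osc t (Suc N) / (\<i> * of_real t)) \<le> 1 / t + real k * c1 + real (k * (k + 1)) * c2"
      using Suc by simp
    ultimately show ?case
      unfolding split using norm_triangle_ineq[of "\<Sum>n=m (Suc k)..<m k. ?f n" "(\<Sum>n=m k..N. ?f n) - osc t (Suc N) / (\<i> * of_real t)"]
      by (simp add: algebra_simps)
  qed
  show ?thesis
  proof (rule that[of "m K"])
    show "m K > 0" by (rule m)
    show "lg (m K) \<le> \<beta>" using m(2)[of K] t by (simp add: \<beta>_def field_simps)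
    have b: "\<beta> > 0" using t by (simp add: \<beta>_def)
    show "real (m K) \<le> 1 / \<beta> + \<beta> / 4 + 1 / 2"
    proof (cases "m K = 1")
      case True
      have "0 \<le> (1 - \<beta> / 2)\<^sup>2" by simp
      then have "\<beta> \<le> 1 + \<beta> * \<beta> / 4" by (simp add: power2_eq_square field_simps)
      then have "1 \<le> 1 / \<beta> + \<beta> / 4" using b by (simp add: field_simps)
      then show ?thesis using True by simp
    next
      case False
      define x where "x = real (m K) - 1"
      have x: "x = real (m K - 1)" "0 < m K - 1" using m(1)[of K] False by (auto simp: x_def)
      have "\<beta> < lg (m K - 1)" using less[of "m K - 1" K] x t by (simp add: \<beta>_def field_simps)
      also have "\<dots> \<le> (1 / x + 1 / (x + 1)) / 2" using lg_bounds(3)[OF x(2)] x(1) by simp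
      finally have *: "\<beta> < (1 / x + 1 / (x + 1)) / 2" .
      \<comment> \<open>With \<open>y = m K - 1 / 2\<close> the trapezoidal bound reads
        \<open>\<beta> < y / (y^2 - 1 / 4)\<close>. So \<open>y\<close> is below
        \<open>(1 + sqrt (1 + \<beta>^2)) / (2 * \<beta>)\<close>, which is at most
        \<open>1 / \<beta> + \<beta> / 4\<close>.\<close>
      define y where "y = x + 1 / 2"
      have y: "y > 1 / 2" using x by (simp add: y_def)
      have "(1 / x + 1 / (x + 1)) / 2 = y / (y\<^sup>2 - 1 / 4)"
      proof -
        have "y\<^sup>2 - 1 / 4 = x * (x + 1)" by (simp add: y_def power2_eq_square algebra_simps)
        moreover have "x > 0" using x by simp
        ultimately show ?thesis by (simp add: y_def divide_simps)
      qed
      moreover have "y\<^sup>2 - 1 / 4 > 0"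
      proof -
        have "y\<^sup>2 - 1 / 4 = x * (x + 1)" by (simp add: y_def power2_eq_square algebra_simps)
        then show ?thesis using x by simp
      qed
      ultimately have "\<beta> * (y\<^sup>2 - 1 / 4) < y" using * by (simp only: pos_less_divide_eq)
      have "y \<le> 1 / \<beta> + \<beta> / 4"
      proof (rule ccontr)
        assume "\<not> ?thesis"
        then have gt: "y > 1 / \<beta> + \<beta> / 4" by simp
        then have "\<beta> * y > 1 + \<beta> * \<beta> / 4" using b by (simp add: field_simps)
        moreover from gt have "y > 1 / \<beta>" using b by (smt (verit) divide_nonneg_nonneg)
        then have "\<beta> * y > 1" using b by (simp add: field_simps)
        ultimately have "(\<beta> * y - 1) * y > \<beta> * \<beta> / 4 * (1 / \<beta>)"
          using \<open>y > 1 / \<beta>\<close> b by (intro mult_strict_mono) auto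
        then show False using \<open>\<beta> * (y\<^sup>2 - 1 / 4) < y\<close> b by (simp add: algebra_simps power2_eq_square)
      qed
      then show ?thesis by (simp add: y_def x_def)
    qed
    show mN: "m K \<le> N" if "m 0 \<le> N" for N
      using lift_Suc_antimono_le[of m 0 K, OF m_anti] that by simp
    fix N assume N: "m 0 \<le> N"
    let ?T = "osc t (Suc N) / (\<i> * of_real t)"
    let ?A = "\<Sum>n=m K..N. of_real (lg n) * ((osc t n + osc t (Suc n)) / 2)"
    \<comment> \<open>Half of this sum separates the plain terms from their averages; since
      \<open>lg\<close> is decreasing, it costs only \<open>lg (m K)\<close>.\<close>
    let ?B = "\<Sum>n=m K..<Suc N. of_real (lg n) * (osc t (Suc n) - osc t n)"
    have "norm ?B \<le> 2 * lg (m K)"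
      using m(1)[of K] by (intro norm_sum_mult_diff_antimono_le) (auto intro!: lg_antimono simp: lg_nonneg)
    then have B: "norm (?B / 2) \<le> lg (m K)" by (simp add: norm_divide)
    have "(\<Sum>n=m K..N. of_real (lg n) * osc t n) - ?T = (?A - ?T) - ?B / 2"
    proof -
      have "(\<Sum>n=m K..N. of_real (lg n) * osc t n) = ?A - ?B / 2"
        unfolding atLeastLessThanSuc_atLeastAtMost sum_divide_distrib sum_subtractf[symmetric]
        by (intro sum.cong refl) (simp add: algebra_simps add_divide_distrib diff_divide_distrib)
      then show ?thesis by simp
    qed
    then have "norm ((\<Sum>n=m K..N. of_real (lg n) * osc t n) - ?T) \<le> norm (?A - ?T) + norm (?B / 2)"
      by (simp only: norm_triangle_ineq4)
    also have "\<dots> \<le> (1 / t + real K * c1 + real (K * (K + 1)) * c2) + lg (m K)"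
      by (intro add_mono mean B N order_refl)
    finally show "norm ((\<Sum>n=m K..N. of_real (lg n) * osc t n) - ?T)
      \<le> lg (m K) + 1 / t + real K * (4 / (t * d) + (2 * d / 3) * (1 + 1 / (1 - d))) + pi * real (K * (K + 1)) * (2 + 7 * d / 3) / t"
      by (simp add: c1_def c2_def mult_ac add_ac)
  qed
qed

text \<open>\<open>13 / 22\<close> bounds Euler's constant. \<open>K\<close> is free: a larger value
  shortens the head, which enters through its logarithm, and adds stationary points to the
  tail.\<close>

lemma norm_zeta_le_explicit:
  fixes t d :: real and K :: nat
  defines "d \<equiv> sqrt (3 / t)" and "\<beta> \<equiv> (2 * real K + 1) * pi / t"
  assumes t: "t > 0" and K: "K = 0 \<or> (12 < t \<and> real K * d < 1 / 2)"
  shows "norm (zeta (1 + \<i> * of_real t)) \<le> 13 / 22 + ln (1 / \<beta> + \<beta> / 4 + 3 / 2) + 1 / t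
    + real K * (4 / (t * d) + (2 * d / 3) * (1 + 1 / (1 - d))) + pi * real (K * (K + 1)) * (2 + 7 * d / 3) / t"
proof -
  define T where "T = 1 / t + real K * (4 / (t * d) + (2 * d / 3) * (1 + 1 / (1 - d))) + pi * real (K * (K + 1)) * (2 + 7 * d / 3) / t"
  obtain m N0 where m: "m > 0" "lg m \<le> \<beta>" "real m \<le> 1 / \<beta> + \<beta> / 4 + 1 / 2"
    and mN: "\<And>N. N0 \<le> N \<Longrightarrow> m \<le> N"
    and tail: "\<And>N. N0 \<le> N \<Longrightarrow> norm ((\<Sum>n=m..N. of_real (lg n) * osc t n) - osc t (Suc N) / (\<i> * of_real t))
      \<le> lg m + 1 / t + real K * (4 / (t * d) + (2 * d / 3) * (1 + 1 / (1 - d))) + pi * real (K * (K + 1)) * (2 + 7 * d / 3) / t"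
    by (rule osc_sum_tail[OF t K[unfolded d_def], folded d_def \<beta>_def]) (rule that)
  have "norm (zeta (1 + \<i> * of_real t)) \<le> euler_mascheroni + (ln (real m) + (lg m + T))"
    using tail by (intro norm_zeta_le_split[OF t m(1) mN] norm_sum_lg_osc_le m) (simp_all add: T_def add.assoc)
  \<comment> \<open>The cost \<open>lg m\<close> of passing from averages to plain terms is absorbed
    by moving the end of the logarithm from \<open>m\<close> to \<open>m + 1\<close>.\<close>
  also have "ln (real m) + (lg m + T) = ln (real (Suc m)) + T" using lg_eq[OF m(1)] by simp
  also have "ln (real (Suc m)) \<le> ln (1 / \<beta> + \<beta> / 4 + 3 / 2)"
    using m by (intro ln_mono) auto
  finally show ?thesis
    using euler_mascheroni_less_13_over_22 unfolding T_def by linarith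
qed

section \<open>The bound with leading coefficient one half\<close>

text \<open>The head ends near \<open>sqrt t / (pi * y)\<close>, which splits off
  \<open>ln t / 2\<close>. The other terms become functions of \<open>x\<close> and \<open>y\<close>
  by \<open>K * x = (y - x) / 2\<close> and \<open>K * (K + 1) / t = (y^2 - x^2) / 4\<close>; for
  fixed \<open>y\<close> they stay bounded as \<open>x\<close> tends to 0.\<close>

lemma norm_zeta_le_scaled:
  fixes t x y :: real and K :: nat
  defines "x \<equiv> 1 / sqrt t" and "y \<equiv> (2 * real K + 1) * x"
  assumes t: "t > 0" and K: "K = 0 \<or> (12 < t \<and> real K * (sqrt 3 * x) < 1 / 2)"
  shows "norm (zeta (1 + \<i> * of_real t)) \<le> ln t / 2 + 13 / 22
    + ln (1 / (pi * y) + pi * y * x\<^sup>2 / 4 + 3 / 2 * x) + x\<^sup>2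
    + (y - x) / 2 * (4 / sqrt 3 + 2 / sqrt 3 * (1 + 1 / (1 - sqrt 3 * x)))
    + pi / 4 * (y\<^sup>2 - x\<^sup>2) * (2 + 7 / sqrt 3 * x)"
proof -
  define r where "r = sqrt (3::real)"
  have r: "r > 0" "r * r = 3" by (simp_all add: r_def)
  have x: "x > 0" "1 / t = x\<^sup>2" "sqrt (3 / t) = r * x" "t = 1 / x\<^sup>2"
    using t by (simp_all add: x_def r_def real_sqrt_divide power_divide)
  have y: "y > 0" using x by (simp add: y_def)
  define v where "v = 1 / (pi * y) + pi * y * x\<^sup>2 / 4 + 3 / 2 * x"
  have v: "v > 0" unfolding v_def using x y by (intro add_pos_pos) auto
  have Kx: "real K * x = (y - x) / 2" by (simp add: y_def algebra_simps)
  have e1: "(2 * real K + 1) * pi / t = pi * y * x"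
    unfolding y_def x(4) using x(1) by (simp add: power2_eq_square)
  have e2: "1 / (pi * y * x) + (pi * y * x) / 4 + 3 / 2 = v / x"
    using x(1) y by (simp add: v_def field_simps power2_eq_square)
  have e3: "ln (v / x) = ln v + ln t / 2"
    using v x(1) t by (simp add: ln_div ln_mult x_def ln_sqrt)
  have e4: "real K * (4 / (t * (r * x)) + (2 * (r * x) / 3) * (1 + 1 / (1 - r * x)))
      = (y - x) / 2 * (4 / r + 2 / r * (1 + 1 / (1 - r * x)))"
  proof -
    have "4 / (t * (r * x)) = x * (4 / r)" unfolding x(4) using x(1) r(1) by (simp add: field_simps power2_eq_square)
    moreover have "2 * (r * x) / 3 = x * (2 / r)" using r by (simp add: field_simps)
    ultimately have "real K * (4 / (t * (r * x)) + (2 * (r * x) / 3) * (1 + 1 / (1 - r * x)))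
       = (real K * x) * (4 / r + 2 / r * (1 + 1 / (1 - r * x)))" by (simp only: algebra_simps)
    then show ?thesis unfolding Kx .
  qed
  have e5: "pi * real (K * (K + 1)) * (2 + 7 * (r * x) / 3) / t = pi / 4 * (y\<^sup>2 - x\<^sup>2) * (2 + 7 / r * x)"
  proof -
    have 1: "7 * (r * x) / 3 = 7 / r * x" using r by (simp add: field_simps)
    have 2: "real (K * (K + 1)) / t = (y\<^sup>2 - x\<^sup>2) / 4"
      unfolding x(4) y_def by (simp add: power2_eq_square algebra_simps)
    have "pi * real (K * (K + 1)) * (2 + 7 * (r * x) / 3) / t = pi * (2 + 7 * (r * x) / 3) * (real (K * (K + 1)) / t)"
      by simp
    then show ?thesis unfolding 1 2 by simp
  qed
  have "K = 0 \<or> 12 < t \<and> real K * sqrt (3 / t) < 1 / 2"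
    using K unfolding x(3) r_def .
  note Z = norm_zeta_le_explicit[OF t this, unfolded x(2,3) e1 e2 e3 e4 e5]
  show ?thesis using Z unfolding v_def r_def by linarith
qed

section \<open>Numerical evaluation in the ranges of \<open>t\<close>\<close>

lemma ln_le_linear: "0 < v \<Longrightarrow> 0 < c \<Longrightarrow> ln v \<le> v / c - 1 + ln (c::real)"
  using ln_le_minus_one[of "v / c"] by (simp add: ln_div)

lemma sqrt3_bounds: "(1732 / 1000) \<le> sqrt 3" "sqrt 3 \<le> ((17321 / 10000)::real)"
  by (rule real_le_rsqrt, simp add: power2_eq_square) (rule real_le_lsqrt, simp_all add: power2_eq_square)

lemma sqrt_bounds:
  assumes "0 \<le> a" "0 \<le> b" "a\<^sup>2 \<le> t" "t \<le> b\<^sup>2"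
  shows "a \<le> sqrt t" "sqrt t \<le> (b::real)"
  using assms by (auto intro: real_le_rsqrt real_le_lsqrt order_trans[OF zero_le_power2])

text \<open>By convexity. This chord and the next one make the numerical inequalities below linear
  on each subinterval, so that arithmetic decides them.\<close>

lemma inverse_le_chord:
  assumes "0 < a" "a \<le> s" "s \<le> (b::real)"
  shows "1 / s \<le> (a + b - s) / (a * b)"
proof -
  have "0 \<le> (s - a) * (b - s)" using assms by simp
  then show ?thesis using assms by (simp add: field_simps)
qed

lemma square_le_chord:
  assumes "a \<le> s" "s \<le> (b::real)"
  shows "s\<^sup>2 \<le> (a + b) * s - a * b"
proof -
  have "0 \<le> (s - a) * (b - s)" using assms by simp
  then show ?thesis by (simp add: algebra_simps power2_eq_square)
qed

text \<open>The choice \<open>K = 0\<close>. The tangent of \<open>ln\<close> at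
  \<open>exp 1\<close> suits the upper end of the range, where \<open>v\<close> is about 2.6. The
  intervals are cut at \<open>s = 4\<close> only to keep the chords close.\<close>

lemma norm_zeta_le_small:
  fixes t :: real
  assumes t: "3 \<le> t" "t \<le> 56"
  shows "norm (zeta (1 + \<i> * of_real t)) \<le> ln t / 2 + 157 / 100"
proof -
  define s where "s = sqrt t"
  define x where "x = 1 / s"
  have s: "(1732 / 1000) \<le> s" "s \<le> (74834 / 10000)" "s > 0"
    using sqrt_bounds[of "(1732 / 1000)" "(74834 / 10000)" t] t by (auto simp: s_def power2_eq_square)
  have x: "0 < x" "x \<le> 1 / (1732 / 1000)" "x * s = 1" using s by (auto simp: x_def field_simps)
  define v where "v = 1 / (pi * x) + pi * x * x\<^sup>2 / 4 + 3 * x / 2"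
  have v: "v > 0" unfolding v_def using x by (intro add_pos_pos) auto
  have e: "exp 1 \<ge> ((2718 / 1000)::real)" using e_approx_32 by (simp add: abs_if split: if_split_asm)
  have "ln v \<le> v / exp 1" using ln_le_linear[OF v, of "exp 1"] by simp
  also have "\<dots> \<le> v / (2718 / 1000)" using v e by (intro divide_left_mono) auto
  finally have 1: "ln v \<le> v / (2718 / 1000)" .
  have "1 / (pi * x) = s / pi" by (simp add: x_def)
  also have "\<dots> \<le> s / (31415 / 10000)" using pi_approx s by (intro divide_left_mono) auto
  finally have 2: "1 / (pi * x) \<le> s / (31415 / 10000)" .
  have "pi * x \<le> (31416 / 10000) * (1 / (1732 / 1000))" using pi_approx x by (intro mult_mono) auto
  then have "pi * x / 4 * x\<^sup>2 \<le> (454 / 1000) * x\<^sup>2" by (intro mult_right_mono) auto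
  then have 3: "pi * x * x\<^sup>2 / 4 \<le> (454 / 1000) * x\<^sup>2" by simp
  have v2: "v \<le> s / (31415 / 10000) + (454 / 1000) * x\<^sup>2 + 3 / 2 * x" using 2 3 unfolding v_def by linarith
  have "v / (2718 / 1000) + x\<^sup>2 \<le> (979 / 1000)"
  proof (cases "s \<le> 4")
    case True
    have "x \<le> ((1732 / 1000) + 4 - s) / ((1732 / 1000) * 4)" unfolding x_def using s True by (intro inverse_le_chord) auto
    moreover have "x\<^sup>2 \<le> (1 / 4 + 1 / (1732 / 1000)) * x - 1 / 4 * (1 / (1732 / 1000))"
      using x s True by (intro square_le_chord) (auto simp: x_def field_simps)
    ultimately show ?thesis using v2 s True by simp
  next
    case False
    have "x \<le> (4 + (74834 / 10000) - s) / (4 * (74834 / 10000))" unfolding x_def using s False by (intro inverse_le_chord) auto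
    moreover have "x\<^sup>2 \<le> (1 / (74834 / 10000) + 1 / 4) * x - 1 / (74834 / 10000) * (1 / 4)"
      using x s False by (intro square_le_chord) (auto simp: x_def field_simps)
    ultimately show ?thesis using v2 s False by simp
  qed
  then have "ln v + x\<^sup>2 + 13 / 22 \<le> (157 / 100)" using 1 by simp
  then show ?thesis
    using norm_zeta_le_scaled[of t 0] t by (simp add: s_def[symmetric] x_def[symmetric] v_def[symmetric])
qed

text \<open>The choice \<open>K = 1\<close>, that is \<open>y = 3 * x\<close>. The variable
  \<open>v\<close> grows from about 1 to about 1.8, so \<open>ln\<close> is bounded by its tangent
  at 1 for \<open>s <= 10\<close> and by its tangent near \<open>sqrt (exp 1)\<close>
  beyond.\<close>

lemma norm_zeta_le_medium:
  fixes t :: real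
  assumes t: "56 \<le> t" "t \<le> 250"
  shows "norm (zeta (1 + \<i> * of_real t)) \<le> ln t / 2 + 157 / 100"
proof -
  define s where "s = sqrt t"
  define x where "x = 1 / s"
  define r where "r = sqrt (3::real)"
  have s: "(74833 / 10000) \<le> s" "s \<le> (158114 / 10000)" "s > 0"
    using sqrt_bounds[of "(74833 / 10000)" "(158114 / 10000)" t] t by (auto simp: s_def power2_eq_square)
  have x: "0 < x" "x \<le> (13364 / 100000)" "x * s = 1" using s by (auto simp: x_def field_simps)
  have r: "(1732 / 1000) \<le> r" "r \<le> (17321 / 10000)" "r * r = 3" using sqrt3_bounds by (auto simp: r_def)
  define v where "v = 1 / (pi * (3 * x)) + pi * (3 * x) * x\<^sup>2 / 4 + 3 / 2 * x"
  have v: "v > 0" unfolding v_def using x by (intro add_pos_pos) auto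
  have "1 / (pi * (3 * x)) = s / (3 * pi)" by (simp add: x_def)
  also have "\<dots> \<le> s / (3 * (31415 / 10000))" using pi_approx s by (intro divide_left_mono) auto
  finally have v1: "1 / (pi * (3 * x)) \<le> s / (94245 / 10000)" by simp
  have "pi * (3 * x) \<le> (31416 / 10000) * (3 * (13364 / 100000))" using pi_approx x by (intro mult_mono) auto
  then have "pi * (3 * x) / 4 * x\<^sup>2 \<le> (315 / 1000) * x\<^sup>2" by (intro mult_right_mono) auto
  then have "pi * (3 * x) * x\<^sup>2 / 4 \<le> (315 / 1000) * x\<^sup>2" by simp
  then have v2: "v \<le> s / (94245 / 10000) + (315 / 1000) * x\<^sup>2 + 3 / 2 * x" using v1 by (simp add: v_def)
  have rx: "r * x \<le> (17321 / 10000) * (13364 / 100000)" using r x by (intro mult_mono) auto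
  have ir: "1 / r \<le> (57737 / 100000)" "0 < 1 / r" using r by (auto simp: field_simps)
  have "1 / (1 - r * x) \<le> 1 + (13013 / 10000) * (r * x)"
  proof -
    have "0 \<le> r * x" using r x by simp
    then have "0 \<le> (r * x) * ((3013 / 10000) - (13013 / 10000) * (r * x))" using rx by (rule_tac mult_nonneg_nonneg) auto
    then have "1 \<le> (1 + (13013 / 10000) * (r * x)) * (1 - r * x)" by (simp add: algebra_simps)
    then show ?thesis using rx by (simp add: field_simps)
  qed
  then have "2 / r * (1 + 1 / (1 - r * x)) \<le> 2 / r * (2 + (13013 / 10000) * (r * x))"
    using r by (intro mult_left_mono) auto
  also have "\<dots> = 4 * (1 / r) + (26026 / 10000) * x" using r by (simp add: field_simps)
  finally have "4 / r + 2 / r * (1 + 1 / (1 - r * x)) \<le> 8 * (1 / r) + (26026 / 10000) * x" by simp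
  also have "\<dots> \<le> (461896 / 100000) + (26026 / 10000) * x" using ir by simp
  finally have "x * (4 / r + 2 / r * (1 + 1 / (1 - r * x))) \<le> x * ((461896 / 100000) + (26026 / 10000) * x)"
    using x by (intro mult_left_mono) auto
  then have m1: "(3 * x - x) / 2 * (4 / r + 2 / r * (1 + 1 / (1 - r * x))) \<le> (461896 / 100000) * x + (26026 / 10000) * x\<^sup>2"
    by (simp add: algebra_simps power2_eq_square)
  have "7 / r * x \<le> 7 * (57737 / 100000) * (13364 / 100000)"
    using ir x mult_mono[of "7 * (1 / r)" "7 * (57737 / 100000)" x "(13364 / 100000)"] by simp
  then have "pi / 4 * 8 * (2 + 7 / r * x) \<le> (31416 / 10000) / 4 * 8 * (2 + (5402 / 10000))"
    using pi_approx r x by (intro mult_mono) auto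
  then have "pi / 4 * 8 * (2 + 7 / r * x) \<le> (15961 / 1000)" by simp
  then have "pi / 4 * 8 * (2 + 7 / r * x) * x\<^sup>2 \<le> (15961 / 1000) * x\<^sup>2" by (intro mult_right_mono) auto
  moreover have "pi / 4 * 8 * (2 + 7 / r * x) * x\<^sup>2 = pi / 4 * ((3 * x)\<^sup>2 - x\<^sup>2) * (2 + 7 / r * x)"
    by (simp add: power_mult_distrib mult_ac)
  ultimately have m2: "pi / 4 * ((3 * x)\<^sup>2 - x\<^sup>2) * (2 + 7 / r * x) \<le> (15961 / 1000) * x\<^sup>2" by linarith
  have "13 / 22 + ln v + x\<^sup>2 + ((461896 / 100000) * x + (26026 / 10000) * x\<^sup>2) + (15961 / 1000) * x\<^sup>2 \<le> (157 / 100)"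
  proof (cases "s \<le> 10")
    case True
    have "ln v \<le> v - 1" by (rule ln_le_minus_one[OF v])
    moreover have "x \<le> ((74833 / 10000) + 10 - s) / ((74833 / 10000) * 10)" unfolding x_def using s True by (intro inverse_le_chord) auto
    moreover have "x\<^sup>2 \<le> (1 / 10 + 1 / (74833 / 10000)) * x - 1 / 10 * (1 / (74833 / 10000))"
      using x s True by (intro square_le_chord) (auto simp: x_def field_simps)
    ultimately show ?thesis using v2 s True by simp
  next
    case False
    \<comment> \<open>\<open>1.648\<close> is just below the square root of
      \<open>exp 1\<close>.\<close>
    have "ln ((1648 / 1000)::real) \<le> 1 / 2"
    proof -
      have "((1648 / 1000)::real)\<^sup>2 \<le> exp 1" using e_approx_32 by (simp add: abs_if power2_eq_square split: if_split_asm)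
      then have "ln (((1648 / 1000)::real)\<^sup>2) \<le> ln (exp 1)" by (intro ln_mono) auto
      then show ?thesis by (simp add: ln_realpow)
    qed
    then have "ln v \<le> v / (1648 / 1000) - 1 / 2" using ln_le_linear[OF v, of "(1648 / 1000)"] by simp
    moreover have "x \<le> (10 + (158114 / 10000) - s) / (10 * (158114 / 10000))" unfolding x_def using s False by (intro inverse_le_chord) auto
    moreover have "x\<^sup>2 \<le> (1 / (158114 / 10000) + 1 / 10) * x - 1 / (158114 / 10000) * (1 / 10)"
      using x s False by (intro square_le_chord) (auto simp: x_def field_simps)
    ultimately show ?thesis using v2 s False by simp
  qed
  moreover have "norm (zeta (1 + \<i> * of_real t)) \<le> ln t / 2 + 13 / 22 + ln v + x\<^sup>2
    + (3 * x - x) / 2 * (4 / r + 2 / r * (1 + 1 / (1 - r * x)))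
    + pi / 4 * ((3 * x)\<^sup>2 - x\<^sup>2) * (2 + 7 / r * x)"
    using norm_zeta_le_scaled[of t 1] t rx
    by (simp add: s_def[symmetric] x_def[symmetric] r_def[symmetric] v_def del: power_mult_distrib)
  ultimately show ?thesis using m1 m2 by linarith
qed


text \<open>For large \<open>t\<close> the bound is minimal when \<open>y\<close> is close to \<open>0.32\<close>.\<close>

lemma norm_zeta_le_large_aux:
  fixes t :: real
  assumes t: "250 \<le> t"
  obtains x y :: real where
    "x = 1 / sqrt t" "(32 / 100) - x \<le> y" "y \<le> (32 / 100) + x"
    "norm (zeta (1 + \<i> * of_real t)) \<le> ln t / 2 + 13 / 22
      + (1 / (pi * y) + pi * y * x\<^sup>2 / 4 + 3 / 2 * x - 1) + x\<^sup>2
      + (y - x) / 2 * ((461896 / 100000) + (22468 / 10000) * x) + (7854 / 10000) * (y\<^sup>2 - x\<^sup>2) * (2 + (4042 / 1000) * x)"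
proof -
  define x where "x = 1 / sqrt t"
  define r where "r = sqrt (3::real)"
  \<comment> \<open>This puts \<open>y = (2 * K + 1) * x\<close> within \<open>x\<close> of
    \<open>0.32\<close>. As \<open>0.32\<close> is close to \<open>1 / pi\<close>, the argument
    \<open>v\<close> is close to 1 for small \<open>x\<close>, and \<open>ln v <= v - 1\<close>
    loses little.\<close>
  define K where "K = nat \<lfloor>(16 / 100) / x\<rfloor>"
  define y where "y = (2 * real K + 1) * x"
  have s: "(158113 / 10000) \<le> sqrt t" using t by (intro real_le_rsqrt) (simp add: power2_eq_square)
  have x: "0 < x" "x \<le> (6325 / 100000)" using s t by (auto simp: x_def field_simps)
  have r: "(1732 / 1000) \<le> r" "r \<le> (17321 / 10000)" "r * r = 3" using sqrt3_bounds by (auto simp: r_def)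
  have "real K \<le> (16 / 100) / x" "(16 / 100) / x < real K + 1" using x by (auto simp: K_def)
  then have K: "real K * x \<le> (16 / 100)" "(16 / 100) < (real K + 1) * x" using x by (auto simp: field_simps)
  then have y: "(32 / 100) - x \<le> y" "y \<le> (32 / 100) + x" by (simp_all add: y_def algebra_simps)
  have y0: "y > 0" using y x by simp
  define v where "v = 1 / (pi * y) + pi * y * x\<^sup>2 / 4 + 3 / 2 * x"
  have v: "v > 0" unfolding v_def using x y0 by (intro add_pos_pos) auto
  have rx: "r * x \<le> (17321 / 10000) * (6325 / 100000)" "0 \<le> r * x" using mult_mono[of r "(17321 / 10000)" x "(6325 / 100000)"] r x by simp_all
  have ir: "1 / r \<le> (57737 / 100000)" "0 < 1 / r" using r by (auto simp: field_simps)
  have "1 / (1 - r * x) \<le> 1 + (11231 / 10000) * (r * x)"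
  proof -
    have "0 \<le> (r * x) * ((1231 / 10000) - (11231 / 10000) * (r * x))" using rx by (rule_tac mult_nonneg_nonneg) auto
    then have "1 \<le> (1 + (11231 / 10000) * (r * x)) * (1 - r * x)" by (simp add: algebra_simps)
    then show ?thesis using rx by (simp add: field_simps)
  qed
  then have "2 / r * (1 + 1 / (1 - r * x)) \<le> 2 / r * (2 + (11231 / 10000) * (r * x))"
    using r by (intro mult_left_mono) auto
  also have "\<dots> = 4 * (1 / r) + (22462 / 10000) * x" using r by (simp add: field_simps)
  finally have "4 / r + 2 / r * (1 + 1 / (1 - r * x)) \<le> 8 * (1 / r) + (22462 / 10000) * x" by simp
  also have "\<dots> \<le> (461896 / 100000) + (22468 / 10000) * x" using ir x by simp
  finally have m1: "(y - x) / 2 * (4 / r + 2 / r * (1 + 1 / (1 - r * x))) \<le> (y - x) / 2 * ((461896 / 100000) + (22468 / 10000) * x)"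
    using x by (intro mult_left_mono) (auto simp: y_def)
  have yx: "0 \<le> y\<^sup>2 - x\<^sup>2" using x by (simp add: y_def power_mult_distrib mult_le_cancel_right1 one_le_power)
  have "7 * (1 / r) * x \<le> (4042 / 1000) * x" using ir x by (intro mult_right_mono) auto
  then have "7 / r * x \<le> (4042 / 1000) * x" by simp
  then have m2: "pi / 4 * (y\<^sup>2 - x\<^sup>2) * (2 + 7 / r * x) \<le> (7854 / 10000) * (y\<^sup>2 - x\<^sup>2) * (2 + (4042 / 1000) * x)"
    using pi_approx r x yx by (intro mult_mono) auto
  have "norm (zeta (1 + \<i> * of_real t)) \<le> ln t / 2 + 13 / 22 + ln v + x\<^sup>2
    + (y - x) / 2 * (4 / r + 2 / r * (1 + 1 / (1 - r * x)))
    + pi / 4 * (y\<^sup>2 - x\<^sup>2) * (2 + 7 / r * x)"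
  proof -
    have "r * (real K * x) \<le> (17321 / 10000) * (16 / 100)" using r K x by (intro mult_mono) auto
    then have "12 < t \<and> real K * (r * x) < 1 / 2" using t by (simp add: algebra_simps)
    then show ?thesis
      using norm_zeta_le_scaled[of t K] t
      unfolding x_def[symmetric] r_def[symmetric] y_def[symmetric] v_def[symmetric] by simp
  qed
  then have "norm (zeta (1 + \<i> * of_real t)) \<le> ln t / 2 + 13 / 22 + (v - 1) + x\<^sup>2
    + (y - x) / 2 * ((461896 / 100000) + (22468 / 10000) * x) + (7854 / 10000) * (y\<^sup>2 - x\<^sup>2) * (2 + (4042 / 1000) * x)"
    using m1 m2 ln_le_minus_one[OF v] by linarith
  then show ?thesis using that[of x y] y by (simp only: x_def v_def)
qed

lemma norm_zeta_le_large:
  fixes t :: real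
  assumes t: "250 \<le> t"
  shows "norm (zeta (1 + \<i> * of_real t)) \<le> ln t / 2 + 157 / 100"
proof -
  obtain x y where xy: "x = 1 / sqrt t" "(32 / 100) - x \<le> y" "y \<le> (32 / 100) + x" and
    Z: "norm (zeta (1 + \<i> * of_real t)) \<le> ln t / 2 + 13 / 22
      + (1 / (pi * y) + pi * y * x\<^sup>2 / 4 + 3 / 2 * x - 1) + x\<^sup>2
      + (y - x) / 2 * ((461896 / 100000) + (22468 / 10000) * x) + (7854 / 10000) * (y\<^sup>2 - x\<^sup>2) * (2 + (4042 / 1000) * x)"
    by (rule norm_zeta_le_large_aux[OF t]) (rule that)
  have "(158113 / 10000) \<le> sqrt t" using t by (intro real_le_rsqrt) (simp add: power2_eq_square)
  then have x: "0 < x" "x \<le> (6325 / 100000)" using t by (auto simp: xy(1) field_simps)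
  have y: "(25675 / 100000) \<le> y" "y \<le> (38325 / 100000)" using xy(2,3) x by simp_all
  have "1 / (pi * y) = 1 / pi * (1 / y)" by simp
  also have "\<dots> \<le> 1 / (31415 / 10000) * (((25675 / 100000) + (38325 / 100000) - y) / ((25675 / 100000) * (38325 / 100000)))"
    using pi_approx y by (intro mult_mono inverse_le_chord frac_le) auto
  finally have 1: "1 / (pi * y) \<le> (3235 / 1000) * ((64 / 100) - y)" using y by simp
  have xx: "x\<^sup>2 \<le> (6325 / 100000) * x" using x by (simp add: power2_eq_square)
  have "pi * y * x\<^sup>2 / 4 \<le> (31416 / 10000) * (38325 / 100000) * ((6325 / 100000) * x) / 4"
    using pi_approx x xx y by (intro divide_right_mono mult_mono) auto
  then have 2: "pi * y * x\<^sup>2 / 4 \<le> (2 / 100) * x" using x by simp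
  have "(y - x) / 2 * ((461896 / 100000) + (22468 / 10000) * x) = (230948 / 100000) * (y - x) + (11234 / 10000) * (y * x) - (11234 / 10000) * x\<^sup>2"
    by (simp add: field_simps power2_eq_square)
  moreover have "y * x \<le> (38325 / 100000) * x" using x y by (intro mult_right_mono) auto
  ultimately have 3: "(y - x) / 2 * ((461896 / 100000) + (22468 / 10000) * x) \<le> (230948 / 100000) * (y - x) + (4306 / 10000) * x"
    using zero_le_power2[of x] x by linarith
  have y2: "y\<^sup>2 \<le> (64 / 100) * y - (983994 / 10000000)" using square_le_chord[OF y] by simp
  have "y\<^sup>2 \<le> (38325 / 100000)\<^sup>2" using y by (intro power_mono) auto
  then have y2x: "y\<^sup>2 * x \<le> (14689 / 100000) * x" using x by (intro mult_right_mono) (auto simp: power2_eq_square)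
  have "(7854 / 10000) * (y\<^sup>2 - x\<^sup>2) * (2 + (4042 / 1000) * x) \<le> (7854 / 10000) * y\<^sup>2 * (2 + (4042 / 1000) * x)"
    using x by (intro mult_right_mono) auto
  also have "\<dots> = (15708 / 10000) * y\<^sup>2 + (7854 / 10000) * (4042 / 1000) * (y\<^sup>2 * x)"
    by (simp add: algebra_simps)
  also have "\<dots> \<le> (15708 / 10000) * ((64 / 100) * y - (983994 / 10000000)) + (4667 / 10000) * x"
  proof (rule add_mono)
    have "(7854 / 10000) * (4042 / 1000) * (y\<^sup>2 * x) \<le> (7854 / 10000) * (4042 / 1000) * ((14689 / 100000) * x)"
      using y2x by (intro mult_left_mono) auto
    also have "\<dots> \<le> (4667 / 10000) * x" using x by simp
    finally show "(7854 / 10000) * (4042 / 1000) * (y\<^sup>2 * x) \<le> (4667 / 10000) * x" .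
  qed (use y2 in \<open>intro mult_left_mono, auto\<close>)
  finally have 4: "(7854 / 10000) * (y\<^sup>2 - x\<^sup>2) * (2 + (4042 / 1000) * x)
      \<le> (15708 / 10000) * ((64 / 100) * y - (983994 / 10000000)) + (4667 / 10000) * x" .
  have "z \<le> L + 157 / 100"
    if "z \<le> L + 13 / 22 + (a + b + 3 / 2 * x - 1) + c + e + f" "a \<le> (3235 / 1000) * ((64 / 100) - y)" "b \<le> (2 / 100) * x"
      "c \<le> (6325 / 100000) * x" "e \<le> (230948 / 100000) * (y - x) + (4306 / 10000) * x"
      "f \<le> (15708 / 10000) * ((64 / 100) * y - (983994 / 10000000)) + (4667 / 10000) * x" for z L a b c e f :: real
    using that x y by (simp add: field_simps)
  from this[OF Z 1 2 xx 3 4] show ?thesis .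
qed

text \<open>Now \<open>x <= 1 / 10000\<close> pins \<open>y\<close> to \<open>0.32\<close> up to
  \<open>1 / 10000\<close>, so all terms are evaluated as constants; they add up to about 1.487. The
  gain over \<open>1.57\<close> is needed to reach \<open>4.8 * 10 ^ 8\<close> in the second
  claim.\<close>

lemma norm_zeta_le_huge:
  fixes t :: real
  assumes t: "10 ^ 8 \<le> t"
  shows "norm (zeta (1 + \<i> * of_real t)) \<le> ln t / 2 + 149 / 100"
proof -
  obtain x y where xy: "x = 1 / sqrt t" "(32 / 100) - x \<le> y" "y \<le> (32 / 100) + x" and
    Z: "norm (zeta (1 + \<i> * of_real t)) \<le> ln t / 2 + 13 / 22
      + (1 / (pi * y) + pi * y * x\<^sup>2 / 4 + 3 / 2 * x - 1) + x\<^sup>2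
      + (y - x) / 2 * ((461896 / 100000) + (22468 / 10000) * x) + (7854 / 10000) * (y\<^sup>2 - x\<^sup>2) * (2 + (4042 / 1000) * x)"
    by (rule norm_zeta_le_large_aux[of t]) (use t in simp, rule that)
  have "10000 \<le> sqrt t" using t by (intro real_le_rsqrt) (simp add: power2_eq_square)
  then have x: "0 < x" "x \<le> (1 / 10000)" using t by (auto simp: xy(1) field_simps)
  have y: "(3199 / 10000) \<le> y" "y \<le> (3201 / 10000)" using xy(2,3) x by simp_all
  have "1 / (pi * y) \<le> 1 / ((31415 / 10000) * (3199 / 10000))"
    using pi_approx y by (intro divide_left_mono mult_mono) auto
  then have 1: "1 / (pi * y) \<le> (99508 / 100000)" by simp
  have "x\<^sup>2 \<le> (1 / 10000) * x" using x by (simp add: power2_eq_square)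
  then have xx: "x\<^sup>2 \<le> (1 / 100000000)" using x by simp
  have "pi * y * x\<^sup>2 / 4 \<le> (31416 / 10000) * (3201 / 10000) * (1 / 100000000) / 4"
    using pi_approx x xx y by (intro divide_right_mono mult_mono) auto
  then have 2: "pi * y * x\<^sup>2 / 4 \<le> (1 / 100000)" by simp
  have "(y - x) / 2 * ((461896 / 100000) + (22468 / 10000) * x) \<le> ((3201 / 10000) - 0) / 2 * ((461896 / 100000) + (22468 / 10000) * (1 / 10000))"
    using x y by (intro mult_mono divide_right_mono) auto
  then have 3: "(y - x) / 2 * ((461896 / 100000) + (22468 / 10000) * x) \<le> (7394 / 10000)" by simp
  have "(7854 / 10000) * (y\<^sup>2 - x\<^sup>2) * (2 + (4042 / 1000) * x) \<le> (7854 / 10000) * ((3201 / 10000)\<^sup>2 - 0) * (2 + (4042 / 1000) * (1 / 10000))"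
    using x y by (intro mult_mono diff_mono power_mono) (auto intro!: power_mono)
  then have 4: "(7854 / 10000) * (y\<^sup>2 - x\<^sup>2) * (2 + (4042 / 1000) * x) \<le> (1611 / 10000)" by (simp add: power2_eq_square)
  show ?thesis using Z 1 2 3 4 xx x by linarith
qed

section \<open>Van der Corput differencing\<close>

lemma sum_weight_Suc:
  fixes f :: "nat \<Rightarrow> real"
  shows "(\<Sum>h=1..<Suc H. real (Suc H - h) * f h) = (\<Sum>h=1..<H. real (H - h) * f h) + (\<Sum>h=1..<Suc H. f h)"
proof -
  have "(\<Sum>h=1..<Suc H. real (Suc H - h) * f h) = (\<Sum>h=1..<Suc H. real (H - h) * f h + f h)"
    by (intro sum.cong) (auto simp: Suc_diff_le algebra_simps)
  also have "\<dots> = (\<Sum>h=1..<H. real (H - h) * f h) + (\<Sum>h=1..<Suc H. f h)"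
    unfolding sum.distrib by (cases "H = 0") auto
  finally show ?thesis .
qed

lemma sum_weight_const_le: "(\<Sum>h=1..<H. real (H - h) * 1) \<le> (real H)\<^sup>2 / 2"
proof (induction H)
  case (Suc H)
  then show ?case
    unfolding sum_weight_Suc by (simp add: power2_eq_square algebra_simps)
qed simp

lemma sum_weight_id_le: "(\<Sum>h=1..<H. real (H - h) * real h) \<le> (real H) ^ 3 / 6"
proof -
  have S: "(\<Sum>h=1..<Suc H. real h) = real H * (real H + 1) / 2" for H
    by (induction H) (auto simp: field_simps)
  have "(\<Sum>h=1..<H. real (H - h) * real h) = ((real H) ^ 3 - real H) / 6"
  proof (induction H)
    case (Suc H)
    then show ?case unfolding sum_weight_Suc S by (simp add: field_simps power3_eq_cube)
  qed simp
  then show ?thesis by simp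
qed

text \<open>AM-GM with parameter \<open>g\<close> reduces the square root to the weights
  \<open>h\<close> and 1. The value \<open>g = sqrt (H / 3)\<close> makes the two resulting terms
  equal and their sum minimal; \<open>0.2887\<close> rounds \<open>sqrt 3 / 6\<close> up.\<close>

lemma sum_weight_sqrt_le: "(\<Sum>h=1..<H. real (H - h) * sqrt (real h)) \<le> (2887 / 10000) * ((real H)\<^sup>2 * sqrt (real H))"
proof (cases "H = 0")
  case False
  define r where "r = sqrt (real H)"
  have r: "r > 0" "r\<^sup>2 = real H" using False by (simp_all add: r_def)
  define g where "g = r / sqrt 3"
  have g: "g > 0" "g * sqrt 3 = r" using r by (simp_all add: g_def)
  have le: "sqrt (real h) \<le> real h * (1 / (2 * g)) + 1 * (g / 2)" for h
  proof -
    have "0 \<le> (sqrt (real h) - g)\<^sup>2" by simp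
    then show ?thesis using g by (simp add: field_simps power2_diff) (simp add: power2_eq_square)
  qed
  have "(\<Sum>h=1..<H. real (H - h) * sqrt (real h)) \<le> (\<Sum>h=1..<H. real (H - h) * (real h * (1 / (2 * g)) + 1 * (g / 2)))"
    by (intro sum_mono mult_left_mono le) auto
  also have "\<dots> = (\<Sum>h=1..<H. real (H - h) * real h) * (1 / (2 * g)) + (\<Sum>h=1..<H. real (H - h) * 1) * (g / 2)"
    unfolding sum_distrib_right sum.distrib[symmetric] by (intro sum.cong refl) (simp only: distrib_left mult.assoc)
  also have "\<dots> \<le> (real H) ^ 3 / 6 * (1 / (2 * g)) + (real H)\<^sup>2 / 2 * (g / 2)"
    using g by (intro add_mono mult_right_mono sum_weight_id_le sum_weight_const_le) auto
  also have "\<dots> = (real H)\<^sup>2 * r * (sqrt 3 / 6)"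
  proof -
    have A: "real H ^ 3 / 6 * (1 / (2 * g)) = (real H)\<^sup>2 * r * (sqrt 3 / 12)"
    proof -
      have "real H = r * (g * sqrt 3)" using g r by (simp add: power2_eq_square)
      then have "real H / g = r * sqrt 3" using g(1) by (simp add: field_simps)
      moreover have "real H ^ 3 / 6 * (1 / (2 * g)) = (real H)\<^sup>2 * (real H / g) / 12" by (simp add: power3_eq_cube power2_eq_square)
      ultimately show ?thesis by simp
    qed
    have "g = r * (sqrt 3 / 3)" using g by (simp add: g_def field_simps)
    then have B: "(real H)\<^sup>2 / 2 * (g / 2) = (real H)\<^sup>2 * r * (sqrt 3 / 12)" by simp
    show ?thesis unfolding A B by (simp add: algebra_simps)
  qed
  also have "\<dots> \<le> (real H)\<^sup>2 * r * (2887 / 10000)"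
    using sqrt3_bounds r by (intro mult_left_mono) auto
  finally show ?thesis by (simp add: r_def)
qed simp

lemma sum_inverse_sqrt_le: "(\<Sum>h=1..<Suc H. 1 / sqrt (real h)) \<le> 2 * sqrt (real H)"
proof (induction H)
  case (Suc H)
  have "1 / sqrt (real (Suc H)) \<le> 2 * sqrt (real (Suc H)) - 2 * sqrt (real H)"
  proof -
    define r s where "r = sqrt (real (Suc H))" and "s = sqrt (real H)"
    have rs: "r\<^sup>2 = s\<^sup>2 + 1" "r > 0" "s \<ge> 0" by (simp_all add: r_def s_def)
    have "0 \<le> (r - s)\<^sup>2" by simp
    then have "2 * (s * r) + 1 \<le> 2 * r\<^sup>2" using rs by (simp add: power2_eq_square algebra_simps)
    then show ?thesis
      unfolding r_def[symmetric] s_def[symmetric] using rs by (simp add: field_simps power2_eq_square)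
  qed
  then show ?case using Suc by simp
qed simp

text \<open>\<open>4 / 3\<close> is the integral of \<open>(1 - x) / sqrt x\<close> over the unit
  interval. The induction step reduces to \<open>(r - s)^2 * (2 * r + s) >= 0\<close> for the roots
  of consecutive integers.\<close>

lemma sum_weight_inverse_sqrt_le:
  "(\<Sum>h=1..<H. real (H - h) * (1 / sqrt (real h))) \<le> 4 / 3 * (real H * sqrt (real H))"
proof (induction H)
  case (Suc H)
  define r s where "r = sqrt (real (Suc H))" and "s = sqrt (real H)"
  have rs: "r\<^sup>2 = s\<^sup>2 + 1" "r > 0" "s \<ge> 0" by (simp_all add: r_def s_def)
  have "2 * (r ^ 3 - s ^ 3) - 3 * s * (r\<^sup>2 - s\<^sup>2) = (r - s)\<^sup>2 * (2 * r + s)"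
    by (simp add: algebra_simps power2_eq_square power3_eq_cube)
  then have C: "2 * (r ^ 3 - s ^ 3) - 3 * s \<ge> 0" using rs by simp
  have A: "real (Suc H) * r = r ^ 3" "real H * s = s ^ 3"
  proof -
    have "real (Suc H) = r\<^sup>2" "real H = s\<^sup>2" by (simp_all add: r_def s_def)
    then show "real (Suc H) * r = r ^ 3" "real H * s = s ^ 3" by (simp_all only: power2_eq_square power3_eq_cube)
  qed
  have "4 / 3 * (real H * s) + 2 * s \<le> 4 / 3 * (real (Suc H) * r)" unfolding A using C by simp
  then show ?case
    unfolding sum_weight_Suc using Suc sum_inverse_sqrt_le[of H]
    unfolding r_def[symmetric] s_def[symmetric] by linarith
qed simp

lemma sum_sum_dist:
  fixes f :: "nat \<Rightarrow> real"
  shows "(\<Sum>i<H. \<Sum>j<H. f (if j \<le> i then i - j else j - i)) = real H * f 0 + 2 * (\<Sum>h=1..<H. real (H - h) * f h)"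
proof (induction H)
  case (Suc H)
  let ?g = "\<lambda>i j. f (if j \<le> i then i - j else j - i)"
  have flip: "(\<Sum>j<H. f (H - j)) = (\<Sum>h=1..<Suc H. f h)"
    by (rule sum.reindex_bij_witness[of _ "\<lambda>h. H - h" "\<lambda>j. H - j"]) auto
  have "(\<Sum>i<Suc H. \<Sum>j<Suc H. ?g i j) = (\<Sum>i<H. \<Sum>j<H. ?g i j) + (\<Sum>i<H. ?g i H) + (\<Sum>j<H. ?g H j) + f 0"
    by (simp add: sum.distrib)
  also have "(\<Sum>i<H. ?g i H) = (\<Sum>j<H. f (H - j))" by (intro sum.cong) auto
  also have "(\<Sum>j<H. ?g H j) = (\<Sum>j<H. f (H - j))" by (intro sum.cong) auto
  finally have 1: "(\<Sum>i<Suc H. \<Sum>j<Suc H. ?g i j) = real H * f 0 + 2 * (\<Sum>h=1..<H. real (H - h) * f h) + 2 * (\<Sum>h=1..<Suc H. f h) + f 0"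
    unfolding Suc.IH flip by simp
  show ?case unfolding 1 sum_weight_Suc by (simp add: algebra_simps)
qed simp

text \<open>Summing the window sums \<open>F m\<close> of length \<open>H\<close> counts every
  \<open>c n\<close> exactly \<open>H\<close> times. Cauchy-Schwarz over the windows leads to the
  squares of the \<open>F m\<close>, and expanding these yields the correlations, which depend only
  on the distance of the two shifts.\<close>

lemma van_der_Corput_inequality:
  fixes c :: "nat \<Rightarrow> complex"
  assumes "a \<le> b" "0 < H" "H \<le> a"
  shows "(real H * norm (\<Sum>n=a..<b. c n))\<^sup>2
    \<le> real (b - a + H) * (real H * (\<Sum>n=a..<b. (norm (c n))\<^sup>2)
        + 2 * (\<Sum>h=1..<H. real (H - h) * norm (\<Sum>n=a..<b - h. c (n + h) * cnj (c n))))"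
proof -
  define d where "d = (\<lambda>n. if a \<le> n \<and> n < b then c n else 0)"
  \<comment> \<open>The starting points of all windows that meet the range; \<open>H <= a\<close>
    prevents the subtraction from being truncated.\<close>
  define A where "A = {a + 1 - H..<b}"
  define F where "F = (\<lambda>m. \<Sum>j<H. d (m + j))"
  define R where "R = (\<lambda>h. \<Sum>n=a..<b - h. c (n + h) * cnj (c n))"
  have shift: "(\<Sum>m\<in>A. f (m + j)) = (\<Sum>n=a..<b'. f n)"
    if "j < H" "b' \<le> b" "\<And>n. n < a \<or> b' \<le> n \<Longrightarrow> f n = 0" for f :: "nat \<Rightarrow> complex" and j b'
  proof -
    have "(\<Sum>m\<in>A. f (m + j)) = (\<Sum>n=a + 1 - H + j..<b + j. f n)"
      unfolding A_def by (rule sum.shift_bounds_nat_ivl[symmetric])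
    also have "\<dots> = (\<Sum>n=a..<b'. f n)"
      using that assms by (intro sum.mono_neutral_right) auto
    finally show ?thesis .
  qed
  have "(\<Sum>m\<in>A. F m) = (\<Sum>j<H. \<Sum>m\<in>A. d (m + j))" unfolding F_def by (rule sum.swap)
  also have "\<dots> = (\<Sum>j<H. \<Sum>n=a..<b. d n)" by (intro sum.cong refl shift) (auto simp: d_def)
  also have "\<dots> = of_nat H * (\<Sum>n=a..<b. c n)" by (simp add: d_def)
  finally have HS: "(\<Sum>m\<in>A. F m) = of_nat H * (\<Sum>n=a..<b. c n)" .
  have corr: "(\<Sum>m\<in>A. d (m + i) * cnj (d (m + j))) = R (i - j)" if "j \<le> i" "i < H" for i j
  proof -
    have "(\<Sum>m\<in>A. d (m + i) * cnj (d (m + j))) = (\<Sum>m\<in>A. (\<lambda>n. d (n + (i - j)) * cnj (d n)) (m + j))"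
      using that by simp
    also have "\<dots> = (\<Sum>n=a..<b - (i - j). d (n + (i - j)) * cnj (d n))"
      using that by (intro shift) (auto simp: d_def)
    also have "\<dots> = R (i - j)" unfolding R_def by (intro sum.cong) (auto simp: d_def)
    finally show ?thesis .
  qed
  have corr': "norm (\<Sum>m\<in>A. d (m + i) * cnj (d (m + j))) = norm (R (if j \<le> i then i - j else j - i))"
    if "i < H" "j < H" for i j
  proof (cases "j \<le> i")
    case False
    have "(\<Sum>m\<in>A. d (m + i) * cnj (d (m + j))) = cnj (\<Sum>m\<in>A. d (m + j) * cnj (d (m + i)))"
      by (simp add: mult.commute)
    then show ?thesis using corr[of i j] False that by simp
  qed (use corr that in auto)
  have "(norm (\<Sum>m\<in>A. F m))\<^sup>2 \<le> (\<Sum>m\<in>A. norm (F m))\<^sup>2" by (intro power_mono norm_sum) auto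
  also have "\<dots> \<le> real (card A) * (\<Sum>m\<in>A. (norm (F m))\<^sup>2)"
    using sum_squared_le_sum_of_squares[of "\<lambda>m. norm (F m)" A] by (simp add: mult.commute)
  also have "\<dots> \<le> real (b - a + H) * (\<Sum>m\<in>A. (norm (F m))\<^sup>2)"
    using assms by (intro mult_right_mono sum_nonneg) (auto simp: A_def)
  also have "(\<Sum>m\<in>A. (norm (F m))\<^sup>2) \<le> (\<Sum>i<H. \<Sum>j<H. norm (R (if j \<le> i then i - j else j - i)))"
  proof -
    have "complex_of_real (\<Sum>m\<in>A. (norm (F m))\<^sup>2) = (\<Sum>m\<in>A. F m * cnj (F m))"
      by (simp only: of_real_sum complex_norm_square)
    also have "\<dots> = (\<Sum>m\<in>A. \<Sum>i<H. \<Sum>j<H. d (m + i) * cnj (d (m + j)))"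
      by (simp add: F_def sum_product)
    also have "\<dots> = (\<Sum>i<H. \<Sum>m\<in>A. \<Sum>j<H. d (m + i) * cnj (d (m + j)))" by (rule sum.swap)
    also have "\<dots> = (\<Sum>i<H. \<Sum>j<H. \<Sum>m\<in>A. d (m + i) * cnj (d (m + j)))"
      by (intro sum.cong refl sum.swap)
    finally have "norm (complex_of_real (\<Sum>m\<in>A. (norm (F m))\<^sup>2)) = norm (\<Sum>i<H. \<Sum>j<H. \<Sum>m\<in>A. d (m + i) * cnj (d (m + j)))" by simp
    also have "\<dots> \<le> (\<Sum>i<H. \<Sum>j<H. norm (\<Sum>m\<in>A. d (m + i) * cnj (d (m + j))))"
      by (intro sum_norm_le order_refl)
    also have "\<dots> = (\<Sum>i<H. \<Sum>j<H. norm (R (if j \<le> i then i - j else j - i)))"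
      by (intro sum.cong refl corr') auto
    finally show ?thesis by (simp add: sum_nonneg del: of_real_sum)
  qed
  also have "(\<Sum>i<H. \<Sum>j<H. norm (R (if j \<le> i then i - j else j - i)))
      = real H * norm (R 0) + 2 * (\<Sum>h=1..<H. real (H - h) * norm (R h))"
    by (rule sum_sum_dist)
  also have "norm (R 0) \<le> (\<Sum>n=a..<b. (norm (c n))\<^sup>2)"
    unfolding R_def by (rule order_trans[OF norm_sum]) (simp add: norm_mult power2_eq_square)
  finally show ?thesis
    unfolding HS R_def by (simp add: norm_mult mult_left_mono)
qed

section \<open>The second derivative test\<close>

text \<open>The section estimate with constant weight, \<open>p = 1\<close> and
  \<open>c = 0\<close>. The half-phase falls by at least \<open>l / 2\<close> per step, so
  \<open>E = E' = 2 / l\<close>, and \<open>d = sqrt (3 * l) / 2\<close> minimizes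
  \<open>2 / d + 8 * d / (3 * l)\<close>. The condition \<open>l <= 3\<close> keeps \<open>d\<close>
  below \<open>pi / 2\<close>.\<close>

lemma sum_cis_section_unweighted_le:
  fixes z :: "nat \<Rightarrow> complex" and al :: "nat \<Rightarrow> real" and l :: real and k :: int
  assumes l: "0 < l" "l \<le> 3" and z: "\<And>n. norm (z n) = 1"
    and al: "\<And>n. a \<le> n \<Longrightarrow> n < b \<Longrightarrow> z (Suc n) = z n * cis (al n)"
    and gap: "\<And>n. a \<le> n \<Longrightarrow> Suc n < b \<Longrightarrow> l \<le> al n - al (Suc n)"
    and sec: "\<And>n. a \<le> n \<Longrightarrow> n < b \<Longrightarrow> (2 * k - 1) * pi \<le> al n \<and> al n \<le> (2 * k + 1) * pi"
  shows "norm (\<Sum>n=a..<b. (z n + z (Suc n)) / 2) \<le> 8 / sqrt (3 * l) + 2"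
proof -
  define d where "d = sqrt (3 * l) / 2"
  have d: "0 < d" "d < pi / 2"
  proof -
    have "sqrt (3 * l) \<le> sqrt (3\<^sup>2)" using l by (intro real_sqrt_le_mono) auto
    then show "d < pi / 2" using pi_gt3 by (simp add: d_def)
  qed (use l in \<open>simp add: d_def\<close>)
  have "norm (\<Sum>n=a..<b. of_real (1 + 0 * (al n / 2 - pi * k)) * ((z n + z (Suc n)) / 2))
     \<le> 2 * 1 / d + (2 * 1 + 0 * d) + (2 * d / 3) * (2 / l + 2 / l)"
  proof (rule cis_sum_section_le[OF d])
    fix n
    show "z (Suc n) = z n * cis (2 * (al n / 2 - pi * k))" if "a \<le> n" "n < b"
    proof -
      have "cis (2 * (al n / 2 - pi * k)) = cis (al n) * cis (2 * pi * (- of_int k))"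
        unfolding cis_mult by (rule arg_cong[of _ _ cis]) (simp add: algebra_simps)
      also have "cis (2 * pi * (- of_int k)) = 1" by (rule cis_multiple_2pi) simp
      finally show ?thesis using al[OF that] by simp
    qed
    show "- pi / 2 \<le> al n / 2 - pi * k \<and> al n / 2 - pi * k \<le> pi / 2" if "a \<le> n" "n < b"
      using sec[OF that] by (simp add: algebra_simps)
    show "al (Suc n) / 2 - pi * k \<le> al n / 2 - pi * k" if "a \<le> n" "Suc n < b"
      using gap[OF that] l by simp
    show "1 + 0 * (al n / 2 - pi * k) \<le> 2 / l * (al n / 2 - pi * k - (al (Suc n) / 2 - pi * k))"
      if "a \<le> n" "Suc n < b" using gap[OF that] l by (simp add: field_simps)
    show "1 + 0 * (al (Suc n) / 2 - pi * k) \<le> 2 / l * (al n / 2 - pi * k - (al (Suc n) / 2 - pi * k))"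
      if "a \<le> n" "Suc n < b" using gap[OF that] l by (simp add: field_simps)
  qed (use l z in auto)
  also have "2 * 1 / d + (2 * 1 + 0 * d) + (2 * d / 3) * (2 / l + 2 / l) = 8 / sqrt (3 * l) + 2"
  proof -
    have "sqrt (3 * l) * sqrt (3 * l) = 3 * l" using l by simp
    then have "(2 * d / 3) * (2 / l + 2 / l) = 4 / sqrt (3 * l)"
      using l by (simp add: d_def field_simps)
    then show ?thesis by (simp add: d_def)
  qed
  finally show ?thesis by simp
qed

text \<open>The phase increments decrease, so the section with the largest ones comes first; the
  induction on \<open>J\<close> splits it off at \<open>m\<close>.\<close>

lemma sum_cis_sections_le:
  fixes z :: "nat \<Rightarrow> complex" and al :: "nat \<Rightarrow> real" and l :: real and k :: int
  assumes l: "0 < l" "l \<le> 3" and z: "\<And>n. norm (z n) = 1"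
    and al: "\<And>n. a \<le> n \<Longrightarrow> n < b \<Longrightarrow> z (Suc n) = z n * cis (al n)"
    and gap: "\<And>n. a \<le> n \<Longrightarrow> Suc n < b \<Longrightarrow> l \<le> al n - al (Suc n)"
    and sec: "\<And>n. a \<le> n \<Longrightarrow> n < b \<Longrightarrow> (2 * k - 1) * pi < al n \<and> al n \<le> (2 * (k + int J) - 1) * pi"
  shows "norm (\<Sum>n=a..<b. (z n + z (Suc n)) / 2) \<le> real J * (8 / sqrt (3 * l) + 2)"
  using al gap sec
proof (induction J arbitrary: a)
  case 0
  have "\<not> a < b" using "0.prems"(3)[of a] by auto
  then show ?case by simp
next
  case (Suc J)
  define c where "c = 8 / sqrt (3 * l) + 2"
  have c: "0 \<le> c" using l by (simp add: c_def)
  show ?case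
  proof (cases "a \<le> b")
    case True
    define m where "m = (LEAST n. a \<le> n \<and> (b \<le> n \<or> al n \<le> (2 * (k + int J) - 1) * pi))"
    have m: "a \<le> m" "b \<le> m \<or> al m \<le> (2 * (k + int J) - 1) * pi" "m \<le> b"
      using LeastI[of "\<lambda>n. a \<le> n \<and> (b \<le> n \<or> al n \<le> (2 * (k + int J) - 1) * pi)" b]
        Least_le[of "\<lambda>n. a \<le> n \<and> (b \<le> n \<or> al n \<le> (2 * (k + int J) - 1) * pi)" b] True
      unfolding m_def by blast+
    have lt: "(2 * (k + int J) - 1) * pi < al n" if "a \<le> n" "n < m" for n
      using not_less_Least[of n "\<lambda>n. a \<le> n \<and> (b \<le> n \<or> al n \<le> (2 * (k + int J) - 1) * pi)"] that m
      unfolding m_def by auto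
    have anti: "al n \<le> al m" if "m \<le> n" "n < b" for n
      using that
    proof (induction n rule: dec_induct)
      case (step n)
      then show ?case using Suc.prems(2)[of n] m l by auto
    qed simp
    have 1: "norm (\<Sum>n=a..<m. (z n + z (Suc n)) / 2) \<le> c"
      unfolding c_def
    proof (rule sum_cis_section_unweighted_le[OF l z, where al = al and k = "k + int J"])
      fix n assume n: "a \<le> n" "n < m"
      show "(2 * (k + int J) - 1) * pi \<le> al n \<and> al n \<le> (2 * (k + int J) + 1) * pi"
        using lt[OF n] Suc.prems(3)[of n] n m by (simp add: algebra_simps)
    qed (use Suc.prems m in auto)
    have 2: "norm (\<Sum>n=m..<b. (z n + z (Suc n)) / 2) \<le> real J * c"
      unfolding c_def
    proof (rule Suc.IH)
      fix n assume n: "m \<le> n" "n < b"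
      show "(2 * k - 1) * pi < al n \<and> al n \<le> (2 * (k + int J) - 1) * pi"
        using anti[OF n] m(2) Suc.prems(3)[of n] n m(1) by auto
    qed (use Suc.prems m in auto)
    have "(\<Sum>n=a..<b. (z n + z (Suc n)) / 2) = (\<Sum>n=a..<m. (z n + z (Suc n)) / 2) + (\<Sum>n=m..<b. (z n + z (Suc n)) / 2)"
      using m by (simp add: sum.atLeastLessThan_concat)
    then show ?thesis
      using 1 2 norm_triangle_ineq[of "\<Sum>n=a..<m. (z n + z (Suc n)) / 2" "\<Sum>n=m..<b. (z n + z (Suc n)) / 2"]
      unfolding c_def[symmetric] by (simp add: algebra_simps)
  qed (use c in \<open>simp add: c_def\<close>)
qed

text \<open>Increments that fall by at most \<open>A\<close> in total meet at most
  \<open>A / (2 * pi) + 2\<close> sections. The leading 1 is the cost of passing from averages to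
  plain terms, a telescoping sum.\<close>

lemma second_derivative_test:
  fixes z :: "nat \<Rightarrow> complex" and al :: "nat \<Rightarrow> real" and l A :: real
  assumes l: "0 < l" "l \<le> 3" and z: "\<And>n. norm (z n) = 1"
    and al: "\<And>n. a \<le> n \<Longrightarrow> n < b \<Longrightarrow> z (Suc n) = z n * cis (al n)"
    and gap: "\<And>n. a \<le> n \<Longrightarrow> Suc n < b \<Longrightarrow> l \<le> al n - al (Suc n)"
    and A: "0 \<le> A" "\<And>n. n = b - 1 \<Longrightarrow> a \<le> n \<Longrightarrow> n < b \<Longrightarrow> al a - al n \<le> A"
  shows "norm (\<Sum>n=a..<b. z n) \<le> 1 + (A / (2 * pi) + 2) * (8 / sqrt (3 * l) + 2)"
proof (cases "a < b")
  case True
  define e where "e = b - 1"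
  have e: "a \<le> e" "e < b" using True by (auto simp: e_def)
  define k where "k = \<lceil>al e / (2 * pi) + 1 / 2\<rceil> - 1"
  define J where "J = nat \<lceil>(al a - (2 * k - 1) * pi) / (2 * pi)\<rceil>"
  have k: "(2 * k - 1) * pi < al e" "al e \<le> (2 * k + 1) * pi"
  proof -
    have "of_int k < al e / (2 * pi) + 1 / 2" "al e / (2 * pi) + 1 / 2 \<le> of_int k + 1"
      unfolding k_def by linarith+
    then show "(2 * k - 1) * pi < al e" "al e \<le> (2 * k + 1) * pi" by (simp_all add: field_simps)
  qed
  have anti: "al e \<le> al n" "al n \<le> al a" if "a \<le> n" "n < b" for n
  proof -
    have "al j \<le> al i" if "i \<le> j" "a \<le> i" "j < b" for i j
      using that
    proof (induction j rule: dec_induct)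
      case (step j)
      then show ?case using gap[of j] l by auto
    qed simp
    from this[of n e] this[of a n] show "al e \<le> al n" "al n \<le> al a" using that e by (auto simp: e_def)
  qed
  have q: "0 \<le> (al a - (2 * k - 1) * pi) / (2 * pi)" using k anti[of a] e by simp
  have J: "(al a - (2 * k - 1) * pi) / (2 * pi) \<le> real J" "real J \<le> (al a - (2 * k - 1) * pi) / (2 * pi) + 1"
    using q unfolding J_def by linarith+
  have "al a \<le> (2 * (k + int J) - 1) * pi"
    using J(1) by (simp add: field_simps)
  then have S: "norm (\<Sum>n=a..<b. (z n + z (Suc n)) / 2) \<le> real J * (8 / sqrt (3 * l) + 2)"
    using k anti al gap by (intro sum_cis_sections_le[OF l z, where al = al and k = k]) force+
  have "real J \<le> A / (2 * pi) + 2"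
  proof -
    have "al a - (2 * k - 1) * pi \<le> A + 2 * pi" using A(2)[of e] e k by (simp add: e_def algebra_simps)
    then have "(al a - (2 * k - 1) * pi) / (2 * pi) \<le> (A + 2 * pi) / (2 * pi)" by (intro divide_right_mono) auto
    then show ?thesis using J(2) by (simp add: add_divide_distrib)
  qed
  then have "real J * (8 / sqrt (3 * l) + 2) \<le> (A / (2 * pi) + 2) * (8 / sqrt (3 * l) + 2)"
    using l by (intro mult_right_mono) auto
  moreover have E: "(\<Sum>n=a..<b. z n) = (\<Sum>n=a..<b. (z n + z (Suc n)) / 2) - (\<Sum>n=a..<b. (z (Suc n) - z n)) / 2"
    unfolding sum_divide_distrib sum_subtractf[symmetric]
    by (intro sum.cong refl) (simp add: field_simps)
  moreover have "norm ((\<Sum>n=a..<b. (z (Suc n) - z n)) / 2) \<le> 1"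
    using norm_triangle_ineq4[of "z b" "z a"] True by (simp add: sum_Suc_diff' norm_divide z)
  ultimately show ?thesis
    unfolding E using S norm_triangle_ineq4[of "\<Sum>n=a..<b. (z n + z (Suc n)) / 2" "(\<Sum>n=a..<b. (z (Suc n) - z n)) / 2"]
    by linarith
qed (use l A in \<open>auto intro!: add_nonneg_nonneg mult_nonneg_nonneg divide_nonneg_nonneg\<close>)

section \<open>Correlations of \<open>osc\<close> with its shifts\<close>

lemma lg_shift_eq:
  assumes "n > 0"
  shows "lg n - lg (n + h) = ln (1 + real h / (real n * (real n + real h + 1)))"
proof -
  define P where "P = real n * (real n + real h + 1)"
  have "P > 0" using assms by (simp add: P_def)
  moreover have "(real n + 1) * (real n + real h) = P + real h" by (simp add: P_def algebra_simps)
  ultimately have "1 + real h / (real n * (real n + real h + 1)) = ((real n + 1) * (real n + real h)) / (real n * (real n + real h + 1))"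
    unfolding P_def[symmetric] by (simp add: add_divide_distrib)
  then show ?thesis
    using assms by (simp add: lg_eq ln_div ln_mult add_ac)
qed

lemma lg_shift_bounds:
  assumes "n > 0"
  shows "lg n - lg (n + h) \<le> real h / (real n * (real n + real h + 1))"
    "real h / ((real n + 1) * (real n + real h)) \<le> lg n - lg (n + h)"
proof -
  define q where "q = real h / (real n * (real n + real h + 1))"
  have q: "q \<ge> 0" by (simp add: q_def)
  show "lg n - lg (n + h) \<le> real h / (real n * (real n + real h + 1))"
    unfolding lg_shift_eq[OF assms] q_def[symmetric] using q by (rule ln_add_one_self_le_self)
  have "real h / ((real n + 1) * (real n + real h)) = q / (1 + q)"
  proof -
    define P where "P = real n * (real n + real h + 1)"
    have "P > 0" using assms by (simp add: P_def)
    moreover have "(real n + 1) * (real n + real h) = P + real h" by (simp add: P_def algebra_simps)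
    ultimately show ?thesis unfolding q_def P_def[symmetric] by (simp add: field_simps)
  qed
  also have "\<dots> \<le> ln (1 + q)"
  proof -
    have "- ln (1 + q) = ln (1 / (1 + q))" using q by (simp add: ln_div)
    also have "\<dots> \<le> 1 / (1 + q) - 1" using q by (intro ln_le_minus_one) simp
    also have "\<dots> = - (q / (1 + q))" using q by (simp add: field_simps)
    finally show ?thesis by simp
  qed
  finally show "real h / ((real n + 1) * (real n + real h)) \<le> lg n - lg (n + h)"
    by (simp add: lg_shift_eq[OF assms] q_def)
qed

text \<open>The right-hand side is \<open>D n - D (n + h)\<close> for the second difference
  \<open>D\<close> of the logarithm, and \<open>D\<close> has the derivative
  \<open>- 2 / (x * (x + 1) * (x + 2))\<close>. In effect the third derivative of \<open>ln\<close>
  is bounded from below.\<close>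

lemma lg_shift_diff_ge:
  assumes n: "0 < n" "real (n + h + 2) \<le> Y"
  shows "2 * real h / Y ^ 3 \<le> (lg n - lg (n + h)) - (lg (Suc n) - lg (Suc n + h))"
proof (cases "h = 0")
  case False
  define D where "D = (\<lambda>x::real. 2 * ln (x + 1) - ln x - ln (x + 2))"
  have lgD: "lg m - lg (Suc m) = D (real m)" if "m > 0" for m
    using that by (simp add: lg_eq D_def add_ac)
  have "\<exists>x>real n. x < real (n + h) \<and> D (real (n + h)) - D (real n) = (real (n + h) - real n) * (2 / (x + 1) - 1 / x - 1 / (x + 2))"
    using n False unfolding D_def
    by (intro MVT2) (auto intro!: derivative_eq_intros)
  then obtain x where x: "real n < x" "x < real (n + h)"
    "D (real (n + h)) - D (real n) = real h * (2 / (x + 1) - 1 / x - 1 / (x + 2))" by auto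
  have x0: "x > 0" using x n by linarith
  have "2 / (x + 1) - 1 / x - 1 / (x + 2) = - 2 / (x * (x + 1) * (x + 2))"
    using x0 by (simp add: divide_simps) (simp add: algebra_simps)
  then have "D (real n) - D (real (n + h)) = real h * (2 / (x * (x + 1) * (x + 2)))"
    using x(3) by simp
  also have "\<dots> \<ge> real h * (2 / Y ^ 3)"
  proof -
    have "x \<le> Y" "x + 1 \<le> Y" "x + 2 \<le> Y" using x n by auto
    then have "x * (x + 1) * (x + 2) \<le> Y * Y * Y" using x0 by (intro mult_mono) auto
    moreover have "Y > 0" using \<open>x \<le> Y\<close> x0 by simp
    ultimately show ?thesis using x0 by (intro mult_left_mono divide_left_mono mult_pos_pos) (auto simp: power3_eq_cube)
  qed
  finally have "real h * (2 / Y ^ 3) \<le> D (real n) - D (real (n + h))" .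
  then show ?thesis using lgD[of n] lgD[of "n + h"] n by (simp add: algebra_simps)
qed simp

text \<open>The sum is conjugated because the phase increments
  \<open>t * (lg n - lg (n + h))\<close> of \<open>z\<close> decrease, as the second derivative test
  requires; they fall by at least \<open>2 * t * h / Y ^ 3\<close> per step.\<close>

lemma osc_correlation_le:
  fixes t X Y :: real
  assumes t: "0 < t" and h: "0 < h" and X: "0 < X" "X \<le> real a" "real b \<le> Y" "X \<le> Y"
    and l: "2 * t * real h / Y ^ 3 \<le> 3"
  shows "norm (\<Sum>n=a..<b - h. osc t (n + h) * cnj (osc t n))
    \<le> 1 + (t * real h * (1 / X\<^sup>2 - 1 / Y\<^sup>2) / (2 * pi) + 2) * (8 / sqrt (3 * (2 * t * real h / Y ^ 3)) + 2)"
proof -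
  define z where "z = (\<lambda>n. osc t n * cnj (osc t (n + h)))"
  have a: "0 < a" using X by simp
  have Y: "0 < Y" using X by simp
  have "(\<Sum>n=a..<b - h. osc t (n + h) * cnj (osc t n)) = cnj (\<Sum>n=a..<b - h. z n)"
    by (simp add: z_def mult.commute)
  then have "norm (\<Sum>n=a..<b - h. osc t (n + h) * cnj (osc t n)) = norm (\<Sum>n=a..<b - h. z n)"
    by (simp only: complex_mod_cnj)
  also have "\<dots> \<le> 1 + (t * real h * (1 / X\<^sup>2 - 1 / Y\<^sup>2) / (2 * pi) + 2) * (8 / sqrt (3 * (2 * t * real h / Y ^ 3)) + 2)"
  proof (rule second_derivative_test[where al = "\<lambda>n. t * (lg n - lg (n + h))"])
    show "0 < 2 * t * real h / Y ^ 3" using t h Y by simp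
    show "norm (z n) = 1" for n by (simp add: z_def norm_mult)
    show "z (Suc n) = z n * cis (t * (lg n - lg (n + h)))" if "a \<le> n" "n < b - h" for n
    proof -
      have "osc t (Suc n) = osc t n * cis (t * lg n)" "osc t (Suc n + h) = osc t (n + h) * cis (t * lg (n + h))"
        using osc_Suc[of n t] osc_Suc[of "n + h" t] that a by auto
      moreover have "cis (t * (lg n - lg (n + h))) = cis (t * lg n) * cnj (cis (t * lg (n + h)))"
        by (simp add: cis_cnj cis_mult algebra_simps)
      ultimately show ?thesis by (simp add: z_def)
    qed
    show "2 * t * real h / Y ^ 3 \<le> t * (lg n - lg (n + h)) - t * (lg (Suc n) - lg (Suc n + h))"
      if "a \<le> n" "Suc n < b - h" for n
    proof -
      have "real (n + h + 2) \<le> Y" using that X by linarith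
      then have "t * (2 * real h / Y ^ 3) \<le> t * ((lg n - lg (n + h)) - (lg (Suc n) - lg (Suc n + h)))"
        using that a t by (intro mult_left_mono lg_shift_diff_ge) auto
      then show ?thesis by (simp add: algebra_simps)
    qed
    have "1 / Y\<^sup>2 \<le> 1 / X\<^sup>2" using X Y by (intro divide_left_mono power_mono) auto
    then show "0 \<le> t * real h * (1 / X\<^sup>2 - 1 / Y\<^sup>2)" using t by simp
    show "t * (lg a - lg (a + h)) - t * (lg n - lg (n + h)) \<le> t * real h * (1 / X\<^sup>2 - 1 / Y\<^sup>2)"
      if "n = b - h - 1" "a \<le> n" "n < b - h" for n
    proof -
      have "lg a - lg (a + h) \<le> real h / (real a * (real a + real h + 1))" by (rule lg_shift_bounds(1)[OF a])
      also have "\<dots> \<le> real h / (X * X)" using X a by (intro divide_left_mono mult_mono) auto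
      finally have 1: "lg a - lg (a + h) \<le> real h / X\<^sup>2" by (simp add: power2_eq_square)
      have "real h / (Y * Y) \<le> real h / ((real n + 1) * (real n + real h))"
        using that a h X Y by (intro divide_left_mono mult_mono mult_pos_pos) auto
      also have "\<dots> \<le> lg n - lg (n + h)" using that a by (intro lg_shift_bounds(2)) auto
      finally have 2: "real h / Y\<^sup>2 \<le> lg n - lg (n + h)" by (simp add: power2_eq_square)
      have "t * ((lg a - lg (a + h)) - (lg n - lg (n + h))) \<le> t * (real h / X\<^sup>2 - real h / Y\<^sup>2)"
        using 1 2 t by (intro mult_left_mono) auto
      then show ?thesis by (simp add: algebra_simps)
    qed
  qed (use l in auto)
  finally show ?thesis .
qed


section \<open>Geometric blocks between the cube root and the square root of
  \<open>t\<close>\<close>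

text \<open>The scaling \<open>X = w^2 * \<tau>\<close> gives \<open>t / X ^ 3 = 1 / w ^ 6\<close>,
  so the correlation phases depend on \<open>w\<close> alone. With \<open>H\<close> of order
  \<open>w^2\<close> the bracket in van der Corput's inequality has terms of order
  \<open>X / w^2\<close> and \<open>w^2 = X / \<tau>\<close>, whose square roots give the two
  summands of the bound.\<close>

lemma osc_block_sum_le:
  fixes \<tau> w X :: real
  assumes \<tau>: "782 \<le> \<tau>" and w: "0 < w" "3 \<le> w\<^sup>2" and X: "X = w\<^sup>2 * \<tau>"
    and ab: "X \<le> real a" "real b \<le> 64 / 49 * X + 1"
  shows "norm (\<Sum>n=a..<b. osc (\<tau> ^ 3) n) \<le> X * ((39 / 100) / w + (656 / 100) * (w / \<tau>))"
proof (cases "a \<le> b")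
  case True
  define t where "t = \<tau> ^ 3"
  \<comment> \<open>Slightly more than \<open>64 / 49\<close>; the excess covers the
    \<open>+ 1\<close> in the hypothesis on \<open>b\<close>.\<close>
  define Y where "Y = (1307 / 1000) * X"
  \<comment> \<open>This choice roughly balances the diagonal term against the correlations.\<close>
  define H where "H = nat \<lceil>(5 / 2) * w\<^sup>2\<rceil>"
  define S where "S = norm (\<Sum>n=a..<b. osc t n)"
  define L where "L = real (b - a)"
  have "3 * 782 \<le> w\<^sup>2 * \<tau>" using w \<tau> by (intro mult_mono) auto
  then have X0: "2346 \<le> X" by (simp add: X)
  have t: "0 < t" using \<tau> by (simp add: t_def)
  have bY: "real b \<le> Y" using ab X0 by (simp add: Y_def)
  have H: "(5 / 2) * w\<^sup>2 \<le> real H" "real H \<le> (28334 / 10000) * w\<^sup>2"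
    using w unfolding H_def by linarith+
  have H1: "1 < H" using H w by linarith
  have wX: "w\<^sup>2 = X / \<tau>" using \<tau> by (simp add: X)
  have HX: "real H \<le> (3624 / 1000000) * X"
  proof -
    have "782 * w\<^sup>2 \<le> \<tau> * w\<^sup>2" using \<tau> by (intro mult_right_mono) auto
    then show ?thesis using H X by (simp add: mult.commute)
  qed
  have Ha: "H \<le> a" using HX X0 ab(1) by linarith
  have L: "0 \<le> L" "L \<le> (3066 / 10000) * X" using True ab X0 by (simp_all add: L_def of_nat_diff)
  have corr: "norm (\<Sum>n=a..<b - h. osc t (n + h) * cnj (osc t n))
      \<le> 5 * 1 + (132 / 1000) * X / w ^ 6 * real h + (32215 / 100000) * X / w ^ 3 * sqrt (real h)
        + (9762 / 1000) * w ^ 3 * (1 / sqrt (real h))" if h: "0 < h" "h < H" for h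
  proof -
    define g where "g = sqrt (real h)"
    have g: "g > 0" "g\<^sup>2 = real h" "g \<noteq> 0" using h by (simp_all add: g_def)
    have tX: "t / X ^ 3 = 1 / w ^ 6" using \<tau> w by (simp add: t_def X power_mult_distrib flip: power_mult)
    define l where "l = 2 * t * real h / Y ^ 3"
    have l: "l = 2 * real h / w ^ 6 * (1000 / 1307) ^ 3"
    proof -
      have "l = 2 * real h * (t / X ^ 3) * (1000 / 1307) ^ 3"
        unfolding l_def Y_def by (simp add: power_mult_distrib power_divide mult_ac)
      then show ?thesis unfolding tX by simp
    qed
    have w6: "w ^ 6 \<ge> 9 * w\<^sup>2"
    proof -
      have "w ^ 6 = w\<^sup>2 * w\<^sup>2 * w\<^sup>2" by (simp flip: power_add)
      also have "\<dots> \<ge> 3 * 3 * w\<^sup>2" using w by (intro mult_right_mono mult_mono) auto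
      finally show ?thesis by simp
    qed
    have "real h \<le> (28334 / 10000) * w\<^sup>2" using h H by linarith
    then have "real h / w ^ 6 \<le> (28334 / 10000) * w\<^sup>2 / (9 * w\<^sup>2)" using w w6 by (intro frac_le) auto
    also have "\<dots> \<le> 1" using w by simp
    finally have "real h / w ^ 6 \<le> 1" .
    then have "2 * (1000 / 1307) ^ 3 * (real h / w ^ 6) \<le> 2 * (1000 / 1307) ^ 3 * 1" by (intro mult_left_mono) auto
    then have l3: "l \<le> 3" unfolding l by (simp add: power3_eq_cube)
    have sq: "8 / sqrt (3 * l) \<le> (4881 / 1000) * (w ^ 3 / g)"
    proof -
      have "(8 / (4881 / 1000) * (g / w ^ 3))\<^sup>2 \<le> 3 * l"
      proof -
        have "(8 / (4881 / 1000) * (g / w ^ 3))\<^sup>2 = (64000000 / 23824161) * (real h / w ^ 6)"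
          using g by (simp add: power_mult_distrib power_divide flip: power_mult)
        also have "\<dots> \<le> (6000000000 / 2232681443) * (real h / w ^ 6)"
          using w by (intro mult_right_mono) auto
        also have "\<dots> = 3 * l" unfolding l by (simp add: power3_eq_cube)
        finally show ?thesis .
      qed
      then have "8 / (4881 / 1000) * (g / w ^ 3) \<le> sqrt (3 * l)" by (rule real_le_rsqrt)
      moreover have "0 < sqrt (3 * l)" using h w unfolding l by simp
      ultimately show ?thesis using g w by (simp add: field_simps)
    qed
    have A: "t * real h * (1 / X\<^sup>2 - 1 / Y\<^sup>2) / (2 * pi) \<le> (66 / 1000) * (X / w ^ 6 * real h)"
    proof -
      have "t * real h * (1 / X\<^sup>2 - 1 / Y\<^sup>2) = (t / X ^ 3) * X * real h * (1 - (1000 / 1307)\<^sup>2)"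
        using X0 by (simp add: Y_def power_mult_distrib power2_eq_square power3_eq_cube field_simps)
      also have "\<dots> = (X / w ^ 6 * real h) * (1 - (1000 / 1307)\<^sup>2)" unfolding tX by simp
      finally have "t * real h * (1 / X\<^sup>2 - 1 / Y\<^sup>2) / (2 * pi) = (X / w ^ 6 * real h) * ((1 - (1000 / 1307)\<^sup>2) / (2 * pi))" by simp
      also have "\<dots> \<le> (X / w ^ 6 * real h) * (66 / 1000)"
        using X0 w pi_approx by (intro mult_left_mono) (auto simp: field_simps power2_eq_square)
      finally show ?thesis by simp
    qed
    have "norm (\<Sum>n=a..<b - h. osc t (n + h) * cnj (osc t n))
        \<le> 1 + (t * real h * (1 / X\<^sup>2 - 1 / Y\<^sup>2) / (2 * pi) + 2) * (8 / sqrt (3 * l) + 2)"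
      unfolding l_def using h X0 ab bY t l3 by (intro osc_correlation_le) (auto simp: Y_def l_def)
    also have "\<dots> \<le> 1 + ((66 / 1000) * (X / w ^ 6 * real h) + 2) * ((4881 / 1000) * (w ^ 3 / g) + 2)"
      using A sq X0 w by (intro add_left_mono mult_mono add_mono) (auto simp: l)
    also have "\<dots> = 5 + (132 / 1000) * X / w ^ 6 * real h + (66 / 1000) * (4881 / 1000) * (X / w ^ 3 * g)
        + (9762 / 1000) * w ^ 3 * (1 / g)"
    proof -
      have PQ: "X / w ^ 6 * real h * (w ^ 3 / g) = X / w ^ 3 * g"
        unfolding g(2)[symmetric] using g w by (simp add: field_simps power2_eq_square flip: power_add)
      have gen: "1 + (c * P + 2) * (e * Q + 2) = 5 + 2 * c * P + c * e * (P * Q) + 2 * e * Q" for c e P Q :: real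
        by (simp add: algebra_simps)
      show ?thesis unfolding gen PQ by simp
    qed
    also have "\<dots> \<le> 5 * 1 + (132 / 1000) * X / w ^ 6 * real h + (32215 / 100000) * X / w ^ 3 * g
        + (9762 / 1000) * w ^ 3 * (1 / g)"
    proof -
      have "(66 / 1000) * (4881 / 1000) * (X / w ^ 3 * g) \<le> (32215 / 100000) * (X / w ^ 3 * g)"
        using X0 w g by (intro mult_right_mono) auto
      then show ?thesis by simp
    qed
    finally show ?thesis by (simp only: g_def)
  qed
  define G where "G = sqrt (real H)"
  have G: "G > 0" "G\<^sup>2 = real H" using H1 by (simp_all add: G_def)
  have G1: "G \<le> (16833 / 10000) * w"
    unfolding G_def using H w by (intro real_le_lsqrt) (auto simp: power_mult_distrib power_divide)
  have G2: "(15811 / 10000) * w \<le> G"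
    unfolding G_def using H w by (intro real_le_rsqrt) (auto simp: power_mult_distrib power_divide)
  have "(\<Sum>h=1..<H. real (H - h) * norm (\<Sum>n=a..<b - h. osc t (n + h) * cnj (osc t n)))
      \<le> (\<Sum>h=1..<H. real (H - h) * (5 * 1 + (132 / 1000) * X / w ^ 6 * real h
        + (32215 / 100000) * X / w ^ 3 * sqrt (real h) + (9762 / 1000) * w ^ 3 * (1 / sqrt (real h))))"
    by (intro sum_mono mult_left_mono corr) auto
  also have "\<dots> = 5 * (\<Sum>h=1..<H. real (H - h) * 1) + (132 / 1000) * X / w ^ 6 * (\<Sum>h=1..<H. real (H - h) * real h)
      + (32215 / 100000) * X / w ^ 3 * (\<Sum>h=1..<H. real (H - h) * sqrt (real h))
      + (9762 / 1000) * w ^ 3 * (\<Sum>h=1..<H. real (H - h) * (1 / sqrt (real h)))"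
    unfolding sum_distrib_left sum.distrib[symmetric] by (intro sum.cong refl) (simp only: distrib_left mult_ac)
  also have "\<dots> \<le> 5 * ((real H)\<^sup>2 / 2) + (132 / 1000) * X / w ^ 6 * ((real H) ^ 3 / 6)
      + (32215 / 100000) * X / w ^ 3 * ((2887 / 10000) * ((real H)\<^sup>2 * sqrt (real H)))
      + (9762 / 1000) * w ^ 3 * (4 / 3 * (real H * sqrt (real H)))"
    using X0 w by (intro add_mono mult_left_mono sum_weight_const_le sum_weight_id_le sum_weight_sqrt_le sum_weight_inverse_sqrt_le) auto
  finally have C: "(\<Sum>h=1..<H. real (H - h) * norm (\<Sum>n=a..<b - h. osc t (n + h) * cnj (osc t n)))
     \<le> 5 * ((real H)\<^sup>2 / 2) + (132 / 1000) * X / w ^ 6 * ((real H) ^ 3 / 6)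
      + (32215 / 100000) * X / w ^ 3 * ((2887 / 10000) * ((real H)\<^sup>2 * G))
      + (9762 / 1000) * w ^ 3 * (4 / 3 * (real H * G))" (is "_ \<le> ?C") unfolding G_def .
  have e: "real (b - a + H) = L + real H" "(\<Sum>n=a..<b. (norm (osc t n))\<^sup>2) = L" by (simp_all add: L_def)
  have "(real H * S)\<^sup>2 \<le> (L + real H) * (real H * L
        + 2 * (\<Sum>h=1..<H. real (H - h) * norm (\<Sum>n=a..<b - h. osc t (n + h) * cnj (osc t n))))"
    using van_der_Corput_inequality[of a b H "osc t"] True H1 Ha unfolding e S_def by linarith
  also have "\<dots> \<le> (L + real H) * (real H * L + 2 * ?C)"
    using C L by (intro mult_left_mono add_mono) (auto simp: L_def)
  also have "real H * L + 2 * ?C = (real H)\<^sup>2 * (L / real H + 5 + (44 / 1000) * (X / w ^ 6 * real H)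
      + 2 * (32215 / 100000) * (2887 / 10000) * (X / w ^ 3 * G) + (26032 / 1000) * (w ^ 3 / G))"
  proof -
    have "real H * G = (real H)\<^sup>2 / G" using G by (simp add: field_simps power2_eq_square)
    moreover have "real H * L = (real H)\<^sup>2 * (L / real H)" using H1 by (simp add: power2_eq_square)
    ultimately show ?thesis by (simp add: algebra_simps power2_eq_square power3_eq_cube)
  qed
  finally have "(real H)\<^sup>2 * S\<^sup>2 \<le> (real H)\<^sup>2 * ((L + real H) * (L / real H + 5 + (44 / 1000) * (X / w ^ 6 * real H)
      + 2 * (32215 / 100000) * (2887 / 10000) * (X / w ^ 3 * G) + (26032 / 1000) * (w ^ 3 / G)))"
    by (simp add: power_mult_distrib mult_ac)
  then have "S\<^sup>2 \<le> (L + real H) * (L / real H + 5 + (44 / 1000) * (X / w ^ 6 * real H)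
      + 2 * (32215 / 100000) * (2887 / 10000) * (X / w ^ 3 * G) + (26032 / 1000) * (w ^ 3 / G))"
    using H1 by (simp add: mult_le_cancel_left)
  also have "\<dots> \<le> ((3103 / 10000) * X) * ((4838 / 10000) * (X / w\<^sup>2) + (16465 / 1000) * (X / \<tau>))"
  proof (rule mult_mono)
    show "L + real H \<le> (3103 / 10000) * X" using L HX X0 by simp
    have "L / real H \<le> ((3066 / 10000) * X) / ((5 / 2) * w\<^sup>2)" using L H w X0 by (intro frac_le) auto
    then have 1: "L / real H \<le> (12264 / 100000) * (X / w\<^sup>2)" by simp
    have q: "0 \<le> X / w\<^sup>2" using X0 by simp
    \<comment> \<open>\<open>X / w^2\<close> is \<open>\<tau>\<close>, so this is where
      \<open>782\<close> is almost sharp.\<close>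
    have 2: "5 \<le> (64 / 10000) * (X / w\<^sup>2)" using w \<tau> by (simp add: X)
    have "X / w ^ 6 * real H \<le> X / w ^ 6 * ((28334 / 10000) * w\<^sup>2)" using H X0 by (intro mult_left_mono) auto
    also have "\<dots> = (28334 / 10000) * (X / w\<^sup>2) / w\<^sup>2"
      using w by (simp add: field_simps flip: power_add)
    also have "\<dots> \<le> (28334 / 10000) * (X / w\<^sup>2) / 3" using w X0 by (intro divide_left_mono) auto
    finally have "X / w ^ 6 * real H \<le> (28334 / 10000) * (X / w\<^sup>2) / 3" .
    then have 3: "(44 / 1000) * (X / w ^ 6 * real H) \<le> (4156 / 100000) * (X / w\<^sup>2)"
    proof -
      have "(44 / 1000) * a \<le> (4156 / 100000) * b" if "a \<le> (28334 / 10000) * b / 3" "0 \<le> b" for a b :: real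
        using that by simp
      with q show ?thesis using \<open>X / w ^ 6 * real H \<le> (28334 / 10000) * (X / w\<^sup>2) / 3\<close> by blast
    qed
    have "X / w ^ 3 * G \<le> X / w ^ 3 * ((16833 / 10000) * w)" using G1 X0 w by (intro mult_left_mono) auto
    also have "\<dots> = (16833 / 10000) * (X / w\<^sup>2)" using w by (simp add: power2_eq_square power3_eq_cube)
    finally have "2 * (32215 / 100000) * (2887 / 10000) * (X / w ^ 3 * G) \<le> 2 * (32215 / 100000) * (2887 / 10000) * ((16833 / 10000) * (X / w\<^sup>2))"
      by (intro mult_left_mono) auto
    also have "\<dots> = (2 * (32215 / 100000) * (2887 / 10000) * (16833 / 10000)) * (X / w\<^sup>2)" by simp
    also have "\<dots> \<le> (3132 / 10000) * (X / w\<^sup>2)" using q by (intro mult_right_mono) auto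
    finally have 4: "2 * (32215 / 100000) * (2887 / 10000) * (X / w ^ 3 * G) \<le> (3132 / 10000) * (X / w\<^sup>2)" .
    have "w ^ 3 / G \<le> w ^ 3 / ((15811 / 10000) * w)" using G2 G w by (intro divide_left_mono) auto
    also have "\<dots> = (10000 / 15811) * w\<^sup>2" using w by (simp add: power2_eq_square power3_eq_cube)
    finally have 5: "(26032 / 1000) * (w ^ 3 / G) \<le> (16465 / 1000) * (X / \<tau>)" unfolding wX[symmetric] using zero_le_power2[of w] by linarith
    show "L / real H + 5 + (44 / 1000) * (X / w ^ 6 * real H)
      + 2 * (32215 / 100000) * (2887 / 10000) * (X / w ^ 3 * G) + (26032 / 1000) * (w ^ 3 / G)
      \<le> (4838 / 10000) * (X / w\<^sup>2) + (16465 / 1000) * (X / \<tau>)"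
      using 1 2 3 4 5 by linarith
  qed (use L G w X0 H in auto)
  \<comment> \<open>Completing the square: \<open>0.39^2\<close> dominates the coefficient of
    \<open>1 / w^2\<close> and \<open>2 * 0.39 * 6.56\<close> that of \<open>1 / \<tau>\<close>; the
    square of the last summand is given away.\<close>
  also have "\<dots> \<le> (X * ((39 / 100) / w + (656 / 100) * (w / \<tau>)))\<^sup>2"
  proof -
    have A: "(X * ((39 / 100) / w + (656 / 100) * (w / \<tau>)))\<^sup>2
        = X\<^sup>2 * ((1521 / 10000) * (1 / w\<^sup>2) + (51168 / 10000) * (1 / \<tau>) + ((656 / 100) * (w / \<tau>))\<^sup>2)"
      using w \<tau> by (simp add: field_simps power2_eq_square)
    have B: "((3103 / 10000) * X) * ((4838 / 10000) * (X / w\<^sup>2) + (16465 / 1000) * (X / \<tau>))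
        \<le> X\<^sup>2 * ((1521 / 10000) * (1 / w\<^sup>2) + (51168 / 10000) * (1 / \<tau>))"
    proof -
      have "((3103 / 10000) * X) * ((4838 / 10000) * (X / w\<^sup>2) + (16465 / 1000) * (X / \<tau>))
        = X\<^sup>2 * ((3103 / 10000) * (4838 / 10000) * (1 / w\<^sup>2) + (3103 / 10000) * (16465 / 1000) * (1 / \<tau>))"
        by (simp add: field_simps power2_eq_square)
      also have "\<dots> \<le> X\<^sup>2 * ((1521 / 10000) * (1 / w\<^sup>2) + (51168 / 10000) * (1 / \<tau>))"
        using w \<tau> by (intro mult_left_mono add_mono mult_right_mono) auto
      finally show ?thesis .
    qed
    show ?thesis unfolding A by (rule order_trans[OF B]) (intro mult_left_mono, simp_all)
  qed
  finally show ?thesis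
    unfolding S_def t_def using w \<tau> X0 by (rule_tac power2_le_imp_le) auto
next
  case False
  have "0 \<le> X" using w \<tau> by (simp add: X)
  then show ?thesis using False w \<tau> by simp
qed


text \<open>The ratio of consecutive blocks is a rational square, so that \<open>w\<close> is a geometric progression
  with rational ratio.\<close>

lemma osc_blocks_sum_le:
  fixes \<tau> :: real and J b :: nat
  defines "w \<equiv> \<lambda>j. sqrt 3 * (8 / 7) ^ j"
  assumes \<tau>: "782 \<le> \<tau>" and b: "real b < (w J)\<^sup>2 * \<tau> + 1"
  shows "norm (\<Sum>n=nat \<lceil>3 * \<tau>\<rceil>..<b. of_real (lg n) * osc (\<tau> ^ 3) n)
    \<le> (\<Sum>j<J. (39 / 100) / w j + (656 / 100) * (w j / \<tau>))"
  using b
proof (induction J arbitrary: b)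
  case 0
  have "real b < 3 * \<tau> + 1" using "0.prems" by (simp add: w_def)
  then have "b \<le> nat \<lceil>3 * \<tau>\<rceil>" by linarith
  then show ?case by simp
next
  case (Suc J)
  define X where "X = (w J)\<^sup>2 * \<tau>"
  define a where "a = nat \<lceil>X\<rceil>"
  define v where "v = (39 / 100) / w J + (656 / 100) * (w J / \<tau>)"
  let ?f = "\<lambda>n. of_real (lg n) * osc (\<tau> ^ 3) n"
  have w: "0 < w J" "3 \<le> (w J)\<^sup>2"
    by (auto simp: w_def power_mult_distrib intro!: one_le_power)
  have X: "3 * \<tau> \<le> X" "0 < X"
    using w \<tau> mult_right_mono[of 3 "(w J)\<^sup>2" \<tau>] by (auto simp: X_def)
  have a: "X \<le> real a" "real a < X + 1" "0 < a" using X unfolding a_def by linarith+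
  have a0: "nat \<lceil>3 * \<tau>\<rceil> \<le> a" using X unfolding a_def by (intro nat_mono ceiling_mono)
  have v: "0 \<le> v" using w \<tau> by (simp add: v_def)
  show ?case
  proof (cases "b \<le> a")
    case True
    then have "real b < (w J)\<^sup>2 * \<tau> + 1" using a by (simp add: X_def)
    from Suc.IH[OF this] v show ?thesis by (simp add: v_def)
  next
    case False
    have bX: "real b \<le> 64 / 49 * X + 1"
    proof -
      have "(w (Suc J))\<^sup>2 * \<tau> = 64 / 49 * X" by (simp add: w_def X_def power2_eq_square)
      then show ?thesis using Suc.prems by simp
    qed
    \<comment> \<open>The weight is at most \<open>1 / X\<close> on the block, which cancels the
      factor \<open>X\<close> of the block estimate.\<close>
    have "norm (\<Sum>n=a..<b. ?f n) \<le> lg a * (X * v)"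
    proof (rule norm_sum_antimono_mult_le)
      show "norm (\<Sum>n=a..<m. osc (\<tau> ^ 3) n) \<le> X * v" if "m \<le> b" for m
        unfolding v_def using that bX a by (intro osc_block_sum_le[OF \<tau> w X_def]) auto
    qed (use a False in \<open>auto simp: lg_nonneg intro!: lg_antimono\<close>)
    also have "\<dots> \<le> (1 / X) * (X * v)"
    proof (rule mult_right_mono)
      have "lg a \<le> 1 / real a" by (rule lg_bounds(1)[OF a(3)])
      also have "\<dots> \<le> 1 / X" using a X by (intro divide_left_mono) auto
      finally show "lg a \<le> 1 / X" .
    qed (use X v in simp)
    finally have 1: "norm (\<Sum>n=a..<b. ?f n) \<le> v" using X by simp
    have 2: "norm (\<Sum>n=nat \<lceil>3 * \<tau>\<rceil>..<a. ?f n) \<le> (\<Sum>j<J. (39 / 100) / w j + (656 / 100) * (w j / \<tau>))"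
      using a by (intro Suc.IH) (simp add: X_def)
    have "(\<Sum>n=nat \<lceil>3 * \<tau>\<rceil>..<b. ?f n) = (\<Sum>n=nat \<lceil>3 * \<tau>\<rceil>..<a. ?f n) + (\<Sum>n=a..<b. ?f n)"
      using a0 False by (simp add: sum.atLeastLessThan_concat)
    then show ?thesis
      using 1 2 norm_triangle_ineq[of "\<Sum>n=nat \<lceil>3 * \<tau>\<rceil>..<a. ?f n" "\<Sum>n=a..<b. ?f n"] by (simp add: v_def)
  qed
qed

text \<open>Two geometric series. That of \<open>1 / w j\<close> converges and gives the constant
  \<open>1.802\<close>. That of \<open>w j\<close> is at most 8 times its last term, and the last
  block starts below \<open>m\<close>, so this term is at most \<open>sqrt (m / \<tau>)\<close>;
  \<open>52.48\<close> is \<open>8 * 6.56\<close>.\<close>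

lemma osc_middle_sum_le:
  fixes \<tau> :: real and m :: nat
  assumes \<tau>: "782 \<le> \<tau>"
  shows "norm (\<Sum>n=nat \<lceil>3 * \<tau>\<rceil>..<m. of_real (lg n) * osc (\<tau> ^ 3) n)
    \<le> (1802 / 1000) + (5248 / 100) * (sqrt (real m / \<tau>) / \<tau>)"
proof -
  define w where "w = (\<lambda>j. sqrt 3 * (8 / 7 :: real) ^ j)"
  define Q where "Q = (\<lambda>J. real m < (w J)\<^sup>2 * \<tau> + 1)"
  define J where "J = (LEAST J. Q J)"
  have "\<exists>J. Q J"
  proof -
    obtain J where J: "real m < (8 / 7) ^ J" using real_arch_pow[of "8 / 7 :: real" "real m"] by auto
    have "1 \<le> (8 / 7 :: real) ^ J" by (rule one_le_power) simp
    then have "(8 / 7) ^ J * 1 \<le> (8 / 7 :: real) ^ J * (8 / 7) ^ J" by (intro mult_left_mono) auto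
    also have "\<dots> \<le> (w J)\<^sup>2" by (simp add: w_def power_mult_distrib power2_eq_square)
    finally have "real m < (w J)\<^sup>2" using J by simp
    also have "(w J)\<^sup>2 * 1 \<le> (w J)\<^sup>2 * \<tau>" using \<tau> by (intro mult_left_mono) auto
    finally show ?thesis unfolding Q_def by (intro exI[of _ J]) simp
  qed
  then have J: "Q J" unfolding J_def by (rule LeastI_ex)
  have w0: "0 < w j" for j by (simp add: w_def)
  have r: "0 \<le> sqrt (real m / \<tau>)" using \<tau> by simp
  have S1: "(\<Sum>j<J. (39 / 100) / w j) \<le> 1802 / 1000"
  proof -
    have "(\<Sum>j<J. (39 / 100) / w j) = (39 / 100) / sqrt 3 * (\<Sum>j<J. (7 / 8) ^ j)"
      unfolding sum_distrib_left by (intro sum.cong refl) (simp add: w_def power_divide)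
    also have "(\<Sum>j<J. (7 / 8 :: real) ^ j) = 8 * (1 - (7 / 8) ^ J)"
      by (simp add: sum_gp_strict)
    also have "\<dots> \<le> 8" by simp
    finally have "(\<Sum>j<J. (39 / 100) / w j) \<le> (39 / 100) / sqrt 3 * 8" by (simp add: divide_right_mono)
    also have "\<dots> \<le> (39 / 100) / (1732 / 1000) * 8"
      using sqrt3_bounds by (intro mult_right_mono divide_left_mono) auto
    finally show ?thesis by simp
  qed
  have S2: "(\<Sum>j<J. w j) \<le> 8 * sqrt (real m / \<tau>)"
  proof (cases J)
    case (Suc J')
    then have "\<not> Q J'" using not_less_Least[of J' Q] by (simp add: J_def)
    then have "(w J')\<^sup>2 * \<tau> \<le> real m" by (simp add: Q_def)
    then have "(w J')\<^sup>2 \<le> real m / \<tau>" using \<tau> by (simp add: field_simps)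
    then have "w J' \<le> sqrt (real m / \<tau>)" by (rule real_le_rsqrt)
    have "(\<Sum>j<J. w j) = sqrt 3 * (7 * ((8 / 7) ^ J - 1))"
      by (simp add: w_def sum_gp_strict flip: sum_distrib_left)
    also have "\<dots> \<le> sqrt 3 * (7 * (8 / 7) ^ J)" by simp
    also have "\<dots> = 8 * w J'" by (simp add: Suc w_def)
    finally show ?thesis using \<open>w J' \<le> _\<close> by simp
  qed (use r in simp)
  have "norm (\<Sum>n=nat \<lceil>3 * \<tau>\<rceil>..<m. of_real (lg n) * osc (\<tau> ^ 3) n)
    \<le> (\<Sum>j<J. (39 / 100) / w j + (656 / 100) * (w j / \<tau>))"
    unfolding w_def using J by (intro osc_blocks_sum_le \<tau>) (simp add: Q_def w_def)
  also have "\<dots> = (\<Sum>j<J. (39 / 100) / w j) + (656 / 100) / \<tau> * (\<Sum>j<J. w j)"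
    by (simp add: sum.distrib sum_distrib_left)
  also have "\<dots> \<le> 1802 / 1000 + (656 / 100) / \<tau> * (8 * sqrt (real m / \<tau>))"
    using S1 S2 \<tau> by (intro add_mono mult_left_mono) auto
  also have "\<dots> = (1802 / 1000) + (5248 / 100) * (sqrt (real m / \<tau>) / \<tau>)" by simp
  finally show ?thesis .
qed

section \<open>The bound with leading coefficient one third\<close>

text \<open>The constant is the sum of about 0.591 for Euler's constant, 1.1 for
  \<open>ln 3\<close>, \<open>1.802 + 0.584\<close> for the blocks and \<open>0.278 + 0.024\<close>
  for the stationary points, with some room left.\<close>

lemma norm_zeta_le_third_derivative:
  fixes t \<tau> :: real
  assumes \<tau>: "782 \<le> \<tau>" "t = \<tau> ^ 3"
  shows "norm (zeta (1 + \<i> * of_real t)) \<le> ln t / 3 + 44 / 10"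
proof -
  define s where "s = sqrt t"
  define d where "d = sqrt (3 / t)"
  \<comment> \<open>The head of length about \<open>2.66 * sqrt t\<close> costs only
    \<open>sqrt (m / \<tau>) / \<tau>\<close> beyond the constant of the blocks, so fewer stationary
    points are kept here than in the bound with \<open>ln t / 2\<close>.\<close>
  define K where "K = nat \<lfloor>6 / 100 * s\<rfloor>"
  define \<beta> where "\<beta> = (2 * real K + 1) * pi / t"
  have "782 ^ 3 \<le> \<tau> ^ 3" using \<tau> by (intro power_mono) auto
  then have t: "478211768 \<le> t" by (simp add: \<tau>)
  have s: "21868 \<le> s" "s * s = t" using t unfolding s_def by (auto intro!: real_le_rsqrt)
  have s0: "0 < s" using s by simp
  have d: "d = sqrt 3 / s" "0 < d" "d \<le> 1 / 10000"
    using s t sqrt3_bounds by (auto simp: d_def s_def real_sqrt_divide field_simps)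
  have K: "real K \<le> 6 / 100 * s" "6 / 100 * s < real K + 1" using s unfolding K_def by linarith+
  have Kd: "real K * d \<le> 6 / 100 * sqrt 3"
  proof -
    have "real K * d \<le> (6 / 100 * s) * d" using K d by (intro mult_right_mono) auto
    then show ?thesis using s0 by (simp add: d)
  qed
  have K': "K = 0 \<or> 12 < t \<and> real K * d < 1 / 2" using Kd sqrt3_bounds t by simp
  define c1 where "c1 = real K * (4 / (t * d) + (2 * d / 3) * (1 + 1 / (1 - d)))"
  define c2 where "c2 = pi * real (K * (K + 1)) * (2 + 7 * d / 3) / t"
  obtain m N0 where m: "m > 0" "lg m \<le> \<beta>" "real m \<le> 1 / \<beta> + \<beta> / 4 + 1 / 2"
    and mN: "\<And>N. N0 \<le> N \<Longrightarrow> m \<le> N"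
    and tail: "\<And>N. N0 \<le> N \<Longrightarrow> norm ((\<Sum>n=m..N. of_real (lg n) * osc t n) - osc t (Suc N) / (\<i> * of_real t))
      \<le> lg m + 1 / t + c1 + c2"
  proof -
    have "0 < t" using t by simp
    then show ?thesis
      by (rule osc_sum_tail[OF _ K'[unfolded d_def], folded d_def \<beta>_def, folded c1_def c2_def]) (rule that)
  qed
  define a where "a = nat \<lceil>3 * \<tau>\<rceil>"
  have a: "0 < a" "real a \<le> 3 * \<tau> + 1" using \<tau> unfolding a_def by linarith+
  define M where "M = (1802 / 1000) + (5248 / 100) * (sqrt (real m / \<tau>) / \<tau>)"
  have M0: "0 \<le> M" using \<tau> by (simp add: M_def)
  have head: "norm (\<Sum>n=1..<m. of_real (lg n) * osc t n) \<le> ln (real a) + M"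
  proof (cases "m \<le> a")
    case True
    have "norm (\<Sum>n=1..<m. of_real (lg n) * osc t n) \<le> ln (real m)" by (rule norm_sum_lg_osc_le[OF m(1)])
    also have "\<dots> \<le> ln (real a)" using True m by (intro ln_mono) auto
    finally show ?thesis using M0 by simp
  next
    case False
    have 1: "norm (\<Sum>n=1..<a. of_real (lg n) * osc t n) \<le> ln (real a)" by (rule norm_sum_lg_osc_le[OF a(1)])
    have 2: "norm (\<Sum>n=a..<m. of_real (lg n) * osc t n) \<le> M"
      unfolding a_def M_def \<tau>(2) by (rule osc_middle_sum_le[OF \<tau>(1)])
    have "(\<Sum>n=1..<m. of_real (lg n) * osc t n) = (\<Sum>n=1..<a. of_real (lg n) * osc t n) + (\<Sum>n=a..<m. of_real (lg n) * osc t n)"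
      using False a by (simp add: sum.atLeastLessThan_concat)
    then show ?thesis
      using 1 2 norm_triangle_ineq[of "\<Sum>n=1..<a. of_real (lg n) * osc t n" "\<Sum>n=a..<m. of_real (lg n) * osc t n"] by simp
  qed
  have Z: "norm (zeta (1 + \<i> * of_real t)) \<le> euler_mascheroni + ((ln (real a) + M) + (lg m + 1 / t + c1 + c2))"
    using t by (intro norm_zeta_le_split[OF _ m(1) mN head tail]) simp
  have A: "ln (real a) \<le> ln t / 3 + 11 / 10"
  proof -
    \<comment> \<open>Since \<open>\<tau> >= 782\<close>, the rounded start
      \<open>3 * \<tau> + 1\<close> of the blocks is below \<open>3.0013 * \<tau>\<close>.\<close>
    have ln3: "ln (30013 / 10000 :: real) \<le> 11 / 10"
    proof -
      have "(30013 / 10000 :: real) ^ 10 \<le> (2718 / 1000) ^ 11" by (simp add: power_divide)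
      also have "\<dots> \<le> exp 1 ^ 11" using e_approx_32 by (intro power_mono) (auto simp: abs_if split: if_split_asm)
      finally have "ln ((30013 / 10000 :: real) ^ 10) \<le> ln (exp 1 ^ 11)" by (intro ln_mono) auto
      then show ?thesis by (simp add: ln_realpow)
    qed
    have "ln (real a) \<le> ln ((30013 / 10000) * \<tau>)" using a \<tau> by (intro ln_mono) auto
    also have "\<dots> = ln (30013 / 10000) + ln \<tau>" using \<tau> by (subst ln_mult) auto
    also have "ln \<tau> = ln t / 3" using \<tau> by (simp add: ln_realpow)
    finally show ?thesis using ln3 by simp
  qed
  have b: "1199 / 10000 * s * pi / t \<le> \<beta>"
    unfolding \<beta>_def using K s t by (intro divide_right_mono mult_right_mono) auto
  have b2: "\<beta> \<le> 1 / 10000"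
  proof -
    have "(2 * real K + 1) * pi \<le> (13 / 100 * s) * 4" using K s pi_less_4 by (intro mult_mono) auto
    then have "\<beta> \<le> (13 / 100 * s) * 4 / t" unfolding \<beta>_def using t by (intro divide_right_mono) auto
    also have "\<dots> = 52 / 100 / s" using s0 by (simp add: s(2)[symmetric])
    also have "\<dots> \<le> 52 / 100 / 21868" using s by (intro divide_left_mono) auto
    finally show ?thesis by simp
  qed
  have "1 / \<beta> \<le> 1 / (1199 / 10000 * s * pi / t)" using b s0 t by (intro frac_le) auto
  also have "\<dots> = s / (1199 / 10000 * pi)" using s0 by (simp add: s(2)[symmetric])
  also have "\<dots> \<le> s / (1199 / 10000 * (3141 / 1000))" using pi_approx s0 by (intro divide_left_mono) auto
  finally have "1 / \<beta> \<le> 26554 / 10000 * s" using s0 by simp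
  then have ms: "real m \<le> 2656 / 1000 * s" using m(3) b2 s by simp
  have mid: "sqrt (real m / \<tau>) / \<tau> \<le> 1112 / 100000"
  proof -
    have "real m / \<tau> / (\<tau> * \<tau>) = real m / t" by (simp add: \<tau>(2) power3_eq_cube)
    also have "\<dots> \<le> (2656 / 1000 * s) / t" using ms t by (intro divide_right_mono) auto
    also have "\<dots> = 2656 / 1000 / s" using s0 by (simp add: s(2)[symmetric])
    also have "\<dots> \<le> 2656 / 1000 / 21868" using s by (intro divide_left_mono) auto
    also have "\<dots> \<le> (1112 / 100000)\<^sup>2" by (simp add: power2_eq_square)
    finally have "sqrt (real m / \<tau> / (\<tau> * \<tau>)) \<le> 1112 / 100000" by (intro real_le_lsqrt) (use \<tau> in auto)
    then show ?thesis using \<tau> by (simp add: real_sqrt_divide real_sqrt_mult)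
  qed
  have c1: "c1 \<le> 278 / 1000"
  proof -
    have "1 / (1 - d) \<le> 1 / (1 - 1 / 10000)" using d by (intro divide_left_mono) auto
    then have "1 + 1 / (1 - d) \<le> 20002 / 10000" by simp
    then have "(2 * d / 3) * (1 + 1 / (1 - d)) \<le> (2 * d / 3) * (20002 / 10000)" using d by (intro mult_left_mono) auto
    moreover have "4 / (t * d) = 4 / 3 * d"
    proof -
      have "t * d * d = 3" using s0 by (simp add: d s(2)[symmetric])
      then show ?thesis using t d(2) by (simp add: field_simps)
    qed
    moreover have "v + u \<le> 26669 / 10000 * d" if "u \<le> (2 * d / 3) * (20002 / 10000)" "v = 4 / 3 * d" for u v
      using that d(2) by simp
    ultimately have "4 / (t * d) + (2 * d / 3) * (1 + 1 / (1 - d)) \<le> 26669 / 10000 * d" by blast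
    then have "c1 \<le> real K * (26669 / 10000 * d)" unfolding c1_def by (intro mult_left_mono) auto
    also have "\<dots> = 26669 / 10000 * (real K * d)" by simp
    also have "\<dots> \<le> 26669 / 10000 * (6 / 100 * (17321 / 10000))" using Kd sqrt3_bounds by (intro mult_left_mono) auto
    finally show ?thesis by simp
  qed
  have c2: "c2 \<le> 24 / 1000"
  proof -
    have "real K + 1 \<le> 601 / 10000 * s" using K s by simp
    then have "real K * (real K + 1) \<le> (6 / 100 * s) * (601 / 10000 * s)" using K by (intro mult_mono) auto
    then have "real (K * (K + 1)) / t \<le> (6 / 100 * s) * (601 / 10000 * s) / t" using t by (intro divide_right_mono) (auto simp: algebra_simps)
    also have "\<dots> = 3606 / 1000000" using s0 by (simp add: s(2)[symmetric])
    finally have k: "real (K * (K + 1)) / t \<le> 3606 / 1000000" .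
    have "c2 = (real (K * (K + 1)) / t) * (pi * (2 + 7 * d / 3))" by (simp add: c2_def)
    also have "\<dots> \<le> 3606 / 1000000 * ((3142 / 1000) * (2 + 7 * (1 / 10000) / 3))"
      using k pi_approx d by (intro mult_mono) auto
    finally show ?thesis by simp
  qed
  have "1 / t \<le> 1 / 100000" using t by (simp add: field_simps)
  then show ?thesis
    using Z A mid c1 c2 m(2) b2 euler_mascheroni_less_13_over_22 unfolding M_def by linarith
qed

theorem theorem1p1:
  shows "(\<forall>t::real. t \<ge> 3 \<longrightarrow>
            norm (zeta (1 + \<i> * of_real t)) \<le> 1 / 2 * ln t + 1.57) \<and>
         (\<forall>t::real. t \<ge> 10 ^ 8 \<longrightarrow>
            norm (zeta (1 + \<i> * of_real t)) \<le> 1 / 3 * ln t + 2 * ln (ln t) - 1.16)"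
proof (intro conjI allI impI)
  fix t :: real assume "t \<ge> 3"
  then consider "3 \<le> t" "t \<le> 56" | "56 \<le> t" "t \<le> 250" | "250 \<le> t" by linarith
  then have "norm (zeta (1 + \<i> * of_real t)) \<le> ln t / 2 + 157 / 100"
    by cases (use norm_zeta_le_small norm_zeta_le_medium norm_zeta_le_large in auto)
  then show "norm (zeta (1 + \<i> * of_real t)) \<le> 1 / 2 * ln t + 1.57" by simp
next
  fix t :: real assume t: "t \<ge> 10 ^ 8"
  have e: "2718 / 1000 \<le> exp (1::real)" "exp (1::real) \<le> 271829 / 100000"
    using e_approx_32 by (auto simp: abs_if split: if_split_asm)
  have e_le: "exp 1 ^ n = exp (real n)" for n by (simp flip: exp_of_nat_mult)
  show "norm (zeta (1 + \<i> * of_real t)) \<le> 1 / 3 * ln t + 2 * ln (ln t) - 1.16"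
  \<comment> \<open>The threshold lies just above \<open>782 ^ 3\<close>, so the block estimate is
    available beyond it.\<close>
  proof (cases "t \<le> 480000000")
    case True
    define L where "L = ln t"
    have L: "12 \<le> L" "L \<le> 20"
    proof -
      have "exp 12 \<le> (271829 / 100000 :: real) ^ 12" unfolding e_le[of 12, simplified, symmetric] using e by (intro power_mono) auto
      also have "\<dots> \<le> 10 ^ 8" by (simp add: power_divide)
      also have "\<dots> \<le> t" by (rule t)
      finally show "12 \<le> L" unfolding L_def using t by (subst ln_ge_iff) auto
      have "t \<le> 480000000" by (rule True)
      also have "\<dots> \<le> (2718 / 1000) ^ 20" by (simp add: power_divide)
      also have "\<dots> \<le> exp 20" unfolding e_le[of 20, simplified, symmetric] using e by (intro power_mono) auto
      finally have "ln t \<le> ln (exp 20)" using t by (intro ln_mono) auto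
      then show "L \<le> 20" by (simp add: L_def)
    qed
    \<comment> \<open>Bounding \<open>ln L\<close> by its tangent in \<open>20 / L\<close> leaves
      this convex function, which takes the value \<open>32 / 6\<close> at both ends 12 and
      20.\<close>
    have "L / 6 + 40 / L \<le> 32 / 6"
    proof -
      have "0 \<le> (20 - L) * (L - 12)" using L by simp
      then show ?thesis using L by (simp add: field_simps)
    qed
    moreover have "ln 20 \<ge> (29957 / 10000 :: real)"
    proof -
      have "exp 3 \<le> (271829 / 100000 :: real) ^ 3" unfolding e_le[of 3, simplified, symmetric] using e by (intro power_mono) auto
      then have "exp 3 / 20 \<le> (10043 / 10000 :: real)" by (simp add: power3_eq_cube)
      moreover have "ln (exp 3 / 20 :: real) = 3 - ln 20" by (simp add: ln_div)
      ultimately show ?thesis using ln_le_minus_one[of "exp 3 / 20 :: real"] by simp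
    qed
    moreover have "ln L \<ge> ln 20 + 1 - 20 / L"
      using ln_le_minus_one[of "20 / L"] L by (simp add: ln_div)
    ultimately have "L / 2 + 149 / 100 \<le> L / 3 + 2 * ln L - 116 / 100" by simp
    then show ?thesis using norm_zeta_le_huge[OF t] by (simp add: L_def)
  next
    case False
    define \<tau> where "\<tau> = root 3 t"
    have \<tau>: "t = \<tau> ^ 3" "782 \<le> \<tau>"
    proof -
      show "t = \<tau> ^ 3" using t by (simp add: \<tau>_def)
      have "root 3 (782 ^ 3) \<le> root 3 t" using False by (intro real_root_le_mono) auto
      then show "782 \<le> \<tau>" unfolding \<tau>_def by (subst (asm) real_root_power_cancel) auto
    qed
    have "19 \<le> ln t"
    proof -
      have "exp 19 \<le> (271829 / 100000 :: real) ^ 19" unfolding e_le[of 19, simplified, symmetric] using e by (intro power_mono) auto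
      also have "\<dots> \<le> 480000000" by (simp add: power_divide)
      also have "\<dots> \<le> t" using False by simp
      finally show ?thesis using t by (subst ln_ge_iff) auto
    qed
    \<comment> \<open>\<open>ln (ln t) >= 2.8\<close> suffices, as
      \<open>2 * 2.8 - 1.16 = 4.44\<close> exceeds \<open>4.4\<close>.\<close>
    moreover have "exp (28 / 10) \<le> (19 :: real)"
    proof -
      have "exp (28 / 10) ^ 5 = (exp 14 :: real)" by (simp flip: exp_of_nat_mult)
      also have "\<dots> \<le> (271829 / 100000) ^ 14" unfolding e_le[of 14, simplified, symmetric] using e by (intro power_mono) auto
      also have "\<dots> \<le> 19 ^ 5" by (simp add: power_divide)
      finally show ?thesis by (rule power_le_imp_le_base[of _ 4, simplified]) auto
    qed
    ultimately have "28 / 10 \<le> ln (ln t)" by (subst ln_ge_iff) auto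
    then show ?thesis using norm_zeta_le_third_derivative[OF \<tau>(2,1)] by simp
  qed
qed

end
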